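(* Let $n\ge 1$ and let $f\in L^1(\mathbb{R}^n)$ satisfy, for some constant $C_0>0$ and some $0<a<1$, the estimates $$|f(x)|\le C_0\, e^{-\frac12 a|x|^2},\qquad |\hat f(x)|\le C_0\, e^{-\frac12 a|x|^2}\qquad (x\in\mathbb{R}^n).$$ Assume further that $f$ is $O(n)$-finite. Let $t>0$ be determined by $a=\tanh(2t)$. Then there is a constant $C>0$, independent of $k$, such that for all $k=0,1,2,\dots$ $$\|P_kf\|_2\le C\,(2k+n)^{\frac{n-2}{4}}\,e^{-(2k+n)t/2}.$$
   Context: The Fourier transform is $\hat f(\xi)=(2\pi)^{-n/2}\int_{\mathbb{R}^n}f(x)e^{-ix\cdot\xi}\,dx$. For $\alpha\in\mathbb{N}^n$ ($\mathbb{N}$ includes $0$), $\Phi_\alpha$ denotes the normalised Hermite function $\Phi_\alpha(x)=\prod_{j=1}^n h_{\alpha_j}(x_j)$, where $h_k(t)=(2^kk!\sqrt{\pi})^{-1/2}H_k(t)e^{-t^2/2}$ and $H_k$ is the $k$-th (physicists') Hermite polynomial; the $\Phi_\alpha$ form an orthonormal basis of $L^2(\mathbb{R}^n)$ of eigenfunctions of $-\Delta+|x|^2$ with eigenvalues $2|\alpha|+n$. For $f\in L^2(\mathbb{R}^n)$, $P_kf=\sum_{|\alpha|=k}(f,\Phi_\alpha)\Phi_\alpha$, with $(\cdot,\cdot)$ the $L^2(\mathbb{R}^n)$ inner product. Let $\{Y_{mj}:1\le j\le d_m,\ m\in\mathbb{N}\}$ be an orthonormal basis of $L^2(S^{n-1})$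 consisting of spherical harmonics ($Y_{mj}$ of degree $m$, $d_m$ the dimension of the space of spherical harmonics of degree $m$). The expansion of $f$ in spherical harmonics is $f(r\omega)=\sum_{m}\sum_{j=1}^{d_m}f_{mj}(r)Y_{mj}(\omega)$, $r>0$, $\omega\in S^{n-1}$. The function $f$ is called $O(n)$-finite if only finitely many terms occur in this expansion, i.e. $f_{mj}=0$ for all but finitely many pairs $(m,j)$. *)

theory Defs
  imports "HOL-Analysis.Analysis" "HOL-Library.Function_Algebras"
begin

definition square_integrable :: "'a measure \<Rightarrow> ('a \<Rightarrow> complex) \<Rightarrow> bool" where
  "square_integrable M f \<longleftrightarrow>
     f \<in> borel_measurable M \<and> integrable M (\<lambda>x. (norm (f x))\<^sup>2)"

definition L2_inner :: "'a measure \<Rightarrow> ('a \<Rightarrow> complex) \<Rightarrow> ('a \<Rightarrow> complex) \<Rightarrow> complex" where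
  "L2_inner M f g = (LINT x|M. f x * cnj (g x))"

definition L2_norm :: "'a measure \<Rightarrow> ('a \<Rightarrow> complex) \<Rightarrow> real" where
  "L2_norm M f = sqrt (LINT x|M. (norm (f x))\<^sup>2)"

definition fourier :: "(real^'n \<Rightarrow> complex) \<Rightarrow> real^'n \<Rightarrow> complex" where
  "fourier f \<xi> = of_real ((2 * pi) powr (- real CARD('n) / 2)) *
     (LINT x|lborel. f x * exp (- \<i> * of_real (x \<bullet> \<xi>)))"

text \<open>The recursion is the one obtained by differentiating the Rodrigues formula
  (lemma \<open>hermite_poly_Rodrigues\<close> below).\<close>

primrec hermite_poly :: "nat \<Rightarrow> real poly" where
  "hermite_poly 0 = 1"
| "hermite_poly (Suc k) = [:0, 2:] * hermite_poly k - pderiv (hermite_poly k)"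

lemma hermite_poly_Rodrigues:
  "poly (hermite_poly k) t = (-1) ^ k * exp (t\<^sup>2) * (deriv ^^ k) (\<lambda>s. exp (- s\<^sup>2)) t"
proof -
  have "(deriv ^^ k) (\<lambda>s. exp (- s\<^sup>2)) =
    (\<lambda>s. (-1) ^ k * (poly (hermite_poly k) s * exp (- s\<^sup>2)))"
  proof (induction k)
    case 0
    show ?case by simp
  next
    case (Suc k)
    have "deriv (\<lambda>s. (-1) ^ k * (poly (hermite_poly k) s * exp (- s\<^sup>2))) s =
      (-1) ^ Suc k * (poly (hermite_poly (Suc k)) s * exp (- s\<^sup>2))" for s :: real
      by (rule DERIV_imp_deriv)
        (auto intro!: derivative_eq_intros simp: algebra_simps)
    then show ?case using Suc.IH by auto
  qed
  then show ?thesis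
    by (simp add: exp_minus field_simps flip: power_mult_distrib)
qed

definition hermite_fun :: "nat \<Rightarrow> real \<Rightarrow> real" where
  "hermite_fun k t =
     (2 ^ k * fact k * sqrt pi) powr (-1/2) * poly (hermite_poly k) t * exp (- t\<^sup>2 / 2)"

text \<open>A multi-index is a function on the coordinate index type, of length \<open>sum \<alpha> UNIV\<close>.\<close>

definition Hermite :: "('n \<Rightarrow> nat) \<Rightarrow> real^'n \<Rightarrow> complex" where
  "Hermite \<alpha> x = of_real (\<Prod>j\<in>UNIV. hermite_fun (\<alpha> j) (x $ j))"

definition hermite_proj :: "nat \<Rightarrow> (real^'n \<Rightarrow> complex) \<Rightarrow> real^'n \<Rightarrow> complex" where
  "hermite_proj k f x =
     (\<Sum>\<alpha> | sum \<alpha> UNIV = k. L2_inner lborel f (Hermite \<alpha>) * Hermite \<alpha> x)"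

text \<open>The surface measure of the unit sphere, defined by
  \<open>\<sigma>(A) = n \<lambda>{r \<omega> | 0 < r < 1, \<omega> \<in> A}\<close>. For \<open>n = 1\<close> it is the counting measure on \<open>{-1, 1}\<close>.
  Its underlying space is the sphere.\<close>

definition sphere_measure :: "(real^'n) measure" where
  "sphere_measure = scale_measure (of_nat CARD('n))
     (distr (restrict_space lborel (ball 0 1 - {0})) (restrict_space borel (sphere 0 1)) sgn)"

lemma sgn_measurable_sphere:
  "(sgn :: real^'n \<Rightarrow> real^'n) \<in>
     restrict_space lborel (ball 0 1 - {0}) \<rightarrow>\<^sub>M restrict_space borel (sphere 0 1)"
proof (rule measurable_restrict_space2)
  show "(sgn :: real^'n \<Rightarrow> real^'n) \<in> space (restrict_space lborel (ball 0 1 - {0})) \<rightarrow> sphere 0 1"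
    by (auto simp: space_restrict_space norm_sgn)
  have "(\<lambda>x :: real^'n. x /\<^sub>R norm x) \<in> borel_measurable borel"
    by measurable
  then show "(sgn :: real^'n \<Rightarrow> real^'n) \<in> borel_measurable (restrict_space lborel (ball 0 1 - {0}))"
    by (intro measurable_restrict_space1) (simp add: sgn_div_norm[abs_def])
qed

definition homogeneous_poly_fun :: "nat \<Rightarrow> (real^'n \<Rightarrow> complex) \<Rightarrow> bool" where
  "homogeneous_poly_fun m p \<longleftrightarrow>
     (\<exists>c. \<forall>x. p x = (\<Sum>\<alpha> | sum \<alpha> UNIV = m. c \<alpha> * of_real (\<Prod>j\<in>UNIV. (x $ j) ^ \<alpha> j)))"

definition partial_deriv :: "'n \<Rightarrow> (real^'n \<Rightarrow> complex) \<Rightarrow> real^'n \<Rightarrow> complex" where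
  "partial_deriv j p x = frechet_derivative p (at x) (axis j 1)"

definition laplacian :: "(real^'n \<Rightarrow> complex) \<Rightarrow> real^'n \<Rightarrow> complex" where
  "laplacian p x = (\<Sum>j\<in>UNIV. partial_deriv j (partial_deriv j p) x)"

text \<open>A function on the sphere is represented by its extension by zero, so that the
  spherical harmonics of degree \<open>m\<close> form a linear subspace of the complex vector space of all
  functions on \<open>real^'n\<close>.\<close>

definition spherical_harmonics :: "nat \<Rightarrow> (real^'n \<Rightarrow> complex) set" where
  "spherical_harmonics m =
     {Y. \<exists>p. homogeneous_poly_fun m p \<and> (\<forall>x. laplacian p x = 0) \<and>
             Y = (\<lambda>x. if x \<in> sphere 0 1 then p x else 0)}"

interpretation cfun: vector_space "\<lambda>(c::complex) (f :: 'a \<Rightarrow> complex) x. c * f x"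
  by unfold_locales (auto simp: fun_eq_iff algebra_simps)

text \<open>\<open>d m\<close> is the dimension of the space of spherical harmonics of degree \<open>m\<close> and the index
  set of the basis is \<open>{(m, j). 1 \<le> j \<le> d m}\<close>.
  For \<open>n = 1\<close> one has \<open>d 0 = d 1 = 1\<close> and \<open>d m = 0\<close> for \<open>m \<ge> 2\<close>.\<close>

definition index_pairs :: "(nat \<Rightarrow> nat) \<Rightarrow> (nat \<times> nat) set" where
  "index_pairs d = {(m, j). 1 \<le> j \<and> j \<le> d m}"

definition spherical_harmonic_basis ::
    "(nat \<Rightarrow> nat) \<Rightarrow> (nat \<Rightarrow> nat \<Rightarrow> real^'n \<Rightarrow> complex) \<Rightarrow> bool" where
  "spherical_harmonic_basis d Y \<longleftrightarrow>
     (\<forall>m. d m = cfun.dim (spherical_harmonics m :: (real^'n \<Rightarrow> complex) set)) \<and>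
     (\<forall>(m, j)\<in>index_pairs d. Y m j \<in> spherical_harmonics m) \<and>
     (\<forall>(m, j)\<in>index_pairs d. \<forall>(m', j')\<in>index_pairs d.
        L2_inner sphere_measure (Y m j) (Y m' j') = (if (m, j) = (m', j') then 1 else 0)) \<and>
     (\<forall>g. square_integrable sphere_measure g \<longrightarrow>
        ((\<lambda>F. L2_norm sphere_measure
            (\<lambda>\<omega>. g \<omega> - (\<Sum>(m, j)\<in>F. L2_inner sphere_measure g (Y m j) * Y m j \<omega>)))
          \<longlongrightarrow> 0) (finite_subsets_at_top (index_pairs d)))"

definition spherical_coeff ::
    "(nat \<Rightarrow> nat \<Rightarrow> real^'n \<Rightarrow> complex) \<Rightarrow> (real^'n \<Rightarrow> complex) \<Rightarrow> nat \<Rightarrow> nat \<Rightarrow> real \<Rightarrow> complex"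
  where "spherical_coeff Y f m j r = L2_inner sphere_measure (\<lambda>\<omega>. f (r *\<^sub>R \<omega>)) (Y m j)"

text \<open>For integrable \<open>f\<close> the coefficients are defined for almost every \<open>r > 0\<close>, and their
  vanishing is understood almost everywhere.\<close>

definition On_finite ::
    "(nat \<Rightarrow> nat) \<Rightarrow> (nat \<Rightarrow> nat \<Rightarrow> real^'n \<Rightarrow> complex) \<Rightarrow> (real^'n \<Rightarrow> complex) \<Rightarrow> bool" where
  "On_finite d Y f \<longleftrightarrow>
     finite {(m, j) \<in> index_pairs d. \<not> (AE r in lborel. 0 < r \<longrightarrow> spherical_coeff Y f m j r = 0)}"

end

theory Submission
  imports Defs "HOL-Probability.Probability" "HOL-Complex_Analysis.Complex_Analysis"
begin

text \<open>Let \<open>m\<close> be the degree of a harmonic polynomial \<open>p\<close>, and put \<open>R = exp (2t)\<close>. The inner products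
  of \<open>f\<close> with \<open>L\<^sub>l(|x|\<^sup>2) p(x) exp (-|x|\<^sup>2/2)\<close>, where \<open>L\<^sub>l\<close> is the Laguerre polynomial of parameter
  \<open>m + n/2 - 1\<close>, are the Taylor coefficients of
  \<open>G(w) = (1 - w)\<^bsup>-m-n/2\<^esup> \<integral> f(x) p(x) exp (-|x|\<^sup>2 (1 + w) / (2 (1 - w))) dx\<close>. The Gaussian bound for \<open>f\<close>
  makes \<open>G\<close> holomorphic, with a growth estimate, on the disc with diameter \<open>(-R\<^sup>2, 1)\<close>. By the
  Hecke--Bochner identity the Fourier transform turns \<open>G(w)\<close> into a multiple of \<open>G(-w)\<close>, so the bound
  for the transform gives the same on the mirror image of that disc. The two discs cover \<open>|w| < R\<close>, and
  of the circle \<open>|w| = R\<close> they miss only the points \<open>iR\<close> and \<open>-iR\<close>. Cauchy's estimate for \<open>G'\<close> on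
  circles of radius close to \<open>R\<close> therefore loses only a power of \<open>l\<close> against \<open>R\<^bsup>-l\<^esup>\<close>. Finally,
  \<open>\<parallel>P\<^sub>k f\<parallel>\<^sup>2 = (f, P\<^sub>k f)\<close>, and in the Fischer decomposition of the polynomial behind \<open>P\<^sub>k f\<close> only
  boundedly many harmonic components pair nontrivially with an \<open>O(n)\<close>-finite \<open>f\<close>.\<close>

section \<open>Homogeneous polynomials and the Fischer decomposition\<close>

text \<open>For \<open>p\<close> harmonic of degree \<open>m\<close>, the component |x|^(2l) p pairs
  with \<open>f\<close> to order l! (l+1)^((m+n)/2-1) R^(-l), and its norm has order sqrt (l!
  (m+n/2)_l). In the quotient \<open>m\<close> cancels from the power of l and (n-2)/4 remains,
  while k = m + 2l turns R^(-l) = exp (-2tl) into exp (-tk) up to the factor exp (tm). The constants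
  depend on \<open>m\<close> without control, which is why finitely many degrees are wanted. The
  obstacle is the loss in Cauchy's estimate. Near iR and -iR the bound for G blows up with exponent
  (m+n)/2, and a supremum over the circle would cost that full power. The mean over the circle gains
  one power, because the bound degenerates only at these two points, like a simple zero of the
  cosine. This needs an exponent above 1, whereas (m+n)/2 can be 1/2 or 1. Passing to G' raises the
  exponent by one, and dividing the coefficient by l takes the extra power back. The value R = exp
  (2t) is forced: s = (1+w)/(1-w) maps the disc of diameter (-R^2, 1) onto the half-plane Re s > -a
  exactly when a = (R^2-1)/(R^2+1) = tanh (2t).\<close>

definition monom_fun :: "('n \<Rightarrow> nat) \<Rightarrow> real^'n \<Rightarrow> complex" where
  "monom_fun \<alpha> x = of_real (\<Prod>j\<in>UNIV. (x $ j) ^ \<alpha> j)"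

lemma finite_multiindices: "finite {\<alpha> :: 'n::finite \<Rightarrow> nat. sum \<alpha> UNIV = k}"
proof (rule finite_subset)
  show "{\<alpha> :: 'n \<Rightarrow> nat. sum \<alpha> UNIV = k} \<subseteq> PiE UNIV (\<lambda>_. {..k})"
    by (auto simp: PiE_def) (metis UNIV_I finite_code member_le_sum zero_le)
qed (auto intro: finite_PiE)

lemma homogeneous_poly_fun_iff:
  "homogeneous_poly_fun k p \<longleftrightarrow> (\<exists>c. p = (\<lambda>x. \<Sum>\<alpha> | sum \<alpha> UNIV = k. c \<alpha> * monom_fun \<alpha> x))"
  by (auto simp: homogeneous_poly_fun_def monom_fun_def fun_eq_iff)

lemma homogeneous_monom_fun: "homogeneous_poly_fun (sum \<alpha> UNIV) (monom_fun \<alpha>)"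
  unfolding homogeneous_poly_fun_iff
proof (intro exI ext)
  fix x
  show "monom_fun \<alpha> x = (\<Sum>\<beta> | sum \<beta> UNIV = sum \<alpha> UNIV. (if \<beta> = \<alpha> then 1 else 0) * monom_fun \<beta> x)"
    using sum.delta'[OF finite_multiindices[of "sum \<alpha> UNIV"], of \<alpha> "\<lambda>\<beta>. monom_fun \<beta> x"]
    by (simp add: if_distrib if_distribR eq_commute cong: if_cong)
qed

lemma homogeneous_0: "homogeneous_poly_fun k (\<lambda>_. 0)"
  unfolding homogeneous_poly_fun_iff by (rule exI[of _ "\<lambda>_. 0"]) simp

lemma homogeneous_add:
  assumes "homogeneous_poly_fun k p" "homogeneous_poly_fun k q"
  shows "homogeneous_poly_fun k (\<lambda>x. p x + q x)"
proof -
  from assms obtain c d where "p = (\<lambda>x. \<Sum>\<alpha> | sum \<alpha> UNIV = k. c \<alpha> * monom_fun \<alpha> x)"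
    "q = (\<lambda>x. \<Sum>\<alpha> | sum \<alpha> UNIV = k. d \<alpha> * monom_fun \<alpha> x)"
    unfolding homogeneous_poly_fun_iff by blast
  then have "(\<lambda>x. p x + q x) = (\<lambda>x. \<Sum>\<alpha> | sum \<alpha> UNIV = k. (c \<alpha> + d \<alpha>) * monom_fun \<alpha> x)"
    by (simp add: sum.distrib algebra_simps)
  then show ?thesis
    unfolding homogeneous_poly_fun_iff by (intro exI[of _ "\<lambda>\<alpha>. c \<alpha> + d \<alpha>"])
qed

lemma homogeneous_cmult:
  assumes "homogeneous_poly_fun k p"
  shows "homogeneous_poly_fun k (\<lambda>x. c * p x)"
proof -
  from assms obtain d where "p = (\<lambda>x. \<Sum>\<alpha> | sum \<alpha> UNIV = k. d \<alpha> * monom_fun \<alpha> x)"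
    unfolding homogeneous_poly_fun_iff by blast
  then have "(\<lambda>x. c * p x) = (\<lambda>x. \<Sum>\<alpha> | sum \<alpha> UNIV = k. (c * d \<alpha>) * monom_fun \<alpha> x)"
    by (simp add: sum_distrib_left algebra_simps)
  then show ?thesis
    unfolding homogeneous_poly_fun_iff by (intro exI[of _ "\<lambda>\<alpha>. c * d \<alpha>"])
qed

lemma homogeneous_sum:
  assumes "\<And>i. i \<in> I \<Longrightarrow> homogeneous_poly_fun k (p i)"
  shows "homogeneous_poly_fun k (\<lambda>x. \<Sum>i\<in>I. p i x)"
  using assms by (induction I rule: infinite_finite_induct) (auto intro: homogeneous_0 homogeneous_add)

lemma homogeneous_diff:
  assumes "homogeneous_poly_fun k p" "homogeneous_poly_fun k q"
  shows "homogeneous_poly_fun k (\<lambda>x. p x - q x)"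
  using homogeneous_add[OF assms(1) homogeneous_cmult[OF assms(2), of "-1"]] by simp

lemma homogeneous_cnj:
  assumes "homogeneous_poly_fun k p"
  shows "homogeneous_poly_fun k (\<lambda>x. cnj (p x))"
proof -
  from assms obtain d where "p = (\<lambda>x. \<Sum>\<alpha> | sum \<alpha> UNIV = k. d \<alpha> * monom_fun \<alpha> x)"
    unfolding homogeneous_poly_fun_iff by blast
  then have "(\<lambda>x. cnj (p x)) = (\<lambda>x. \<Sum>\<alpha> | sum \<alpha> UNIV = k. cnj (d \<alpha>) * monom_fun \<alpha> x)"
    by (simp add: monom_fun_def)
  then show ?thesis
    unfolding homogeneous_poly_fun_iff by (intro exI[of _ "\<lambda>\<alpha>. cnj (d \<alpha>)"])
qed

text \<open>Properties linear in \<open>p\<close> need checking only on monomials. Homogeneity is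
  handed to the cases \<open>add\<close> and \<open>cmult\<close> because
  \<open>partial_deriv\<close> and \<open>laplacian\<close> are linear only on differentiable
  functions.\<close>

lemma homogeneous_induct [consumes 1, case_names monom zero add cmult]:
  assumes hom: "homogeneous_poly_fun k p"
    and mono: "\<And>\<alpha>. sum \<alpha> UNIV = k \<Longrightarrow> P (monom_fun \<alpha>)"
    and zero: "P (\<lambda>_. 0)"
    and add: "\<And>p q. homogeneous_poly_fun k p \<Longrightarrow> P p \<Longrightarrow> homogeneous_poly_fun k q \<Longrightarrow> P q
      \<Longrightarrow> P (\<lambda>x. p x + q x)"
    and cmult: "\<And>c p. homogeneous_poly_fun k p \<Longrightarrow> P p \<Longrightarrow> P (\<lambda>x. c * p x)"
  shows "P p"
proof -
  obtain c where p: "p = (\<lambda>x. \<Sum>\<alpha> | sum \<alpha> UNIV = k. c \<alpha> * monom_fun \<alpha> x)"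
    using hom unfolding homogeneous_poly_fun_iff by blast
  have "S \<subseteq> {\<alpha>. sum \<alpha> UNIV = k} \<Longrightarrow> P (\<lambda>x. \<Sum>\<alpha>\<in>S. c \<alpha> * monom_fun \<alpha> x)" if "finite S" for S
    using that
  proof (induction S)
    case empty
    then show ?case using zero by simp
  next
    case (insert \<alpha> S)
    have h: "homogeneous_poly_fun k (monom_fun \<beta>)" if "\<beta> \<in> insert \<alpha> S" for \<beta>
      using homogeneous_monom_fun[of \<beta>] insert.prems that by auto
    have "P (\<lambda>x. c \<alpha> * monom_fun \<alpha> x + (\<Sum>\<alpha>\<in>S. c \<alpha> * monom_fun \<alpha> x))"
      using insert h by (intro add cmult mono homogeneous_cmult homogeneous_sum) auto
    then show ?case using insert by simp
  qed
  from this[OF finite_multiindices subset_refl] show ?thesis using p by simp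
qed

section \<open>Partial derivatives of homogeneous polynomials\<close>

lemma has_derivative_monom_fun: "\<exists>D. (monom_fun \<alpha> has_derivative D) (at x)"
proof -
  have "((\<lambda>x :: real^'a. \<Prod>j\<in>UNIV. (x $ j) ^ \<alpha> j) has_derivative
      (\<lambda>y. \<Sum>i\<in>UNIV. (of_nat (\<alpha> i) * (y $ i) * (x $ i) ^ (\<alpha> i - 1)) * (\<Prod>j\<in>UNIV - {i}. (x $ j) ^ \<alpha> j))) (at x)"
    by (intro has_derivative_prod has_derivative_power bounded_linear_imp_has_derivative bounded_linear_vec_nth)
  from bounded_linear.has_derivative[OF bounded_linear_of_real this]
  show ?thesis unfolding monom_fun_def[abs_def] by blast
qed

lemma homogeneous_differentiable:
  assumes "homogeneous_poly_fun k p"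
  shows "p differentiable (at x)"
  using assms
  by (induction rule: homogeneous_induct)
     (use has_derivative_monom_fun in \<open>auto simp: differentiable_def
        intro: has_derivative_add has_derivative_mult_right\<close>)

lemma homogeneous_continuous:
  assumes "homogeneous_poly_fun k p"
  shows "continuous_on UNIV p"
  using homogeneous_differentiable[OF assms]
  by (simp add: continuous_at_imp_continuous_on differentiable_imp_continuous_within)

lemma homogeneous_measurable:
  assumes "homogeneous_poly_fun k p"
  shows "p \<in> borel_measurable borel"
  using homogeneous_continuous[OF assms] by (rule borel_measurable_continuous_onI)

lemma homogeneous_scaleR:
  assumes "homogeneous_poly_fun k p"
  shows "p (r *\<^sub>R x) = of_real r ^ k * p x"
  using assms
  by (induction rule: homogeneous_induct)
     (auto simp: monom_fun_def power_mult_distrib prod.distrib power_sum algebra_simps)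

text \<open>Separates existence from value: once the Frechet derivative is known to exist, a
  one-variable derivative along the axis computes its entry.\<close>

lemma partial_deriv_eqI:
  assumes "p differentiable (at x)"
    and "((\<lambda>t. p (x + t *\<^sub>R axis j 1)) has_vector_derivative D) (at 0)"
  shows "partial_deriv j p x = D"
proof -
  have "(p has_derivative frechet_derivative p (at x)) (at x)"
    using assms(1) frechet_derivative_works by blast
  then have "(p has_derivative frechet_derivative p (at x)) (at (x + 0 *\<^sub>R axis j 1))"
    by simp
  moreover have "((\<lambda>t. x + t *\<^sub>R axis j 1) has_derivative (\<lambda>t. t *\<^sub>R axis j 1)) (at 0)"
    by (auto intro!: derivative_eq_intros)
  ultimately have "((\<lambda>t. p (x + t *\<^sub>R axis j 1)) has_derivative
      (\<lambda>t. frechet_derivative p (at x) (t *\<^sub>R axis j 1))) (at 0)"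
    using has_derivative_compose by fastforce
  moreover have "linear (frechet_derivative p (at x))"
    using assms(1) by (rule linear_frechet_derivative)
  ultimately have "((\<lambda>t. p (x + t *\<^sub>R axis j 1)) has_vector_derivative
      frechet_derivative p (at x) (axis j 1)) (at 0)"
    by (simp add: has_vector_derivative_def linear_cmul)
  with assms(2) show ?thesis
    unfolding partial_deriv_def using vector_derivative_unique_at by blast
qed

lemma partial_deriv_add:
  assumes "p differentiable (at x)" "q differentiable (at x)"
  shows "partial_deriv j (\<lambda>x. p x + q x) x = partial_deriv j p x + partial_deriv j q x"
proof -
  have "((\<lambda>x. p x + q x) has_derivative
      (\<lambda>h. frechet_derivative p (at x) h + frechet_derivative q (at x) h)) (at x)"
    using assms by (auto intro!: has_derivative_add simp: frechet_derivative_works)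
  from frechet_derivative_at[OF this, symmetric] show ?thesis
    by (simp add: partial_deriv_def)
qed

lemma partial_deriv_mult:
  fixes p q :: "real^'n \<Rightarrow> complex"
  assumes "p differentiable (at x)" "q differentiable (at x)"
  shows "partial_deriv j (\<lambda>x. p x * q x) x = p x * partial_deriv j q x + partial_deriv j p x * q x"
proof -
  have "((\<lambda>x. p x * q x) has_derivative
      (\<lambda>h. p x * frechet_derivative q (at x) h + frechet_derivative p (at x) h * q x)) (at x)"
    using assms by (auto intro!: has_derivative_mult simp: frechet_derivative_works)
  from frechet_derivative_at[OF this, symmetric] show ?thesis
    by (simp add: partial_deriv_def)
qed

lemma partial_deriv_const: "partial_deriv j (\<lambda>_. c) x = 0"
  by (simp add: partial_deriv_def)

lemma partial_deriv_cmult: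
  assumes "p differentiable (at x)"
  shows "partial_deriv j (\<lambda>x. c * p x) x = c * partial_deriv j p x"
  using partial_deriv_mult[OF _ assms, of "\<lambda>_. c"] by (simp add: partial_deriv_const)

lemma differentiable_coord: "(\<lambda>x :: real^'n. complex_of_real (x $ i)) differentiable (at x)"
  by (intro bounded_linear_imp_differentiable bounded_linear_compose[OF bounded_linear_of_real bounded_linear_vec_nth])

lemma partial_deriv_coord:
  "partial_deriv j (\<lambda>x :: real^'n. complex_of_real (x $ i)) x = (if i = j then 1 else 0)"
proof (rule partial_deriv_eqI[OF differentiable_coord])
  have "((\<lambda>t. complex_of_real (x $ i) + of_real t * (if i = j then 1 else 0)) has_vector_derivative
      (if i = j then 1 else 0)) (at 0)"
    by (auto intro!: derivative_eq_intros simp: has_vector_derivative_def scaleR_conv_of_real fun_eq_iff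
        bounded_linear_imp_has_derivative[OF bounded_linear_of_real])
  then show "((\<lambda>t. complex_of_real ((x + t *\<^sub>R axis j 1) $ i)) has_vector_derivative
      (if i = j then 1 else 0)) (at 0)"
    by (auto simp: axis_def)
qed

text \<open>For \<open>\<alpha> j = 0\<close> the truncated exponent \<open>\<alpha> j - 1\<close>
  is harmless, because the factor \<open>of_nat (\<alpha> j)\<close> vanishes.\<close>

lemma partial_deriv_monom_fun:
  "partial_deriv j (monom_fun \<alpha>) = (\<lambda>x. of_nat (\<alpha> j) * monom_fun (\<alpha>(j := \<alpha> j - 1)) x)"
proof (rule ext, rule partial_deriv_eqI)
  fix x :: "real^'a"
  show "monom_fun \<alpha> differentiable at x"
    using has_derivative_monom_fun differentiable_def by blast
  have split: "(\<Prod>i\<in>UNIV. h i) = h j * (\<Prod>i\<in>UNIV - {j}. h i)" for h :: "'a \<Rightarrow> real"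
    by (rule prod.remove) auto
  have eq: "(\<lambda>t. monom_fun \<alpha> (x + t *\<^sub>R axis j 1)) =
      (\<lambda>t. of_real ((x $ j + t) ^ \<alpha> j * (\<Prod>i\<in>UNIV - {j}. (x $ i) ^ \<alpha> i)))"
    unfolding monom_fun_def by (subst split) (auto simp: axis_def intro!: ext prod.cong)
  have eq2: "of_nat (\<alpha> j) * monom_fun (\<alpha>(j := \<alpha> j - 1)) x =
      complex_of_real (of_nat (\<alpha> j) * (x $ j) ^ (\<alpha> j - 1) * (\<Prod>i\<in>UNIV - {j}. (x $ i) ^ \<alpha> i))"
    unfolding monom_fun_def by (subst split) (auto intro!: prod.cong)
  have "((\<lambda>t. (x $ j + t) ^ \<alpha> j * (\<Prod>i\<in>UNIV - {j}. (x $ i) ^ \<alpha> i)) has_real_derivative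
      (of_nat (\<alpha> j) * (x $ j) ^ (\<alpha> j - 1) * (\<Prod>i\<in>UNIV - {j}. (x $ i) ^ \<alpha> i))) (at 0)"
    by (auto intro!: derivative_eq_intros)
  then show "((\<lambda>t. monom_fun \<alpha> (x + t *\<^sub>R axis j 1)) has_vector_derivative
      of_nat (\<alpha> j) * monom_fun (\<alpha>(j := \<alpha> j - 1)) x) (at 0)"
    unfolding eq eq2 by (rule has_vector_derivative_of_real)
qed

lemma coord_mult_monom_fun:
  "of_real (x $ j) * monom_fun \<alpha> x = monom_fun (\<alpha>(j := Suc (\<alpha> j))) x"
proof -
  have split: "(\<Prod>i\<in>UNIV. h i) = h j * (\<Prod>i\<in>UNIV - {j}. h i)" for h :: "'a \<Rightarrow> real"
    by (rule prod.remove) auto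
  show ?thesis
    unfolding monom_fun_def by (subst (1 2) split) (auto intro!: prod.cong)
qed

lemma sum_upd_Suc: "sum (\<alpha>(j := Suc (\<alpha> j))) UNIV = Suc (sum \<alpha> (UNIV :: 'n::finite set))"
proof -
  have "sum (\<alpha>(j := Suc (\<alpha> j))) (UNIV - {j}) = sum \<alpha> (UNIV - {j})"
    by (intro sum.cong) auto
  then show ?thesis using sum.remove[of UNIV j "\<alpha>(j := Suc (\<alpha> j))"] sum.remove[of UNIV j \<alpha>] by simp
qed

lemma sum_upd_pred: "sum ((\<alpha> :: 'n \<Rightarrow> nat)(j := \<alpha> j - 1)) (UNIV :: 'n::finite set) = sum \<alpha> UNIV - 1" if "\<alpha> j > 0"
proof -
  have "sum (\<alpha>(j := \<alpha> j - 1)) (UNIV - {j}) = sum \<alpha> (UNIV - {j})"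
    by (intro sum.cong) auto
  then show ?thesis
    using that sum.remove[of UNIV j "\<alpha>(j := \<alpha> j - 1)"] sum.remove[of UNIV j \<alpha>] by simp
qed

lemma homogeneous_coord_mult:
  assumes "homogeneous_poly_fun k p"
  shows "homogeneous_poly_fun (Suc k) (\<lambda>x. of_real (x $ j) * p x)"
  using assms
proof (induction rule: homogeneous_induct)
  case (monom \<alpha>)
  then show ?case using homogeneous_monom_fun[of "\<alpha>(j := Suc (\<alpha> j))"]
    by (simp add: coord_mult_monom_fun sum_upd_Suc del: fun_upd_apply)
next
  case (add p q)
  then show ?case using homogeneous_add[OF add(3) add(4)] by (simp add: algebra_simps)
next
  case (cmult c p)
  then show ?case using homogeneous_cmult[OF cmult(2), of c] by (simp add: algebra_simps)
qed (simp add: homogeneous_0)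

text \<open>At k = 0 the truncated degree k - 1 is still correct: the derivative is then the zero
  function, which is homogeneous of every degree.\<close>

lemma homogeneous_partial_deriv:
  assumes "homogeneous_poly_fun k p"
  shows "homogeneous_poly_fun (k - 1) (partial_deriv j p)"
  using assms
proof (induction rule: homogeneous_induct)
  case (monom \<alpha>)
  show ?case
  proof (cases "\<alpha> j")
    case 0
    then show ?thesis by (simp add: partial_deriv_monom_fun homogeneous_0)
  next
    case (Suc i)
    then show ?thesis
      using homogeneous_monom_fun[of "\<alpha>(j := \<alpha> j - 1)"] sum_upd_pred[of \<alpha> j] monom
      by (simp add: partial_deriv_monom_fun homogeneous_cmult del: fun_upd_apply)
  qed
next
  case (add p q)
  then have "partial_deriv j (\<lambda>x. p x + q x) = (\<lambda>x. partial_deriv j p x + partial_deriv j q x)"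
    by (auto intro!: partial_deriv_add homogeneous_differentiable)
  then show ?case using homogeneous_add[OF add(3) add(4)] by simp
next
  case (cmult c p)
  then have "partial_deriv j (\<lambda>x. c * p x) = (\<lambda>x. c * partial_deriv j p x)"
    by (auto intro!: partial_deriv_cmult homogeneous_differentiable)
  then show ?case using homogeneous_cmult[OF cmult(2), of c] by simp
next
  case zero
  then show ?case by (simp add: partial_deriv_const[abs_def] homogeneous_0)
qed

lemma partial_deriv_hom_add:
  assumes "homogeneous_poly_fun k p" "homogeneous_poly_fun l q"
  shows "partial_deriv j (\<lambda>x. p x + q x) = (\<lambda>x. partial_deriv j p x + partial_deriv j q x)"
  using assms by (auto intro!: partial_deriv_add homogeneous_differentiable)

lemma partial_deriv_hom_cmult:
  assumes "homogeneous_poly_fun k p"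
  shows "partial_deriv j (\<lambda>x. c * p x) = (\<lambda>x. c * partial_deriv j p x)"
  using assms by (auto intro!: partial_deriv_cmult homogeneous_differentiable)

lemma partial_deriv_coord_mult:
  assumes "homogeneous_poly_fun k p"
  shows "partial_deriv i (\<lambda>x. of_real (x $ j) * p x) =
    (\<lambda>x. of_real (x $ j) * partial_deriv i p x + (if i = j then p x else 0))"
  by (rule ext, subst partial_deriv_mult)
     (auto simp: partial_deriv_coord intro!: differentiable_coord homogeneous_differentiable[OF assms])

lemma partial_deriv_commute:
  assumes "homogeneous_poly_fun k p"
  shows "partial_deriv i (partial_deriv j p) = partial_deriv j (partial_deriv i p)"
  using assms
proof (induction rule: homogeneous_induct)
  case (monom \<alpha>)
  show ?case
  proof (cases "i = j")
    case False
    have "partial_deriv i (\<lambda>x. of_nat (\<alpha> j) * monom_fun (\<alpha>(j := \<alpha> j - 1)) x) =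
      (\<lambda>x. of_nat (\<alpha> j) * (of_nat (\<alpha> i) * monom_fun (\<alpha>(j := \<alpha> j - 1, i := \<alpha> i - 1)) x))"
      using False
      by (subst partial_deriv_hom_cmult[OF homogeneous_monom_fun]) (simp add: partial_deriv_monom_fun)
    moreover have "partial_deriv j (\<lambda>x. of_nat (\<alpha> i) * monom_fun (\<alpha>(i := \<alpha> i - 1)) x) =
      (\<lambda>x. of_nat (\<alpha> i) * (of_nat (\<alpha> j) * monom_fun (\<alpha>(i := \<alpha> i - 1, j := \<alpha> j - 1)) x))"
      using False
      by (subst partial_deriv_hom_cmult[OF homogeneous_monom_fun]) (simp add: partial_deriv_monom_fun)
    ultimately show ?thesis
      using False by (simp add: partial_deriv_monom_fun fun_upd_twist[OF False] mult.left_commute)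
  qed simp
next
  case (add p q)
  then show ?case
    by (simp add: partial_deriv_hom_add[of k p k q] partial_deriv_hom_add[OF homogeneous_partial_deriv homogeneous_partial_deriv, of k p k q])
next
  case (cmult c p)
  then show ?case
    by (simp add: partial_deriv_hom_cmult[of k p] partial_deriv_hom_cmult[OF homogeneous_partial_deriv, of k p])
qed (simp add: partial_deriv_const[abs_def])

text \<open>Each monomial is an eigenvector of x_j d/dx_j with eigenvalue \<open>\<alpha> j\<close>,
  and these eigenvalues add up to \<open>k\<close>.\<close>

lemma euler_homogeneous:
  assumes "homogeneous_poly_fun k p"
  shows "(\<Sum>j\<in>UNIV. of_real (x $ j) * partial_deriv j p x) = of_nat k * p x"
  using assms
proof (induction rule: homogeneous_induct)
  case (monom \<alpha>)
  have "of_real (x $ j) * partial_deriv j (monom_fun \<alpha>) x = of_nat (\<alpha> j) * monom_fun \<alpha> x" for j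
  proof (cases "\<alpha> j")
    case (Suc i)
    then show ?thesis
      using coord_mult_monom_fun[of x j "\<alpha>(j := \<alpha> j - 1)"]
      by (simp add: partial_deriv_monom_fun algebra_simps fun_upd_idem)
  qed (simp add: partial_deriv_monom_fun)
  then show ?case
    using monom by (simp flip: sum_distrib_right of_nat_sum)
next
  case (add p q)
  then show ?case
    by (simp add: partial_deriv_hom_add[of k p k q] algebra_simps sum.distrib)
next
  case (cmult c p)
  have "(\<Sum>j\<in>UNIV. of_real (x $ j) * (c * partial_deriv j p x)) = c * (of_nat k * p x)"
    by (simp flip: cmult(2) add: sum_distrib_left algebra_simps)
  then show ?case using cmult(1)
    by (simp add: partial_deriv_hom_cmult[of k p] algebra_simps)
qed (simp add: partial_deriv_const)

section \<open>The Laplacian and its commutation with multiplication by |x|^2\<close>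

lemma homogeneous_laplacian:
  assumes "homogeneous_poly_fun k p"
  shows "homogeneous_poly_fun (k - 2) (laplacian p)"
proof -
  have "homogeneous_poly_fun (k - 1 - 1) (partial_deriv j (partial_deriv j p))" for j
    by (intro homogeneous_partial_deriv assms)
  then show ?thesis
    unfolding laplacian_def[abs_def] by (intro homogeneous_sum) (simp add: numeral_2_eq_2)
qed

lemma laplacian_zero: "laplacian (\<lambda>_. 0) = (\<lambda>_. 0)"
  by (simp add: laplacian_def fun_eq_iff partial_deriv_const[abs_def])

lemma laplacian_add:
  assumes "homogeneous_poly_fun k p" "homogeneous_poly_fun l q"
  shows "laplacian (\<lambda>x. p x + q x) = (\<lambda>x. laplacian p x + laplacian q x)"
  by (simp add: laplacian_def[abs_def] partial_deriv_hom_add[OF assms] sum.distrib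
      partial_deriv_hom_add[OF assms[THEN homogeneous_partial_deriv]])

lemma laplacian_cmult:
  assumes "homogeneous_poly_fun k p"
  shows "laplacian (\<lambda>x. c * p x) = (\<lambda>x. c * laplacian p x)"
  by (simp add: laplacian_def[abs_def] partial_deriv_hom_cmult[OF assms] sum_distrib_left
      partial_deriv_hom_cmult[OF assms[THEN homogeneous_partial_deriv]])

lemma laplacian_diff:
  assumes "homogeneous_poly_fun k p" "homogeneous_poly_fun l q"
  shows "laplacian (\<lambda>x. p x - q x) = (\<lambda>x. laplacian p x - laplacian q x)"
  using laplacian_add[OF assms(1) homogeneous_cmult[OF assms(2), of "-1"]]
    laplacian_cmult[OF assms(2), of "-1"] by (simp add: fun_eq_iff)

lemma laplacian_sum:
  assumes "\<And>i. i \<in> I \<Longrightarrow> homogeneous_poly_fun k (p i)"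
  shows "laplacian (\<lambda>x. \<Sum>i\<in>I. p i x) = (\<lambda>x. \<Sum>i\<in>I. laplacian (p i) x)"
  using assms
proof (induction I rule: infinite_finite_induct)
  case (insert i I)
  then show ?case
    using laplacian_add[of k "p i" k "\<lambda>x. \<Sum>i\<in>I. p i x"] by (simp add: homogeneous_sum)
qed (simp_all add: laplacian_zero)

text \<open>The commutator of the Laplacian with x_j is twice the j-th partial derivative. The
  commutators of the Laplacian with |x|^2 and of its powers with x_j are built from this
  one.\<close>

lemma laplacian_coord_mult:
  assumes p: "homogeneous_poly_fun k p"
  shows "laplacian (\<lambda>x. of_real (x $ j) * p x) =
    (\<lambda>x. of_real (x $ j) * laplacian p x + 2 * partial_deriv j p x)"
proof
  fix x
  have "partial_deriv i (partial_deriv i (\<lambda>x. of_real (x $ j) * p x)) x =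
    of_real (x $ j) * partial_deriv i (partial_deriv i p) x + (if i = j then 2 * partial_deriv j p x else 0)" for i
  proof -
    have *: "homogeneous_poly_fun (Suc (k - 1)) (\<lambda>x. of_real (x $ j) * partial_deriv i p x)"
      by (intro homogeneous_coord_mult homogeneous_partial_deriv p)
    have **: "homogeneous_poly_fun k (\<lambda>x. if i = j then p x else 0)"
      using p by (cases "i = j") (simp_all add: homogeneous_0)
    show ?thesis
      by (auto simp: partial_deriv_coord_mult[OF p] partial_deriv_hom_add[OF * **] partial_deriv_const
          partial_deriv_coord_mult[OF homogeneous_partial_deriv[OF p]])
  qed
  then show "laplacian (\<lambda>x. of_real (x $ j) * p x) x =
    of_real (x $ j) * laplacian p x + 2 * partial_deriv j p x"
    by (simp add: laplacian_def sum.distrib sum_distrib_left)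
qed

lemma partial_deriv_laplacian:
  assumes p: "homogeneous_poly_fun k p"
  shows "partial_deriv j (laplacian p) = laplacian (partial_deriv j p)"
proof -
  have "partial_deriv j (\<lambda>x. \<Sum>i\<in>I. partial_deriv i (partial_deriv i p) x) =
     (\<lambda>x. \<Sum>i\<in>I. partial_deriv j (partial_deriv i (partial_deriv i p)) x)" if "finite I" for I
    using that
  proof (induction I)
    case (insert i I)
    have "partial_deriv j (\<lambda>x. partial_deriv i (partial_deriv i p) x + (\<Sum>i\<in>I. partial_deriv i (partial_deriv i p) x)) =
      (\<lambda>x. partial_deriv j (partial_deriv i (partial_deriv i p)) x + partial_deriv j (\<lambda>x. \<Sum>i\<in>I. partial_deriv i (partial_deriv i p) x) x)"
      by (rule partial_deriv_hom_add[where k="k - 1 - 1" and l="k - 1 - 1"]; intro homogeneous_sum homogeneous_partial_deriv p)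
    then show ?case using insert by simp
  qed (simp add: partial_deriv_const[abs_def])
  from this[of UNIV] show ?thesis
    unfolding laplacian_def[abs_def]
    by (simp add: partial_deriv_commute[OF homogeneous_partial_deriv[OF p]] partial_deriv_commute[OF p])
qed

text \<open>Kept as an operator so that its iterates face those of \<open>laplacian\<close>, to
  which it will be adjoint up to a factor.\<close>

definition norm_sq_mult :: "(real^'n \<Rightarrow> complex) \<Rightarrow> real^'n \<Rightarrow> complex" where
  "norm_sq_mult p x = of_real ((norm x)\<^sup>2) * p x"

lemma norm_sq_mult_eq:
  "norm_sq_mult p = (\<lambda>x. \<Sum>j\<in>UNIV. of_real (x $ j) * (of_real (x $ j) * p x))"
proof
  fix x :: "real^'a"
  have "(norm x)\<^sup>2 = (\<Sum>j\<in>UNIV. x $ j * x $ j)"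
    by (simp add: power2_norm_eq_inner inner_vec_def)
  then show "norm_sq_mult p x = (\<Sum>j\<in>UNIV. of_real (x $ j) * (of_real (x $ j) * p x))"
    by (simp add: norm_sq_mult_def sum_distrib_right mult.assoc)
qed

lemma homogeneous_norm_sq_mult:
  assumes "homogeneous_poly_fun k p"
  shows "homogeneous_poly_fun (Suc (Suc k)) (norm_sq_mult p)"
  unfolding norm_sq_mult_eq by (intro homogeneous_sum homogeneous_coord_mult assms)

lemma homogeneous_norm_sq_mult_funpow:
  assumes "homogeneous_poly_fun k p"
  shows "homogeneous_poly_fun (k + 2 * l) ((norm_sq_mult ^^ l) p)"
  using homogeneous_norm_sq_mult assms by (induction l) fastforce+

lemma norm_sq_mult_funpow: "(norm_sq_mult ^^ l) p x = of_real ((norm x) ^ (2 * l)) * p x"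
  by (induction l) (simp_all add: norm_sq_mult_def power2_eq_square algebra_simps)

text \<open>Commute the Laplacian past x_j twice and sum over j: the first-order terms form the
  Euler operator, which acts as \<open>k\<close>, and the zeroth-order terms contribute 2n.\<close>

lemma laplacian_norm_sq_mult:
  fixes p :: "real^'n \<Rightarrow> complex"
  assumes p: "homogeneous_poly_fun k p"
  shows "laplacian (norm_sq_mult p) =
    (\<lambda>x. norm_sq_mult (laplacian p) x + (4 * of_nat k + 2 * of_nat CARD('n)) * p x)"
proof
  fix x
  have "laplacian (norm_sq_mult p) x =
    (\<Sum>j\<in>UNIV. of_real (x $ j) * (of_real (x $ j) * laplacian p x + 2 * partial_deriv j p x)
      + 2 * (of_real (x $ j) * partial_deriv j p x + p x))"
    unfolding norm_sq_mult_eq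
    by (subst laplacian_sum[where k="Suc (Suc k)"])
       (simp_all add: laplacian_coord_mult[OF homogeneous_coord_mult[OF p]] laplacian_coord_mult[OF p]
         partial_deriv_coord_mult[OF p] homogeneous_coord_mult p)
  also have "\<dots> = (\<Sum>j\<in>UNIV. of_real (x $ j) * (of_real (x $ j) * laplacian p x))
      + 4 * (\<Sum>j\<in>UNIV. of_real (x $ j) * partial_deriv j p x) + of_nat CARD('n) * (2 * p x)"
    by (simp add: sum.distrib sum_distrib_left algebra_simps)
  finally show "laplacian (norm_sq_mult p) x =
    norm_sq_mult (laplacian p) x + (4 * of_nat k + 2 * of_nat CARD('n)) * p x"
    unfolding euler_homogeneous[OF p] norm_sq_mult_eq[of "laplacian p"]
    by (simp add: algebra_simps)
qed

text \<open>The constant is the sum of the commutators 4(m + 2j) + 2n over j = 0, ..., l, one for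
  each factor |x|^2 that the Laplacian passes before it meets the harmonic \<open>p\<close>.\<close>

lemma laplacian_norm_sq_mult_funpow:
  fixes p :: "real^'n \<Rightarrow> complex"
  assumes p: "homogeneous_poly_fun m p" and harm: "laplacian p = (\<lambda>_. 0)"
  shows "laplacian ((norm_sq_mult ^^ Suc l) p) =
    (\<lambda>x. of_real (4 * (l + 1) * (l + m + CARD('n) / 2)) * (norm_sq_mult ^^ l) p x)"
proof (induction l)
  case 0
  then show ?case
    using laplacian_norm_sq_mult[OF p]
    by (simp add: harm fun_eq_iff algebra_simps) (simp add: norm_sq_mult_def)
next
  case (Suc l)
  define q where "q = (norm_sq_mult ^^ l) p"
  have "laplacian (norm_sq_mult (norm_sq_mult q)) =
    (\<lambda>x. norm_sq_mult (laplacian (norm_sq_mult q)) x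
        + (4 * of_nat (m + 2 * Suc l) + 2 * of_nat CARD('n)) * norm_sq_mult q x)"
    using laplacian_norm_sq_mult[OF homogeneous_norm_sq_mult_funpow[OF p, of "Suc l"]]
    by (simp add: q_def)
  also have "laplacian (norm_sq_mult q) =
      (\<lambda>x. of_real (4 * (l + 1) * (l + m + CARD('n) / 2)) * q x)"
    using Suc.IH by (simp add: q_def)
  also have "(\<lambda>x. norm_sq_mult (\<lambda>x. of_real (4 * (l + 1) * (l + m + CARD('n) / 2)) * q x) x
        + (4 * of_nat (m + 2 * Suc l) + 2 * of_nat CARD('n)) * norm_sq_mult q x) =
      (\<lambda>x. of_real (4 * (Suc l + 1) * (Suc l + m + CARD('n) / 2)) * norm_sq_mult q x)"
    by (simp add: norm_sq_mult_def fun_eq_iff algebra_simps)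
  finally show ?case by (simp add: q_def)
qed

lemma partial_deriv_sum:
  assumes "\<And>i. i \<in> I \<Longrightarrow> p i differentiable (at x)"
  shows "partial_deriv j (\<lambda>x. \<Sum>i\<in>I. p i x) x = (\<Sum>i\<in>I. partial_deriv j (p i) x)"
  using assms
proof (induction I rule: infinite_finite_induct)
  case (insert i I)
  then show ?case
    using partial_deriv_add[of "p i" x "\<lambda>x. \<Sum>i\<in>I. p i x" j] by (simp add: differentiable_sum)
qed (simp_all add: partial_deriv_const)

lemma partial_deriv_homogeneous_0:
  assumes "homogeneous_poly_fun 0 p"
  shows "partial_deriv j p = (\<lambda>_. 0)"
  using assms
  by (induction rule: homogeneous_induct)
     (auto simp: partial_deriv_monom_fun partial_deriv_const partial_deriv_hom_add[of 0 _ 0]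
        partial_deriv_hom_cmult[of 0])

lemma laplacian_homogeneous_less_2:
  assumes "homogeneous_poly_fun k p" "k < 2"
  shows "laplacian p = (\<lambda>_. 0)"
proof -
  have "homogeneous_poly_fun 0 (partial_deriv j p)" for j
    using homogeneous_partial_deriv[OF assms(1), of j] assms(2) by simp
  then show ?thesis
    by (simp add: laplacian_def[abs_def] partial_deriv_homogeneous_0)
qed

text \<open>By induction on the degree: decompose the Laplacian of \<open>p\<close>, lift each
  component |x|^(2l) Q l to |x|^(2l+2) Q l, and divide by the constant that the Laplacian produces
  on it. The sum S of the lifts has the same Laplacian as \<open>p\<close>, so p - S is the
  remaining harmonic component.\<close>

lemma Fischer_decomposition:
  fixes p :: "real^'n \<Rightarrow> complex"
  assumes "homogeneous_poly_fun k p"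
  obtains Q where "\<And>l. l \<le> k div 2 \<Longrightarrow> homogeneous_poly_fun (k - 2 * l) (Q l)"
    and "\<And>l. l \<le> k div 2 \<Longrightarrow> laplacian (Q l) = (\<lambda>_. 0)"
    and "p = (\<lambda>x. \<Sum>l\<le>k div 2. (norm_sq_mult ^^ l) (Q l) x)"
proof -
  have "\<exists>Q. (\<forall>l\<le>k div 2. homogeneous_poly_fun (k - 2 * l) (Q l) \<and> laplacian (Q l) = (\<lambda>_. 0)) \<and>
      p = (\<lambda>x. \<Sum>l\<le>k div 2. (norm_sq_mult ^^ l) (Q l) x)"
    using assms
  proof (induction k arbitrary: p rule: less_induct)
    case (less k)
    show ?case
    proof (cases "k < 2")
      case True
      then show ?thesis
        using less.prems laplacian_homogeneous_less_2[OF less.prems True]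
        by (intro exI[of _ "\<lambda>_. p"]) auto
    next
      case False
      define k' where "k' = k - 2"
      have k: "k = Suc (Suc k')" "k div 2 = Suc (k' div 2)"
        using False by (auto simp: k'_def)
      have "homogeneous_poly_fun k' (laplacian p)"
        using homogeneous_laplacian[OF less.prems] by (simp add: k'_def)
      then obtain Q where Q: "\<And>l. l \<le> k' div 2 \<Longrightarrow> homogeneous_poly_fun (k' - 2 * l) (Q l)"
        "\<And>l. l \<le> k' div 2 \<Longrightarrow> laplacian (Q l) = (\<lambda>_. 0)"
        "laplacian p = (\<lambda>x. \<Sum>l\<le>k' div 2. (norm_sq_mult ^^ l) (Q l) x)"
        using less.IH[of k' "laplacian p"] k by auto
      \<comment> \<open>The constant of \<open>laplacian_norm_sq_mult_funpow\<close> for a harmonic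
        polynomial of degree k' - 2l. It is positive because n >= 1, so division by it is
        allowed.\<close>
      define c where "c l = complex_of_real (4 * (l + 1) * (l + (k' - 2 * l :: nat) + CARD('n) / 2))" for l :: nat
      have c: "c l \<noteq> 0" for l
      proof -
        have "(0::real) < 4 * (l + 1) * (l + (k' - 2 * l :: nat) + CARD('n) / 2)"
          by (intro mult_pos_pos add_nonneg_pos) auto
        then show ?thesis unfolding c_def of_real_eq_0_iff by linarith
      qed
      define S where "S x = (\<Sum>l\<le>k' div 2. (1 / c l) * (norm_sq_mult ^^ Suc l) (Q l) x)" for x
      have hS: "homogeneous_poly_fun k (\<lambda>x. (1 / c l) * (norm_sq_mult ^^ Suc l) (Q l) x)"
        if "l \<le> k' div 2" for l
      proof -
        have "k' - 2 * l + 2 * Suc l = k" using that k by auto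
        then show ?thesis
          using homogeneous_cmult[OF homogeneous_norm_sq_mult_funpow[OF Q(1)[OF that], of "Suc l"]]
          by (simp only:)
      qed
      have hS': "homogeneous_poly_fun k S"
        unfolding S_def[abs_def] using hS by (intro homogeneous_sum) auto
      have "laplacian S = (\<lambda>x. \<Sum>l\<le>k' div 2. laplacian (\<lambda>x. (1 / c l) * (norm_sq_mult ^^ Suc l) (Q l) x) x)"
        unfolding S_def[abs_def] by (rule laplacian_sum[where k=k]) (use hS in auto)
      also have "\<dots> = (\<lambda>x. \<Sum>l\<le>k' div 2. (norm_sq_mult ^^ l) (Q l) x)"
      proof (intro ext sum.cong refl)
        fix x l assume "l \<in> {..k' div 2}"
        then have l: "l \<le> k' div 2" by simp
        have "laplacian (\<lambda>x. (1 / c l) * (norm_sq_mult ^^ Suc l) (Q l) x) =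
          (\<lambda>x. (1 / c l) * laplacian ((norm_sq_mult ^^ Suc l) (Q l)) x)"
          by (rule laplacian_cmult[OF homogeneous_norm_sq_mult_funpow[OF Q(1)[OF l]]])
        also have "laplacian ((norm_sq_mult ^^ Suc l) (Q l)) = (\<lambda>x. c l * (norm_sq_mult ^^ l) (Q l) x)"
          using laplacian_norm_sq_mult_funpow[OF Q(1)[OF l] Q(2)[OF l], of l]
          unfolding c_def by simp
        finally show "laplacian (\<lambda>x. (1 / c l) * (norm_sq_mult ^^ Suc l) (Q l) x) x = (norm_sq_mult ^^ l) (Q l) x"
          using c[of l] by simp
      qed
      finally have lapS: "laplacian S = laplacian p" using Q(3) by simp
      \<comment> \<open>Index 0 receives the new harmonic part; the components of the Laplacian move
        up by one power of |x|^2.\<close>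
      define Q' where "Q' l = (case l of 0 \<Rightarrow> (\<lambda>x. p x - S x) | Suc l \<Rightarrow> (\<lambda>x. (1 / c l) * Q l x))" for l
      have "homogeneous_poly_fun (k - 2 * l) (Q' l) \<and> laplacian (Q' l) = (\<lambda>_. 0)" if "l \<le> k div 2" for l
      proof (cases l)
        case 0
        then show ?thesis
          using homogeneous_diff[OF less.prems hS'] laplacian_diff[OF less.prems hS'] lapS
          by (simp add: Q'_def)
      next
        case (Suc l')
        then have l': "l' \<le> k' div 2" using that k by simp
        have "k - 2 * l = k' - 2 * l'" using Suc k by simp
        then show ?thesis
          using Suc homogeneous_cmult[OF Q(1)[OF l'], of "1 / c l'"] laplacian_cmult[OF Q(1)[OF l'], of "1 / c l'"]
            Q(2)[OF l']
          by (simp add: Q'_def)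
      qed
      moreover have "p = (\<lambda>x. \<Sum>l\<le>k div 2. (norm_sq_mult ^^ l) (Q' l) x)"
        unfolding k(2) sum.atMost_Suc_shift
        by (simp add: Q'_def S_def norm_sq_mult_funpow fun_eq_iff algebra_simps del: funpow.simps)
      ultimately show ?thesis by blast
    qed
  qed
  then show ?thesis using that by blast
qed

section \<open>Hermite polynomials as heat transforms of monomials\<close>

lemma homogeneous_laplacian_funpow:
  assumes "homogeneous_poly_fun k p"
  shows "homogeneous_poly_fun (k - 2 * i) ((laplacian ^^ i) p)"
proof (induction i)
  case (Suc i)
  then show ?case using homogeneous_laplacian[OF Suc.IH] by (simp add: algebra_simps)
qed (simp add: assms)

lemma laplacian_funpow_zero: "(laplacian ^^ i) (\<lambda>_. 0) = (\<lambda>_. 0)"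
  by (induction i) (simp_all add: laplacian_zero)

lemma laplacian_funpow_add:
  assumes "homogeneous_poly_fun k p" "homogeneous_poly_fun l q"
  shows "(laplacian ^^ i) (\<lambda>x. p x + q x) = (\<lambda>x. (laplacian ^^ i) p x + (laplacian ^^ i) q x)"
  by (induction i)
     (simp_all add: laplacian_add[OF assms[THEN homogeneous_laplacian_funpow]])

lemma laplacian_funpow_cmult:
  assumes "homogeneous_poly_fun k p"
  shows "(laplacian ^^ i) (\<lambda>x. c * p x) = (\<lambda>x. c * (laplacian ^^ i) p x)"
  by (induction i)
     (simp_all add: laplacian_cmult[OF assms[THEN homogeneous_laplacian_funpow]])

text \<open>Each of the \<open>i\<close> Laplacians contributes one commutator 2 d_j, and d_j
  commutes with the others. At i = 0 the truncated index i - 1 is multiplied by zero.\<close>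

lemma laplacian_funpow_coord_mult:
  assumes p: "homogeneous_poly_fun k p"
  shows "(laplacian ^^ i) (\<lambda>x. of_real (x $ j) * p x) =
    (\<lambda>x. of_real (x $ j) * (laplacian ^^ i) p x + 2 * of_nat i * partial_deriv j ((laplacian ^^ (i - 1)) p) x)"
proof (induction i)
  case (Suc i)
  have h1: "homogeneous_poly_fun (Suc (k - 2 * i)) (\<lambda>x. of_real (x $ j) * (laplacian ^^ i) p x)"
    by (intro homogeneous_coord_mult homogeneous_laplacian_funpow p)
  have h2: "homogeneous_poly_fun (k - 2 * (i - 1) - 1) (partial_deriv j ((laplacian ^^ (i - 1)) p))"
    by (intro homogeneous_partial_deriv homogeneous_laplacian_funpow p)
  have "(laplacian ^^ Suc i) (\<lambda>x. of_real (x $ j) * p x) =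
    laplacian (\<lambda>x. of_real (x $ j) * (laplacian ^^ i) p x + 2 * of_nat i * partial_deriv j ((laplacian ^^ (i - 1)) p) x)"
    using Suc.IH by simp
  also have "\<dots> = (\<lambda>x. of_real (x $ j) * (laplacian ^^ Suc i) p x + 2 * partial_deriv j ((laplacian ^^ i) p) x
      + 2 * of_nat i * partial_deriv j (laplacian ((laplacian ^^ (i - 1)) p)) x)"
    by (subst laplacian_add[OF h1 homogeneous_cmult[OF h2]])
       (simp add: laplacian_cmult[OF h2, unfolded One_nat_def] laplacian_coord_mult[OF homogeneous_laplacian_funpow[OF p]]
         partial_deriv_laplacian[OF homogeneous_laplacian_funpow[OF p]])
  also have "\<dots> = (\<lambda>x. of_real (x $ j) * (laplacian ^^ Suc i) p x + 2 * of_nat (Suc i) * partial_deriv j ((laplacian ^^ (Suc i - 1)) p) x)"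
    by (cases i) (simp_all add: fun_eq_iff algebra_simps)
  finally show ?case .
qed simp

text \<open>The truncated exponential of \<open>-\<Delta>/4\<close>. It maps \<open>(2x)\<^sup>\<alpha>\<close> to the product of the
  Hermite polynomials of degrees \<open>\<alpha> j\<close>.\<close>

definition heat_coeff :: "nat \<Rightarrow> complex" where
  "heat_coeff i = (-1/4) ^ i / fact i"

definition hermite_transform :: "nat \<Rightarrow> (real^'n \<Rightarrow> complex) \<Rightarrow> real^'n \<Rightarrow> complex" where
  "hermite_transform N p x = (\<Sum>i\<le>N. heat_coeff i * (laplacian ^^ i) p x)"

definition hermite_prod :: "('n \<Rightarrow> nat) \<Rightarrow> real^'n \<Rightarrow> complex" where
  "hermite_prod \<alpha> x = of_real (\<Prod>j\<in>UNIV. poly (hermite_poly (\<alpha> j)) (x $ j)) / 2 ^ sum \<alpha> UNIV"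

lemma hermite_transform_add:
  assumes "homogeneous_poly_fun k p" "homogeneous_poly_fun l q"
  shows "hermite_transform N (\<lambda>x. p x + q x) = (\<lambda>x. hermite_transform N p x + hermite_transform N q x)"
  by (simp add: hermite_transform_def[abs_def] laplacian_funpow_add[OF assms] algebra_simps sum.distrib)

lemma hermite_transform_cmult:
  assumes "homogeneous_poly_fun k p"
  shows "hermite_transform N (\<lambda>x. c * p x) = (\<lambda>x. c * hermite_transform N p x)"
  by (simp add: hermite_transform_def[abs_def] laplacian_funpow_cmult[OF assms] sum_distrib_left algebra_simps)

lemma hermite_transform_zero: "hermite_transform N (\<lambda>_. 0) = (\<lambda>_. 0)"
  by (simp add: hermite_transform_def[abs_def] laplacian_funpow_zero)

lemma hermite_transform_sum:
  assumes "\<And>i. i \<in> I \<Longrightarrow> homogeneous_poly_fun k (p i)"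
  shows "hermite_transform N (\<lambda>x. \<Sum>i\<in>I. p i x) = (\<lambda>x. \<Sum>i\<in>I. hermite_transform N (p i) x)"
  using assms
proof (induction I rule: infinite_finite_induct)
  case (insert i I)
  then show ?case
    using hermite_transform_add[of k "p i" k "\<lambda>x. \<Sum>i\<in>I. p i x"] by (simp add: homogeneous_sum)
qed (simp_all add: hermite_transform_zero)

lemma hermite_transform_harmonic:
  assumes "laplacian p = (\<lambda>_. 0)"
  shows "hermite_transform N p = p"
proof -
  have "(laplacian ^^ Suc i) p = (\<lambda>_. 0)" for i
    by (simp add: funpow_swap1 assms laplacian_funpow_zero)
  then show ?thesis
    unfolding hermite_transform_def[abs_def] sum.atMost_shift
    by (simp del: funpow.simps) (simp add: heat_coeff_def)
qed

lemma hermite_transform_differentiable: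
  assumes "homogeneous_poly_fun k p"
  shows "hermite_transform N p differentiable (at x)"
  unfolding hermite_transform_def[abs_def]
  by (intro differentiable_sum ballI finite_atMost
      homogeneous_differentiable[OF homogeneous_cmult[OF homogeneous_laplacian_funpow[OF assms]]])

text \<open>Conjugation by exp (-Laplacian/4) turns multiplication by x_j into x_j - d_j/2. The
  derivative term has order \<open>N\<close> only, since the commutator in the summand of index i +
  1 contains the i-th power of the Laplacian.\<close>

lemma hermite_transform_coord_mult:
  assumes p: "homogeneous_poly_fun k p"
  shows "hermite_transform (Suc N) (\<lambda>x. of_real (x $ j) * p x) x =
    of_real (x $ j) * hermite_transform (Suc N) p x - 1/2 * partial_deriv j (hermite_transform N p) x"
proof -
  have "hermite_transform (Suc N) (\<lambda>x. of_real (x $ j) * p x) x =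
      of_real (x $ j) * hermite_transform (Suc N) p x +
      (\<Sum>i\<le>Suc N. heat_coeff i * (2 * of_nat i * partial_deriv j ((laplacian ^^ (i - 1)) p) x))"
    unfolding hermite_transform_def laplacian_funpow_coord_mult[OF p]
    by (simp add: sum_distrib_left sum.distrib algebra_simps del: sum.atMost_Suc)
  also have "(\<Sum>i\<le>Suc N. heat_coeff i * (2 * of_nat i * partial_deriv j ((laplacian ^^ (i - 1)) p) x)) =
    (\<Sum>i\<le>N. - 1/2 * (heat_coeff i * partial_deriv j ((laplacian ^^ i) p) x))"
  proof -
    have "heat_coeff (Suc i) * (2 * of_nat (Suc i)) = - 1/2 * heat_coeff i" for i
      by (simp add: heat_coeff_def divide_simps del: of_nat_Suc)
    then have "heat_coeff (Suc i) * (2 * of_nat (Suc i) * z) = - 1/2 * (heat_coeff i * z)" for i z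
      by (metis mult.assoc)
    then show ?thesis
      unfolding sum.atMost_Suc_shift by (simp del: of_nat_Suc)
  qed
  also have "\<dots> = - 1/2 * (\<Sum>i\<le>N. partial_deriv j (\<lambda>x. heat_coeff i * (laplacian ^^ i) p x) x)"
    by (simp only: sum_distrib_left partial_deriv_hom_cmult[OF homogeneous_laplacian_funpow[OF p]])
  also have "\<dots> = - 1/2 * partial_deriv j (hermite_transform N p) x"
    unfolding hermite_transform_def[abs_def]
    by (subst partial_deriv_sum)
       (simp_all only: homogeneous_differentiable[OF homogeneous_cmult[OF homogeneous_laplacian_funpow[OF p]]])
  finally show ?thesis by simp
qed

text \<open>The Hermite recursion 2x H - H' in one coordinate, halved by the normalisation
  2^(-|\<alpha>|). It matches the operator x_j - d_j/2 found for the transform.\<close>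

lemma partial_deriv_hermite_prod:
  assumes diff: "hermite_prod \<alpha> differentiable (at x)"
  shows "of_real (x $ j) * hermite_prod \<alpha> x - 1/2 * partial_deriv j (hermite_prod \<alpha>) x =
    hermite_prod (\<alpha>(j := Suc (\<alpha> j))) x"
proof -
  define r where "r = (\<Prod>i\<in>UNIV - {j}. poly (hermite_poly (\<alpha> i)) (x $ i))"
  have split: "(\<Prod>i\<in>UNIV. h i) = h j * (\<Prod>i\<in>UNIV - {j}. h i)" for h :: "'a \<Rightarrow> real"
    by (rule prod.remove) auto
  have eq: "(\<lambda>t. hermite_prod \<alpha> (x + t *\<^sub>R axis j 1)) =
      (\<lambda>t. of_real (poly (hermite_poly (\<alpha> j)) (x $ j + t) * r / 2 ^ sum \<alpha> UNIV))"
    unfolding hermite_prod_def r_def by (subst split) (auto simp: axis_def intro!: ext prod.cong)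
  have "((\<lambda>t. poly (hermite_poly (\<alpha> j)) (x $ j + t) * r / 2 ^ sum \<alpha> UNIV) has_real_derivative
      poly (pderiv (hermite_poly (\<alpha> j))) (x $ j) * r / 2 ^ sum \<alpha> UNIV) (at 0)"
    by (auto intro!: derivative_eq_intros)
  then have "((\<lambda>t. hermite_prod \<alpha> (x + t *\<^sub>R axis j 1)) has_vector_derivative
      of_real (poly (pderiv (hermite_poly (\<alpha> j))) (x $ j) * r / 2 ^ sum \<alpha> UNIV)) (at 0)"
    unfolding eq by (rule has_vector_derivative_of_real)
  then have pd: "partial_deriv j (hermite_prod \<alpha>) x =
      of_real (poly (pderiv (hermite_poly (\<alpha> j))) (x $ j) * r / 2 ^ sum \<alpha> UNIV)"
    by (rule partial_deriv_eqI[OF diff])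
  have hp: "hermite_prod \<alpha> x = of_real (poly (hermite_poly (\<alpha> j)) (x $ j) * r / 2 ^ sum \<alpha> UNIV)"
    unfolding hermite_prod_def r_def by (subst split) simp
  have hp': "hermite_prod (\<alpha>(j := Suc (\<alpha> j))) x =
      of_real (poly (hermite_poly (Suc (\<alpha> j))) (x $ j) * r / 2 ^ Suc (sum \<alpha> UNIV))"
    unfolding hermite_prod_def r_def sum_upd_Suc by (subst split) (auto intro!: prod.cong)
  show ?thesis
    unfolding pd hp hp' by (simp add: field_simps)
qed

lemma hermite_transform_monom_fun:
  "sum \<alpha> UNIV \<le> N \<Longrightarrow> hermite_transform N (monom_fun \<alpha>) = hermite_prod \<alpha>"
proof (induction "sum \<alpha> UNIV" arbitrary: \<alpha> N)
  case 0
  then have \<alpha>: "\<alpha> = (\<lambda>_. 0)" by (auto simp: fun_eq_iff)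
  have "laplacian (monom_fun \<alpha>) = (\<lambda>_. 0)"
    by (rule laplacian_homogeneous_less_2[OF homogeneous_monom_fun]) (simp add: \<alpha>)
  from hermite_transform_harmonic[OF this] show ?case
    by (simp add: \<alpha> monom_fun_def[abs_def] hermite_prod_def[abs_def])
next
  case (Suc k)
  have "\<exists>j. \<alpha> j > 0"
    by (rule ccontr) (use Suc(2) in auto)
  then obtain j where j: "\<alpha> j > 0" ..
  define \<beta> where "\<beta> = \<alpha>(j := \<alpha> j - 1)"
  have \<alpha>: "\<alpha> = \<beta>(j := Suc (\<beta> j))" using j by (simp add: \<beta>_def fun_eq_iff)
  have k: "k = sum \<beta> UNIV" using sum_upd_Suc[of \<beta> j] Suc(2) \<alpha> by simp
  obtain N' where N': "N = Suc N'" "sum \<beta> UNIV \<le> N'" using Suc(2,3) k by (cases N) auto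
  \<comment> \<open>The commutation rule involves the orders \<open>N'\<close> and \<open>N\<close>
    at once, which is why the induction covers every order not below the degree.\<close>
  have IH: "hermite_transform N' (monom_fun \<beta>) = hermite_prod \<beta>" "hermite_transform N (monom_fun \<beta>) = hermite_prod \<beta>"
    using Suc(1)[OF k] N' by auto
  have "hermite_prod \<beta> differentiable (at x)" for x
    unfolding IH(1)[symmetric] by (rule hermite_transform_differentiable[OF homogeneous_monom_fun])
  note h = partial_deriv_hermite_prod[OF this, of _ j]
  have m: "monom_fun \<alpha> = (\<lambda>x. of_real (x $ j) * monom_fun \<beta> x)"
    by (simp add: coord_mult_monom_fun \<alpha>)
  show ?case
    unfolding m
    by (rule ext) (use hermite_transform_coord_mult[OF homogeneous_monom_fun, of N' j \<beta>] IH N' h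
      in \<open>simp add: \<alpha>[symmetric]\<close>)
qed

text \<open>Differentiate the recursion; by the induction hypothesis the terms beside 2 H_(k+1) are
  a multiple of 2x H_k - H_k', which is H_(k+1) again.\<close>

lemma pderiv_hermite_poly: "pderiv (hermite_poly (Suc k)) = smult (2 * (1 + of_nat k)) (hermite_poly k)"
proof (induction k)
  case 0
  then show ?case by (simp add: pderiv_mult pderiv_pCons)
next
  case (Suc k)
  have "pderiv (hermite_poly (Suc (Suc k))) =
      smult 2 (hermite_poly (Suc k)) + [:0, 2:] * pderiv (hermite_poly (Suc k))
      - pderiv (pderiv (hermite_poly (Suc k)))"
    unfolding hermite_poly.simps(2)[of "Suc k"]
    by (simp add: pderiv_diff pderiv_mult pderiv_pCons pderiv_smult del: hermite_poly.simps)
  also have "\<dots> = smult 2 (hermite_poly (Suc k)) + smult (2 * (1 + of_nat k)) (hermite_poly (Suc k))"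
    unfolding Suc.IH by (simp add: pderiv_smult smult_diff_right algebra_simps)
  also have "\<dots> = smult (2 * (1 + of_nat (Suc k))) (hermite_poly (Suc k))"
    by (simp only: flip: smult_add_left) (simp add: algebra_simps)
  finally show ?case .
qed

section \<open>Integrals of polynomials and Hermite polynomials against Gaussians\<close>

lemma integrable_power_gaussian:
  assumes "c > 0"
  shows "integrable lborel (\<lambda>x :: real. x ^ k * exp (- c * x\<^sup>2))"
proof -
  \<comment> \<open>The standard deviation for which the centred normal density is a multiple of exp
    (-c x^2).\<close>
  define \<sigma> where "\<sigma> = 1 / sqrt (2 * c)"
  have \<sigma>: "\<sigma> > 0" "2 * \<sigma>\<^sup>2 = 1 / c" using assms by (auto simp: \<sigma>_def power_divide)
  have "integrable lborel (\<lambda>x. sqrt (2 * pi * \<sigma>\<^sup>2) * (normal_density 0 \<sigma> x * (x - 0) ^ k))"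
    by (intro integrable_mult_right integrable_normal_moment \<sigma>)
  also have "(\<lambda>x. sqrt (2 * pi * \<sigma>\<^sup>2) * (normal_density 0 \<sigma> x * (x - 0) ^ k)) = (\<lambda>x. x ^ k * exp (- c * x\<^sup>2))"
  proof
    fix x
    have "- (x - 0)\<^sup>2 / (2 * \<sigma>\<^sup>2) = - c * x\<^sup>2" unfolding \<sigma>(2) by simp
    moreover have "sqrt (2 * pi * \<sigma>\<^sup>2) > 0" using \<sigma>(1) by simp
    ultimately show "sqrt (2 * pi * \<sigma>\<^sup>2) * (normal_density 0 \<sigma> x * (x - 0) ^ k) = x ^ k * exp (- c * x\<^sup>2)"
      using \<sigma>(1) unfolding normal_density_def by (simp only:) (simp add: field_simps)
  qed
  finally show ?thesis .
qed

lemma integrable_poly_gaussian: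
  assumes "c > 0"
  shows "integrable lborel (\<lambda>x :: real. poly p x * exp (- c * x\<^sup>2))"
  unfolding poly_altdef sum_distrib_right mult.assoc
  by (intro Bochner_Integration.integrable_sum integrable_mult_right integrable_power_gaussian assms)

lemma power_gaussian_tendsto_0:
  assumes "c > 0"
  shows "((\<lambda>x :: real. x ^ k * exp (- c * x\<^sup>2)) \<longlongrightarrow> 0) at_top"
proof (rule Lim_null_comparison)
  show "((\<lambda>x :: real. x ^ k / exp x) \<longlongrightarrow> 0) at_top"
    by (rule tendsto_power_div_exp_0)
  show "\<forall>\<^sub>F x in at_top. norm (x ^ k * exp (- c * x\<^sup>2)) \<le> x ^ k / exp x"
    using eventually_ge_at_top[of "1 / c"] eventually_ge_at_top[of 0]
  proof eventually_elim
    case (elim x)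
    have "x * 1 \<le> x * (c * x)" using elim assms by (intro mult_left_mono) (auto simp: field_simps)
    then have "exp (- c * x\<^sup>2) \<le> exp (- x)" by (simp add: power2_eq_square algebra_simps)
    then show ?case using elim by (auto simp: abs_mult exp_minus divide_inverse intro!: mult_left_mono)
  qed
qed

lemma poly_gaussian_tendsto_0:
  assumes "c > 0"
  shows "((\<lambda>x :: real. poly p x * exp (- c * x\<^sup>2)) \<longlongrightarrow> 0) at_top"
    and "((\<lambda>x :: real. poly p x * exp (- c * x\<^sup>2)) \<longlongrightarrow> 0) at_bot"
proof -
  show *: "((\<lambda>x :: real. poly p x * exp (- c * x\<^sup>2)) \<longlongrightarrow> 0) at_top" for p
    unfolding poly_altdef sum_distrib_right mult.assoc
    by (intro tendsto_null_sum tendsto_mult_right_zero power_gaussian_tendsto_0 assms)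
  have "((\<lambda>x :: real. poly p (- x) * exp (- c * (- x)\<^sup>2)) \<longlongrightarrow> 0) at_top"
    using *[of "pcompose p [:0, -1:]"] by (simp add: poly_pcompose)
  then show "((\<lambda>x :: real. poly p x * exp (- c * x\<^sup>2)) \<longlongrightarrow> 0) at_bot"
    by (subst filterlim_at_bot_mirror) simp
qed

text \<open>Integration by parts without boundary terms, applied below to products that contain a
  Gaussian factor.\<close>

lemma integral_derivative_eq_0:
  fixes F f :: "real \<Rightarrow> 'a::euclidean_space"
  assumes "\<And>x. (F has_vector_derivative f x) (at x)" "continuous_on UNIV f" "integrable lborel f"
    and "(F \<longlongrightarrow> 0) at_top" "(F \<longlongrightarrow> 0) at_bot"
  shows "(LINT x|lborel. f x) = 0"
proof -
  have "(LBINT x=-\<infinity>..\<infinity>. f x) = 0 - 0"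
    using assms
    by (intro interval_integral_FTC_integrable[where F=F])
       (auto simp: ereal_tendsto_simps continuous_on_eq_continuous_at set_integrable_def)
  then show ?thesis
    by (simp add: interval_lebesgue_integral_def set_lebesgue_integral_def)
qed

text \<open>Since the derivative of H_k exp (-x^2) is -H_(k+1) exp (-x^2), integration by parts
  trades H_j' H_k for H_j H_(k+1). Together with H_(j+1)' = 2(j+1) H_j this lowers both indices at
  once, down to the Gaussian integral.\<close>

lemma hermite_poly_orthogonality:
  "(LINT x|lborel. poly (hermite_poly j) x * poly (hermite_poly k) x * exp (- x\<^sup>2)) =
    (if j = k then 2 ^ k * fact k * sqrt pi else 0)"
proof -
  define I where "I j k = (LINT x|lborel. poly (hermite_poly j) x * poly (hermite_poly k) x * exp (- x\<^sup>2))" for j k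
  have int: "integrable lborel (\<lambda>x::real. poly p x * poly q x * exp (- x\<^sup>2))" for p q
    using integrable_poly_gaussian[of 1 "p * q"] by simp
  have rec: "(LINT x|lborel. poly (pderiv (hermite_poly j)) x * poly (hermite_poly k) x * exp (- x\<^sup>2)) = I j (Suc k)" for j k
  proof -
    have "(LINT x|lborel. poly (pderiv (hermite_poly j)) x * poly (hermite_poly k) x * exp (- x\<^sup>2)
        - poly (hermite_poly j) x * poly (hermite_poly (Suc k)) x * exp (- x\<^sup>2)) = 0"
    proof (rule integral_derivative_eq_0[where F="\<lambda>x. poly (hermite_poly j) x * poly (hermite_poly k) x * exp (- x\<^sup>2)"])
      show "((\<lambda>x. poly (hermite_poly j) x * poly (hermite_poly k) x * exp (- x\<^sup>2)) has_vector_derivative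
          poly (pderiv (hermite_poly j)) x * poly (hermite_poly k) x * exp (- x\<^sup>2)
        - poly (hermite_poly j) x * poly (hermite_poly (Suc k)) x * exp (- x\<^sup>2)) (at x)" for x :: real
        unfolding has_real_derivative_iff_has_vector_derivative[symmetric]
        by (auto intro!: derivative_eq_intros simp: algebra_simps)
      show "integrable lborel (\<lambda>x. poly (pderiv (hermite_poly j)) x * poly (hermite_poly k) x * exp (- x\<^sup>2)
        - poly (hermite_poly j) x * poly (hermite_poly (Suc k)) x * exp (- x\<^sup>2))"
        by (intro Bochner_Integration.integrable_diff int)
    qed (use poly_gaussian_tendsto_0[of 1 "hermite_poly j * hermite_poly k"] in \<open>auto intro!: continuous_intros\<close>)
    then show ?thesis by (simp add: int I_def del: hermite_poly.simps)
  qed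
  have comm: "I j k = I k j" for j k by (simp add: I_def mult.commute)
  have I0: "I 0 (Suc k) = 0" for k
    using rec[of 0 k] by simp
  have I1: "I (Suc j) (Suc k) = 2 * (1 + real j) * I j k" for j k
    using rec[of "Suc j" k] unfolding pderiv_hermite_poly by (simp add: I_def mult.assoc)
  have "has_bochner_integral lborel (\<lambda>x::real. exp (- x\<^sup>2)) (2 *\<^sub>R (sqrt pi / 2))"
    using has_bochner_integral_even_function[OF gaussian_moment_0] by simp
  then have 00: "I 0 0 = sqrt pi"
    by (simp add: I_def has_bochner_integral_integral_eq)
  have "I j k = (if j = k then 2 ^ k * fact k * sqrt pi else 0)"
  proof (induction k arbitrary: j)
    case 0
    then show ?case using I0 comm 00 by (cases j) auto
  next
    case (Suc k)
    then show ?case using I0 I1 Suc by (cases j) (auto simp: algebra_simps)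
  qed
  then show ?thesis by (simp add: I_def)
qed

lemma integrable_poly_gaussian_exp:
  "integrable lborel (\<lambda>x :: real. complex_of_real (poly p x * exp (- x\<^sup>2 / 2)) * exp (- \<i> * of_real (x * \<xi>)))"
proof (rule Bochner_Integration.integrable_bound)
  show "integrable lborel (\<lambda>x. poly p x * exp (- x\<^sup>2 / 2))"
    using integrable_poly_gaussian[of "1/2" p] by simp
qed (auto simp: norm_mult intro!: borel_measurable_continuous_onI continuous_intros)

text \<open>Up to normalisation, the characteristic function of the standard normal law at
  -\<xi>.\<close>

lemma fourier_gaussian_1d:
  "(LINT x|lborel. complex_of_real (exp (- x\<^sup>2 / 2)) * exp (- \<i> * of_real (x * \<xi>))) =
    of_real (sqrt (2 * pi) * exp (- \<xi>\<^sup>2 / 2))"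
proof -
  have "of_real (exp (- \<xi>\<^sup>2 / 2)) = char std_normal_distribution (- \<xi>)"
    by (simp add: char_std_normal_distribution)
  also have "\<dots> = (LINT x|lborel. std_normal_density x *\<^sub>R iexp (- \<xi> * x))"
    unfolding char_def by (subst integral_density) auto
  also have "\<dots> = (LINT x|lborel. of_real (1 / sqrt (2 * pi)) *
      (complex_of_real (exp (- x\<^sup>2 / 2)) * exp (- \<i> * of_real (x * \<xi>))))"
    by (intro Bochner_Integration.integral_cong refl)
       (simp add: std_normal_density_def scaleR_conv_of_real algebra_simps)
  also have "\<dots> = of_real (1 / sqrt (2 * pi)) *
      (LINT x|lborel. complex_of_real (exp (- x\<^sup>2 / 2)) * exp (- \<i> * of_real (x * \<xi>)))"
    by (rule integral_mult_right_zero)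
  finally show ?thesis by (simp add: field_simps)
qed

text \<open>Both sides satisfy the recursion y_(k+2) = 2(k+1) y_k - 2i \<xi> y_(k+1). For the right
  side this is the three-term recursion of the Hermite polynomials multiplied by (-i)^(k+2); for the
  left side it comes from integration by parts.\<close>

lemma fourier_hermite_1d:
  "(LINT x|lborel. complex_of_real (poly (hermite_poly k) x * exp (- x\<^sup>2 / 2)) * exp (- \<i> * of_real (x * \<xi>))) =
    (- \<i>) ^ k * of_real (sqrt (2 * pi) * poly (hermite_poly k) \<xi> * exp (- \<xi>\<^sup>2 / 2))"
proof -
  define J where "J p = (LINT x|lborel. complex_of_real (poly p x * exp (- x\<^sup>2 / 2)) * exp (- \<i> * of_real (x * \<xi>)))" for p
  note int = integrable_poly_gaussian_exp[of _ \<xi>]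
  have add: "J (p + q) = J p + J q" for p q
    unfolding J_def using int[of p] int[of q]
    by (subst Bochner_Integration.integral_add[symmetric]) (auto simp: algebra_simps)
  have smult: "J (smult c p) = of_real c * J p" for c p
    unfolding J_def by (subst integral_mult_right_zero[symmetric]) (simp add: algebra_simps)
  have diff: "J (p - q) = J p - J q" for p q
    using add[of p "smult (-1) q"] smult[of "-1" q] by simp
  \<comment> \<open>Integrate the derivative of p(x) exp (-x^2/2) exp (-i x \<xi>) over the
    line.\<close>
  have ibp: "J (pderiv p) = J ([:0, 1:] * p) + \<i> * of_real \<xi> * J p" for p
  proof -
    let ?f = "\<lambda>p x. complex_of_real (poly p x * exp (- x\<^sup>2 / 2)) * exp (- \<i> * of_real (x * \<xi>))"
    have "(LINT x|lborel. ?f (pderiv p - [:0, 1:] * p) x - \<i> * of_real \<xi> * ?f p x) = 0"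
    proof (rule integral_derivative_eq_0[where F="?f p"])
      have 1: "((\<lambda>x. complex_of_real (poly p x * exp (- x\<^sup>2 / 2))) has_vector_derivative
          of_real (poly (pderiv p - [:0, 1:] * p) x * exp (- x\<^sup>2 / 2))) (at x)" for x
        by (rule has_vector_derivative_of_real) (auto intro!: derivative_eq_intros simp: algebra_simps)
      have 2: "((\<lambda>x. exp (- \<i> * of_real (x * \<xi>))) has_vector_derivative
          (- \<i> * of_real \<xi> * exp (- \<i> * of_real (x * \<xi>)))) (at x)" for x
      proof -
        have "((\<lambda>x. exp (- \<i> * of_real \<xi> * of_real x)) has_vector_derivative
          (- \<i> * of_real \<xi> * exp (- \<i> * of_real \<xi> * of_real x))) (at x)"
          by (rule has_vector_derivative_real_field) (auto intro!: derivative_eq_intros)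
        then show ?thesis by (simp add: algebra_simps)
      qed
      show "(?f p has_vector_derivative (?f (pderiv p - [:0, 1:] * p) x - \<i> * of_real \<xi> * ?f p x)) (at x)" for x
        by (rule has_vector_derivative_eq_rhs[OF has_vector_derivative_mult[OF 1 2]]) (simp add: algebra_simps)
      show "integrable lborel (\<lambda>x. ?f (pderiv p - [:0, 1:] * p) x - \<i> * of_real \<xi> * ?f p x)"
        by (intro Bochner_Integration.integrable_diff integrable_mult_right int)
      have n: "norm (?f p x) = norm (poly p x * exp (- (1/2) * x\<^sup>2))" for x
        by (simp add: norm_mult abs_mult)
      show "(?f p \<longlongrightarrow> 0) at_top" "(?f p \<longlongrightarrow> 0) at_bot"
        by (rule tendsto_norm_zero_cancel, unfold n,
            rule tendsto_norm_zero[OF poly_gaussian_tendsto_0(1)] tendsto_norm_zero[OF poly_gaussian_tendsto_0(2)], simp)+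
    qed (auto intro!: continuous_intros)
    moreover have "(LINT x|lborel. ?f (pderiv p - [:0, 1:] * p) x - \<i> * of_real \<xi> * ?f p x) =
        J (pderiv p - [:0, 1:] * p) - \<i> * of_real \<xi> * J p"
      unfolding J_def integral_mult_right_zero[symmetric]
      by (intro Bochner_Integration.integral_diff integrable_mult_right int)
    ultimately show ?thesis
      unfolding diff by (simp only: diff_eq_eq add_0_left right_minus_eq) (simp add: algebra_simps)
  qed
  define b where "b k = (- \<i>) ^ k * of_real (sqrt (2 * pi) * poly (hermite_poly k) \<xi> * exp (- \<xi>\<^sup>2 / 2))" for k
  have rec: "J (hermite_poly (Suc k)) = J (pderiv (hermite_poly k)) - 2 * \<i> * of_real \<xi> * J (hermite_poly k)" for k
  proof -
    have "J ([:0, 2:] * hermite_poly k) = 2 * J ([:0, 1:] * hermite_poly k)"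
      using smult[of 2 "[:0, 1:] * hermite_poly k"] by simp
    moreover have "J (hermite_poly (Suc k)) = J ([:0, 2:] * hermite_poly k) - J (pderiv (hermite_poly k))"
      by (simp only: hermite_poly.simps diff)
    moreover note ibp[of "hermite_poly k"]
    ultimately show ?thesis by (simp add: algebra_simps del: mult_pCons_left)
  qed
  \<comment> \<open>Two consecutive values are carried along because the recursion has three
    terms.\<close>
  have "J (hermite_poly k) = b k \<and> J (hermite_poly (Suc k)) = b (Suc k)" for k
  proof (induction k)
    case 0
    have "J 0 = 0" by (simp add: J_def)
    then show ?case
      using rec[of 0] fourier_gaussian_1d[of \<xi>] by (simp add: J_def b_def pderiv_1 algebra_simps)
  next
    case (Suc k)
    have "J (hermite_poly (Suc (Suc k))) = of_real (2 * (1 + real k)) * b k - 2 * \<i> * of_real \<xi> * b (Suc k)"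
      using rec[of "Suc k"] Suc unfolding pderiv_hermite_poly smult by simp
    moreover have "poly (hermite_poly (Suc (Suc k))) \<xi> =
        2 * \<xi> * poly (hermite_poly (Suc k)) \<xi> - 2 * (1 + real k) * poly (hermite_poly k) \<xi>"
      using hermite_poly.simps(2)[of "Suc k"] unfolding pderiv_hermite_poly by simp
    then have "b (Suc (Suc k)) = of_real (2 * (1 + real k)) * b k - 2 * \<i> * of_real \<xi> * b (Suc k)"
      unfolding b_def by (simp only:) (simp add: algebra_simps del: hermite_poly.simps)
    ultimately show ?case
      using Suc by simp
  qed
  then show ?thesis by (simp add: J_def b_def)
qed

text \<open>Lebesgue measure on \<open>real^'n\<close> is the image of a product measure indexed by
  \<open>Basis\<close>. The work lies in renaming each basis vector \<open>axis j 1\<close> as its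
  coordinate \<open>j\<close>; then the product theorems apply.\<close>

lemma
  fixes \<phi> :: "'n::finite \<Rightarrow> real \<Rightarrow> 'a::{real_normed_field,banach,second_countable_topology}"
  assumes int: "\<And>j. integrable lborel (\<phi> j)"
  shows integrable_lborel_prod: "integrable lborel (\<lambda>x :: real^'n. \<Prod>j\<in>UNIV. \<phi> j (x $ j))"
    and integral_lborel_prod: "(LINT x|lborel. (\<Prod>j\<in>UNIV. \<phi> j ((x :: real^'n) $ j))) = (\<Prod>j\<in>UNIV. (LINT t|lborel. \<phi> j t))"
proof -
  interpret product_sigma_finite "\<lambda>_ :: real^'n. lborel :: real measure" ..
  let ?B = "Basis :: (real^'n) set"
  have B: "?B = (\<lambda>j. axis j 1) ` UNIV" by (auto simp: Basis_vec_def)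
  have inj: "inj (\<lambda>j :: 'n. axis j (1 :: real))" by (auto simp: inj_on_def axis_eq_axis)
  define ix where "ix b = inv (\<lambda>j :: 'n. axis j (1 :: real)) b" for b
  have ix: "ix (axis j 1) = j" for j unfolding ix_def by (rule inv_f_f[OF inj])
  let ?s = "\<lambda>f. \<Sum>b\<in>?B. f b *\<^sub>R b"
  have comp: "?s f $ j = f (axis j 1)" for f j
  proof -
    have "?s f $ j = ?s f \<bullet> axis j 1" by (simp add: cart_eq_inner_axis)
    also have "\<dots> = f (axis j 1)" by (subst inner_sum_left_Basis) (auto simp: B)
    finally show ?thesis .
  qed
  have prod: "(\<Prod>j\<in>UNIV. h j) = (\<Prod>b\<in>?B. h (ix b))" for h :: "'n \<Rightarrow> 'a"
    unfolding B by (subst prod.reindex[OF inj]) (simp add: ix)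
  have ixb: "axis (ix b) 1 = b" if "b \<in> ?B" for b
    using that by (auto simp: B ix)
  have eq: "(\<Prod>j\<in>UNIV. \<phi> j (?s f $ j)) = (\<Prod>b\<in>?B. \<phi> (ix b) (f b))" for f
    unfolding prod comp by (intro prod.cong refl) (simp add: ixb)
  have [measurable]: "\<phi> j \<in> borel_measurable borel" for j
    using borel_measurable_integrable[OF int[of j]] by simp
  have [measurable]: "(\<lambda>x :: real^'n. x $ j) \<in> borel_measurable borel" for j
    by (intro borel_measurable_continuous_onI continuous_intros)
  have meas: "(\<lambda>x :: real^'n. \<Prod>j\<in>UNIV. \<phi> j (x $ j)) \<in> borel_measurable borel"
    by measurable
  have meas2: "?s \<in> measurable (Pi\<^sub>M ?B (\<lambda>_. lborel)) borel"
    by measurable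
  show "integrable lborel (\<lambda>x :: real^'n. \<Prod>j\<in>UNIV. \<phi> j (x $ j))"
    unfolding lborel_eq[where 'a="real^'n"]
    by (subst integrable_distr_eq[OF meas2 meas], unfold eq) (intro product_integrable_prod int finite_Basis)
  show "(LINT x|lborel. (\<Prod>j\<in>UNIV. \<phi> j ((x :: real^'n) $ j))) = (\<Prod>j\<in>UNIV. (LINT t|lborel. \<phi> j t))"
    unfolding lborel_eq[where 'a="real^'n"]
    by (subst integral_distr[OF meas2 meas], unfold eq, subst product_integral_prod)
       (auto intro: int simp: prod lborel_eq[where 'a=real, symmetric])
qed

section \<open>Hermite functions and their inner product\<close>

definition hermite_gauss :: "('n \<Rightarrow> nat) \<Rightarrow> real^'n \<Rightarrow> complex" where
  "hermite_gauss \<alpha> x = hermite_prod \<alpha> x * of_real (exp (- (norm x)\<^sup>2 / 2))"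

text \<open>The squared L2 norm of \<open>hermite_gauss \<alpha>\<close>, equal to pi^(n/2)
  \<alpha>! / 2^(|\<alpha>|). The power of 4 comes from the factor 2^(-|\<alpha>|) in
  \<open>hermite_prod\<close>.\<close>

definition hermite_weight :: "('n::finite \<Rightarrow> nat) \<Rightarrow> real" where
  "hermite_weight \<alpha> = (\<Prod>j\<in>UNIV. 2 ^ \<alpha> j * fact (\<alpha> j) * sqrt pi) / 4 ^ sum \<alpha> UNIV"

lemma hermite_weight_pos: "hermite_weight \<alpha> > 0"
  unfolding hermite_weight_def by (intro divide_pos_pos prod_pos) auto

text \<open>This ratio is what makes multiplication by x_j adjoint to half of the j-th partial
  derivative.\<close>

lemma hermite_weight_Suc:
  "hermite_weight (\<alpha>(j := Suc (\<alpha> j))) = hermite_weight \<alpha> * real (Suc (\<alpha> j)) / 2"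
proof -
  have split: "(\<Prod>i\<in>UNIV. h i) = h j * (\<Prod>i\<in>UNIV - {j}. h i)" for h :: "'a \<Rightarrow> real"
    by (rule prod.remove) auto
  have "(\<Prod>i\<in>UNIV - {j}. 2 ^ (\<alpha>(j := Suc (\<alpha> j))) i * fact ((\<alpha>(j := Suc (\<alpha> j))) i) * sqrt pi) =
      (\<Prod>i\<in>UNIV - {j}. 2 ^ \<alpha> i * fact (\<alpha> i) * sqrt pi)"
    by (intro prod.cong) auto
  then show ?thesis
    unfolding hermite_weight_def sum_upd_Suc by (subst (1 2) split) (simp add: mult_ac)
qed

lemma norm_vec_sq: "(norm (x :: real^'n))\<^sup>2 = (\<Sum>j\<in>UNIV. (x $ j)\<^sup>2)"
  unfolding power2_norm_eq_inner inner_vec_def by (simp add: power2_eq_square)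

lemma hermite_gauss_prod:
  "hermite_gauss \<alpha> x = (\<Prod>j\<in>UNIV. of_real (poly (hermite_poly (\<alpha> j)) (x $ j) * exp (- (x $ j)\<^sup>2 / 2))) / 2 ^ sum \<alpha> UNIV"
proof -
  have "- (norm x)\<^sup>2 / 2 = (\<Sum>j\<in>UNIV. - (x $ j)\<^sup>2 / 2)"
    unfolding norm_vec_sq sum_divide_distrib[symmetric] sum_negf ..
  then have "exp (- (norm x)\<^sup>2 / 2) = (\<Prod>j\<in>UNIV. exp (- (x $ j)\<^sup>2 / 2))"
    by (simp add: exp_sum)
  then show ?thesis
    by (simp add: hermite_gauss_def hermite_prod_def prod.distrib)
qed

lemma
  shows integrable_hermite_gauss_mult:
      "integrable lborel (\<lambda>x. hermite_gauss \<alpha> x * cnj (hermite_gauss \<beta> x))"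
    and L2_inner_hermite_gauss:
      "L2_inner lborel (hermite_gauss \<alpha>) (hermite_gauss \<beta>) =
        (if \<alpha> = \<beta> then of_real (hermite_weight \<alpha>) else 0)"
proof -
  let ?h = "\<lambda>j t. complex_of_real (poly (hermite_poly (\<alpha> j)) t * poly (hermite_poly (\<beta> j)) t * exp (- t\<^sup>2))"
  let ?c = "1 / 2 ^ (sum \<alpha> UNIV + sum \<beta> UNIV)"
  have eq: "(\<lambda>x. hermite_gauss \<alpha> x * cnj (hermite_gauss \<beta> x)) = (\<lambda>x. ?c * (\<Prod>j\<in>UNIV. ?h j (x $ j)))"
  proof
    fix x
    have "?h j (x $ j) = of_real (poly (hermite_poly (\<alpha> j)) (x $ j) * exp (- (x $ j)\<^sup>2 / 2)) *
       of_real (poly (hermite_poly (\<beta> j)) (x $ j) * exp (- (x $ j)\<^sup>2 / 2))" for j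
    proof -
      have "exp (- (x $ j)\<^sup>2) = exp (- (x $ j)\<^sup>2 / 2) * exp (- (x $ j)\<^sup>2 / 2)"
        by (simp flip: exp_add)
      then show ?thesis by (simp only: of_real_mult mult_ac)
    qed
    then show "hermite_gauss \<alpha> x * cnj (hermite_gauss \<beta> x) = ?c * (\<Prod>j\<in>UNIV. ?h j (x $ j))"
      unfolding hermite_gauss_prod by (simp add: prod.distrib power_add del: of_real_mult)
  qed
  have int: "integrable lborel (?h j)" for j
    using integrable_poly_gaussian[of 1 "hermite_poly (\<alpha> j) * hermite_poly (\<beta> j)"]
    by (intro integrable_of_real) simp
  show "integrable lborel (\<lambda>x. hermite_gauss \<alpha> x * cnj (hermite_gauss \<beta> x))"
    unfolding eq by (intro integrable_mult_right integrable_lborel_prod int)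
  have "L2_inner lborel (hermite_gauss \<alpha>) (hermite_gauss \<beta>) =
      ?c * (\<Prod>j\<in>UNIV. of_real (if \<alpha> j = \<beta> j then 2 ^ \<beta> j * fact (\<beta> j) * sqrt pi else 0))"
    unfolding L2_inner_def eq integral_mult_right_zero
    by (subst integral_lborel_prod[OF int]) (simp only: integral_complex_of_real hermite_poly_orthogonality)
  also have "\<dots> = (if \<alpha> = \<beta> then of_real (hermite_weight \<alpha>) else 0)"
  proof (cases "\<alpha> = \<beta>")
    case True
    have "(2::complex) ^ (sum \<beta> UNIV + sum \<beta> UNIV) = 4 ^ sum \<beta> UNIV"
      by (simp add: power_add flip: power_mult_distrib)
    with True show ?thesis by (simp add: hermite_weight_def)
  next
    case False
    then obtain j where "\<alpha> j \<noteq> \<beta> j" by auto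
    then show ?thesis using False by (auto intro!: prod_zero)
  qed
  finally show "L2_inner lborel (hermite_gauss \<alpha>) (hermite_gauss \<beta>) =
        (if \<alpha> = \<beta> then of_real (hermite_weight \<alpha>) else 0)" .
qed

lemma Hermite_eq_hermite_gauss:
  "Hermite \<alpha> = (\<lambda>x. of_real (1 / sqrt (hermite_weight \<alpha>)) * hermite_gauss \<alpha> x)"
proof
  fix x
  have "1 / sqrt (hermite_weight \<alpha>) = (\<Prod>j\<in>UNIV. (2 ^ \<alpha> j * fact (\<alpha> j) * sqrt pi) powr (- 1/2)) * 2 ^ sum \<alpha> UNIV"
  proof -
    have "(\<Prod>j\<in>UNIV. (2 ^ \<alpha> j * fact (\<alpha> j) * sqrt pi) powr (- 1/2)) =
        (\<Prod>j\<in>UNIV. 2 ^ \<alpha> j * fact (\<alpha> j) * sqrt pi) powr (- 1/2)"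
      by (rule prod_powr_distrib[symmetric])
    also have "\<dots> = 1 / sqrt (\<Prod>j\<in>UNIV. 2 ^ \<alpha> j * fact (\<alpha> j) * sqrt pi)"
      by (subst minus_divide_left[symmetric], subst powr_minus_divide, subst powr_half_sqrt) (auto intro!: prod_nonneg)
    finally have "(\<Prod>j\<in>UNIV. (2 ^ \<alpha> j * fact (\<alpha> j) * sqrt pi) powr (- 1/2)) =
        1 / sqrt (\<Prod>j\<in>UNIV. 2 ^ \<alpha> j * fact (\<alpha> j) * sqrt pi)" .
    moreover have "sqrt (4 ^ sum \<alpha> UNIV) = 2 ^ sum \<alpha> UNIV"
      by (metis real_sqrt_four real_sqrt_power)
    ultimately show ?thesis
      by (simp add: hermite_weight_def real_sqrt_divide)
  qed
  then show "Hermite \<alpha> x = of_real (1 / sqrt (hermite_weight \<alpha>)) * hermite_gauss \<alpha> x"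
    unfolding Hermite_def hermite_fun_def hermite_gauss_prod
    by (simp add: prod.distrib)
qed

lemma
  shows integrable_hermite_gauss_exp:
      "integrable lborel (\<lambda>x. hermite_gauss \<alpha> x * exp (- \<i> * of_real (x \<bullet> \<xi>)))"
    and fourier_hermite_gauss:
      "fourier (hermite_gauss \<alpha>) \<xi> = (- \<i>) ^ sum \<alpha> UNIV * hermite_gauss \<alpha> (\<xi> :: real^'n)"
proof -
  let ?h = "\<lambda>j t. complex_of_real (poly (hermite_poly (\<alpha> j)) t * exp (- t\<^sup>2 / 2)) * exp (- \<i> * of_real (t * \<xi> $ j))"
  let ?c = "1 / 2 ^ sum \<alpha> UNIV :: complex"
  have eq: "(\<lambda>x. hermite_gauss \<alpha> x * exp (- \<i> * of_real (x \<bullet> \<xi>))) = (\<lambda>x. ?c * (\<Prod>j\<in>UNIV. ?h j (x $ j)))"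
  proof
    fix x
    have "exp (- \<i> * of_real (x \<bullet> \<xi>)) = (\<Prod>j\<in>UNIV. exp (- \<i> * of_real (x $ j * \<xi> $ j)))"
      by (simp add: inner_vec_def exp_sum[symmetric] sum_distrib_left flip: sum_negf)
    then show "hermite_gauss \<alpha> x * exp (- \<i> * of_real (x \<bullet> \<xi>)) = ?c * (\<Prod>j\<in>UNIV. ?h j (x $ j))"
      unfolding hermite_gauss_prod by (simp only: prod.distrib) simp
  qed
  have int: "integrable lborel (?h j)" for j
    by (rule integrable_poly_gaussian_exp)
  show "integrable lborel (\<lambda>x. hermite_gauss \<alpha> x * exp (- \<i> * of_real (x \<bullet> \<xi>)))"
    unfolding eq by (intro integrable_mult_right integrable_lborel_prod int)
  have "(\<Prod>j\<in>UNIV. (- \<i>) ^ \<alpha> j * complex_of_real (sqrt (2 * pi) * poly (hermite_poly (\<alpha> j)) (\<xi> $ j) * exp (- (\<xi> $ j)\<^sup>2 / 2))) =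
      (- \<i>) ^ sum \<alpha> UNIV * of_real (sqrt (2 * pi) ^ CARD('n)) *
      (\<Prod>j\<in>UNIV. of_real (poly (hermite_poly (\<alpha> j)) (\<xi> $ j) * exp (- (\<xi> $ j)\<^sup>2 / 2)))"
    by (simp add: prod.distrib power_sum algebra_simps)
  \<comment> \<open>The n factors sqrt (2 pi) of the one-dimensional transforms cancel the
    normalisation of \<open>fourier\<close>.\<close>
  moreover have "(2 * pi) powr (- real CARD('n) / 2) * sqrt (2 * pi) ^ CARD('n) = 1"
  proof -
    have "sqrt (2 * pi) ^ CARD('n) = (2 * pi) powr (real CARD('n) / 2)"
      by (simp add: powr_half_sqrt[symmetric] powr_powr flip: powr_realpow)
    then show ?thesis by (simp flip: powr_add)
  qed
  then have "complex_of_real ((2 * pi) powr (- real CARD('n) / 2)) * of_real (sqrt (2 * pi) ^ CARD('n)) = 1"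
    by (metis of_real_1 of_real_mult)
  moreover have "(LINT x|lborel. hermite_gauss \<alpha> x * exp (- \<i> * of_real (x \<bullet> \<xi>))) =
      ?c * (\<Prod>j\<in>UNIV. (- \<i>) ^ \<alpha> j * complex_of_real (sqrt (2 * pi) * poly (hermite_poly (\<alpha> j)) (\<xi> $ j) * exp (- (\<xi> $ j)\<^sup>2 / 2)))"
    by (simp only: eq integral_mult_right_zero integral_lborel_prod[OF int] fourier_hermite_1d)
  ultimately show "fourier (hermite_gauss \<alpha>) \<xi> = (- \<i>) ^ sum \<alpha> UNIV * hermite_gauss \<alpha> \<xi>"
    unfolding fourier_def hermite_gauss_prod[of \<alpha> \<xi>] by (simp only:) (simp add: field_simps)
qed

section \<open>From homogeneous polynomials to Hermite functions, and the inner product pulled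
  back\<close>

definition transform_gauss :: "nat \<Rightarrow> (real^'n \<Rightarrow> complex) \<Rightarrow> real^'n \<Rightarrow> complex" where
  "transform_gauss k p x = hermite_transform k p x * of_real (exp (- (norm x)\<^sup>2 / 2))"

lemma transform_gauss_monom_fun: "sum \<alpha> UNIV = k \<Longrightarrow> transform_gauss k (monom_fun \<alpha>) = hermite_gauss \<alpha>"
  by (simp add: transform_gauss_def[abs_def] hermite_transform_monom_fun hermite_gauss_def[abs_def])

lemma transform_gauss_add:
  assumes "homogeneous_poly_fun k p" "homogeneous_poly_fun k q"
  shows "transform_gauss k (\<lambda>x. p x + q x) = (\<lambda>x. transform_gauss k p x + transform_gauss k q x)"
  by (simp add: transform_gauss_def[abs_def] hermite_transform_add[OF assms] algebra_simps)

lemma transform_gauss_cmult: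
  assumes "homogeneous_poly_fun k p"
  shows "transform_gauss k (\<lambda>x. c * p x) = (\<lambda>x. c * transform_gauss k p x)"
  by (simp add: transform_gauss_def[abs_def] hermite_transform_cmult[OF assms] algebra_simps)

lemma transform_gauss_zero: "transform_gauss k (\<lambda>_. 0) = (\<lambda>_. 0)"
  by (simp add: transform_gauss_def[abs_def] hermite_transform_zero)

lemma transform_gauss_sum:
  assumes "\<And>i. i \<in> I \<Longrightarrow> homogeneous_poly_fun k (p i)"
  shows "transform_gauss k (\<lambda>x. \<Sum>i\<in>I. p i x) = (\<lambda>x. \<Sum>i\<in>I. transform_gauss k (p i) x)"
  by (simp add: transform_gauss_def[abs_def] hermite_transform_sum[OF assms] sum_distrib_right)

lemma integrable_transform_gauss_mult:
  assumes "homogeneous_poly_fun k p" "homogeneous_poly_fun l q"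
  shows "integrable lborel (\<lambda>x. transform_gauss k p x * cnj (transform_gauss l q x))"
  using assms
proof (induction rule: homogeneous_induct)
  case (monom \<alpha>)
  note \<alpha> = monom(1)
  from monom(2) show ?case
  proof (induction rule: homogeneous_induct)
    case (monom \<beta>)
    then show ?case using \<alpha> by (simp add: transform_gauss_monom_fun integrable_hermite_gauss_mult)
  next
    case (add p q)
    then show ?case by (simp add: transform_gauss_add distrib_left)
  next
    case (cmult c p)
    then show ?case
      using integrable_mult_right[of "cnj c", OF cmult(2)]
      by (simp add: transform_gauss_cmult mult.left_commute)
  qed (simp add: transform_gauss_zero)
next
  case (add p q)
  then show ?case by (simp add: transform_gauss_add distrib_right)
next
  case (cmult c p)
  then show ?case by (simp add: transform_gauss_cmult mult.assoc)
qed (simp add: transform_gauss_zero)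

text \<open>On homogeneous polynomials of degree \<open>k\<close> this is pi^(n/2) / 2^k times the
  Fischer inner product, for which monomials are orthogonal and x^\<alpha> has squared norm
  \<alpha>!.\<close>

definition hermite_inner :: "nat \<Rightarrow> (real^'n \<Rightarrow> complex) \<Rightarrow> (real^'n \<Rightarrow> complex) \<Rightarrow> complex" where
  "hermite_inner k p q = L2_inner lborel (transform_gauss k p) (transform_gauss k q)"

lemma hermite_inner_cnj: "hermite_inner k p q = cnj (hermite_inner k q p)"
  unfolding hermite_inner_def L2_inner_def Bochner_Integration.integral_cnj[symmetric]
  by (simp add: mult.commute)

lemma hermite_inner_zero: "hermite_inner k (\<lambda>_. 0) q = 0" "hermite_inner k p (\<lambda>_. 0) = 0"
  by (simp_all add: hermite_inner_def L2_inner_def transform_gauss_zero)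

lemma hermite_inner_add_left:
  assumes "homogeneous_poly_fun k p" "homogeneous_poly_fun k p'" "homogeneous_poly_fun k q"
  shows "hermite_inner k (\<lambda>x. p x + p' x) q = hermite_inner k p q + hermite_inner k p' q"
  using assms
  by (simp add: hermite_inner_def L2_inner_def transform_gauss_add distrib_right integrable_transform_gauss_mult)

lemma hermite_inner_cmult_left:
  assumes "homogeneous_poly_fun k p"
  shows "hermite_inner k (\<lambda>x. c * p x) q = c * hermite_inner k p q"
  using assms
  by (simp add: hermite_inner_def L2_inner_def transform_gauss_cmult mult.assoc)

lemma hermite_inner_sum_left:
  assumes "\<And>i. i \<in> I \<Longrightarrow> homogeneous_poly_fun k (p i)" "homogeneous_poly_fun k q"
  shows "hermite_inner k (\<lambda>x. \<Sum>i\<in>I. p i x) q = (\<Sum>i\<in>I. hermite_inner k (p i) q)"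
  using assms
proof (induction I rule: infinite_finite_induct)
  case (insert i I)
  then show ?case
    using hermite_inner_add_left[of k "p i" "\<lambda>x. \<Sum>i\<in>I. p i x"] by (simp add: homogeneous_sum)
qed (simp_all add: hermite_inner_zero)

lemma hermite_inner_add_right:
  assumes "homogeneous_poly_fun k p" "homogeneous_poly_fun k q" "homogeneous_poly_fun k q'"
  shows "hermite_inner k p (\<lambda>x. q x + q' x) = hermite_inner k p q + hermite_inner k p q'"
  by (subst (1 2 3) hermite_inner_cnj) (simp add: hermite_inner_add_left assms)

lemma hermite_inner_cmult_right:
  assumes "homogeneous_poly_fun k q"
  shows "hermite_inner k p (\<lambda>x. c * q x) = cnj c * hermite_inner k p q"
  by (subst (1 2) hermite_inner_cnj) (simp add: hermite_inner_cmult_left assms)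

lemma hermite_inner_sum_right:
  assumes "\<And>i. i \<in> I \<Longrightarrow> homogeneous_poly_fun k (q i)" "homogeneous_poly_fun k p"
  shows "hermite_inner k p (\<lambda>x. \<Sum>i\<in>I. q i x) = (\<Sum>i\<in>I. hermite_inner k p (q i))"
  by (subst (1 2) hermite_inner_cnj) (simp add: hermite_inner_sum_left assms)

lemma hermite_inner_monom_fun:
  assumes "sum \<alpha> UNIV = k" "sum \<beta> UNIV = k"
  shows "hermite_inner k (monom_fun \<alpha>) (monom_fun \<beta>) = (if \<alpha> = \<beta> then of_real (hermite_weight \<alpha>) else 0)"
  using assms by (simp add: hermite_inner_def transform_gauss_monom_fun L2_inner_hermite_gauss)

text \<open>Up to the factor \<open>1/2\<close>, multiplication by a coordinate is adjoint to the partial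
  derivative, as for the Fischer inner product of homogeneous polynomials.\<close>

lemma hermite_inner_coord_mult:
  assumes "homogeneous_poly_fun k p" "homogeneous_poly_fun (Suc k) q"
  shows "hermite_inner (Suc k) (\<lambda>x. of_real (x $ j) * p x) q = 1/2 * hermite_inner k p (partial_deriv j q)"
  using assms
proof (induction rule: homogeneous_induct)
  case (monom \<alpha>)
  note \<alpha> = monom(1)
  have h\<alpha>: "homogeneous_poly_fun k (monom_fun \<alpha>)" using homogeneous_monom_fun[of \<alpha>] \<alpha> by simp
  have h\<alpha>': "homogeneous_poly_fun (Suc k) (\<lambda>x. of_real (x $ j) * monom_fun \<alpha> x)"
    by (intro homogeneous_coord_mult h\<alpha>)
  from monom(2) show ?case
  proof (induction rule: homogeneous_induct)
    case (monom \<beta>)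
    have L: "hermite_inner (Suc k) (\<lambda>x. of_real (x $ j) * monom_fun \<alpha> x) (monom_fun \<beta>) =
      (if \<alpha>(j := Suc (\<alpha> j)) = \<beta> then of_real (hermite_weight \<beta>) else 0)"
      unfolding coord_mult_monom_fun using \<alpha> monom hermite_inner_monom_fun[of "\<alpha>(j := Suc (\<alpha> j))" "Suc k" \<beta>] sum_upd_Suc[of \<alpha> j]
      by (simp del: fun_upd_apply)
    show ?case
    proof (cases "\<beta> j")
      case 0
      then show ?thesis unfolding L
        by (auto simp: partial_deriv_monom_fun hermite_inner_zero)
    next
      case (Suc i)
      have s: "sum (\<beta>(j := \<beta> j - 1)) UNIV = k" using sum_upd_pred[of \<beta> j] Suc monom by simp
      have h\<beta>: "homogeneous_poly_fun k (monom_fun (\<beta>(j := \<beta> j - 1)))"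
        using homogeneous_monom_fun[of "\<beta>(j := \<beta> j - 1)"] s by simp
      have "hermite_inner k (monom_fun \<alpha>) (partial_deriv j (monom_fun \<beta>)) =
        of_nat (\<beta> j) * (if \<alpha> = \<beta>(j := \<beta> j - 1) then of_real (hermite_weight \<alpha>) else 0)"
        unfolding partial_deriv_monom_fun hermite_inner_cmult_right[OF h\<beta>] hermite_inner_monom_fun[OF \<alpha> s] by simp
      \<comment> \<open>Lowering \<beta> undoes raising \<alpha> because \<beta> j > 0 in this
        case.\<close>
      moreover have "\<alpha> = \<beta>(j := \<beta> j - 1) \<longleftrightarrow> \<alpha>(j := Suc (\<alpha> j)) = \<beta>"
        using Suc by (auto simp: fun_eq_iff)
      moreover have "complex_of_real (hermite_weight \<beta>) = 1/2 * (of_nat (\<beta> j) * of_real (hermite_weight \<alpha>))"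
        if "\<alpha>(j := Suc (\<alpha> j)) = \<beta>"
      proof -
        have "hermite_weight \<beta> = 1/2 * (real (\<beta> j) * hermite_weight \<alpha>)"
          using hermite_weight_Suc[of \<alpha> j] that by auto
        then show ?thesis
          by (simp only: of_real_mult of_real_divide of_real_1 of_real_numeral of_real_of_nat_eq)
      qed
      ultimately show ?thesis unfolding L by simp
    qed
  next
    case (add q q')
    have q: "homogeneous_poly_fun (Suc k) q" "homogeneous_poly_fun (Suc k) q'" by fact+
    have pd: "homogeneous_poly_fun k (partial_deriv j q)" "homogeneous_poly_fun k (partial_deriv j q')"
      using q[THEN homogeneous_partial_deriv, of j] by simp_all
    have IH: "hermite_inner (Suc k) (\<lambda>x. of_real (x $ j) * monom_fun \<alpha> x) q =
        1/2 * hermite_inner k (monom_fun \<alpha>) (partial_deriv j q)"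
      "hermite_inner (Suc k) (\<lambda>x. of_real (x $ j) * monom_fun \<alpha> x) q' =
        1/2 * hermite_inner k (monom_fun \<alpha>) (partial_deriv j q')" by fact+
    show ?case
      unfolding partial_deriv_hom_add[OF q] hermite_inner_add_right[OF h\<alpha> pd] hermite_inner_add_right[OF h\<alpha>' q]
        IH distrib_left ..
  next
    case (cmult c q)
    have q: "homogeneous_poly_fun (Suc k) q" by fact
    have pd: "homogeneous_poly_fun k (partial_deriv j q)"
      using homogeneous_partial_deriv[OF q, of j] by simp
    have IH: "hermite_inner (Suc k) (\<lambda>x. of_real (x $ j) * monom_fun \<alpha> x) q =
        1/2 * hermite_inner k (monom_fun \<alpha>) (partial_deriv j q)" by fact
    show ?case
      unfolding partial_deriv_hom_cmult[OF q] hermite_inner_cmult_right[OF pd] hermite_inner_cmult_right[OF q]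
        IH mult.left_commute[of "cnj c"] ..
  next
    case zero
    then show ?case by (simp add: hermite_inner_zero partial_deriv_const[abs_def])
  qed
next
  case (add p p')
  have q: "homogeneous_poly_fun (Suc k) q" by fact
  have p: "homogeneous_poly_fun k p" "homogeneous_poly_fun k p'" by fact+
  have pd: "homogeneous_poly_fun k (partial_deriv j q)"
    using homogeneous_partial_deriv[OF q, of j] by simp
  have IH: "hermite_inner (Suc k) (\<lambda>x. of_real (x $ j) * p x) q = 1/2 * hermite_inner k p (partial_deriv j q)"
    "hermite_inner (Suc k) (\<lambda>x. of_real (x $ j) * p' x) q = 1/2 * hermite_inner k p' (partial_deriv j q)"
    using add q by blast+
  show ?case
    unfolding distrib_left hermite_inner_add_left[OF p pd] hermite_inner_add_left[OF p[THEN homogeneous_coord_mult] q] IH ..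
next
  case (cmult c p)
  have q: "homogeneous_poly_fun (Suc k) q" by fact
  have p: "homogeneous_poly_fun k p" by fact
  have IH: "hermite_inner (Suc k) (\<lambda>x. of_real (x $ j) * p x) q = 1/2 * hermite_inner k p (partial_deriv j q)"
    using cmult q by blast
  show ?case
    unfolding mult.left_commute[of _ c] hermite_inner_cmult_left[OF p] hermite_inner_cmult_left[OF homogeneous_coord_mult[OF p]] IH ..
qed (simp add: hermite_inner_zero)

text \<open>The adjointness of coordinate and derivative is used twice in each coordinate, so its
  factor 1/2 is squared.\<close>

lemma hermite_inner_norm_sq_mult:
  assumes p: "homogeneous_poly_fun k p" and q: "homogeneous_poly_fun (Suc (Suc k)) q"
  shows "hermite_inner (Suc (Suc k)) (norm_sq_mult p) q = 1/4 * hermite_inner k p (laplacian q)"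
proof -
  have pd: "homogeneous_poly_fun (Suc k) (partial_deriv j q)" for j
    using homogeneous_partial_deriv[OF q] by simp
  have pd2: "homogeneous_poly_fun k (partial_deriv j (partial_deriv j q))" for j
    using homogeneous_partial_deriv[OF pd] by simp
  have "hermite_inner (Suc (Suc k)) (norm_sq_mult p) q =
    (\<Sum>j\<in>UNIV. hermite_inner (Suc (Suc k)) (\<lambda>x. of_real (x $ j) * (of_real (x $ j) * p x)) q)"
    unfolding norm_sq_mult_eq by (intro hermite_inner_sum_left homogeneous_coord_mult p q)
  also have "\<dots> = (\<Sum>j\<in>UNIV. 1/4 * hermite_inner k p (partial_deriv j (partial_deriv j q)))"
    by (intro sum.cong refl)
       (simp add: hermite_inner_coord_mult homogeneous_coord_mult p q pd)
  also have "\<dots> = 1/4 * hermite_inner k p (laplacian q)"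
    unfolding laplacian_def[abs_def]
    by (subst hermite_inner_sum_right[OF pd2 p]) (simp_all add: sum_distrib_left)
  finally show ?thesis .
qed

lemma hermite_inner_norm_sq_mult_funpow:
  assumes p: "homogeneous_poly_fun m p" and q: "homogeneous_poly_fun (m + 2 * l) q"
  shows "hermite_inner (m + 2 * l) ((norm_sq_mult ^^ l) p) q = (1/4) ^ l * hermite_inner m p ((laplacian ^^ l) q)"
  using q
proof (induction l arbitrary: q)
  case (Suc l)
  have "homogeneous_poly_fun (m + 2 * l) (laplacian q)"
    using homogeneous_laplacian[OF Suc.prems] by simp
  then show ?case
    using Suc.IH[of "laplacian q"] Suc.prems
      hermite_inner_norm_sq_mult[OF homogeneous_norm_sq_mult_funpow[OF p], of l q]
    by (simp add: funpow_swap1)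
qed simp

text \<open>The surplus power \<open>l\<close> stays arbitrary because the induction peels off the
  last Laplacian and uses the hypothesis at \<open>Suc l\<close>.\<close>

lemma laplacian_funpow_norm_sq_mult_funpow:
  fixes p :: "real^'n \<Rightarrow> complex"
  assumes p: "homogeneous_poly_fun m p" and harm: "laplacian p = (\<lambda>_. 0)"
  shows "(laplacian ^^ i) ((norm_sq_mult ^^ (l + i)) p) =
    (\<lambda>x. of_real (\<Prod>r<i. 4 * real (l + r + 1) * (real (l + r + m) + real CARD('n) / 2)) * (norm_sq_mult ^^ l) p x)"
proof (induction i arbitrary: l)
  case (Suc i)
  have "(laplacian ^^ Suc i) ((norm_sq_mult ^^ (l + Suc i)) p) =
      laplacian ((laplacian ^^ i) ((norm_sq_mult ^^ (Suc l + i)) p))"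
    by simp
  also have "\<dots> = laplacian (\<lambda>x. of_real (\<Prod>r<i. 4 * real (Suc l + r + 1) * (real (Suc l + r + m) + real CARD('n) / 2)) * (norm_sq_mult ^^ Suc l) p x)"
    unfolding Suc.IH[of "Suc l"] ..
  also have "\<dots> = (\<lambda>x. of_real (\<Prod>r<i. 4 * real (Suc l + r + 1) * (real (Suc l + r + m) + real CARD('n) / 2)) *
      (of_real (4 * (l + 1) * (l + m + CARD('n) / 2)) * (norm_sq_mult ^^ l) p x))"
    unfolding laplacian_cmult[OF homogeneous_norm_sq_mult_funpow[OF p]] laplacian_norm_sq_mult_funpow[OF p harm] by simp
  also have "\<dots> = (\<lambda>x. of_real (\<Prod>r<Suc i. 4 * real (l + r + 1) * (real (l + r + m) + real CARD('n) / 2)) * (norm_sq_mult ^^ l) p x)"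
    unfolding prod.lessThan_Suc_shift by (simp add: mult_ac)
  finally show ?case .
qed simp

text \<open>Moving all factors |x|^2 to the other side leaves the l-th Laplacian of |x|^(2l) p, a
  multiple of \<open>p\<close>. The factors 4 in that multiple cancel the factors 1/4 of
  adjointness.\<close>

lemma hermite_inner_harmonic_self:
  fixes p :: "real^'n \<Rightarrow> complex"
  assumes p: "homogeneous_poly_fun m p" and harm: "laplacian p = (\<lambda>_. 0)"
  shows "hermite_inner (m + 2 * l) ((norm_sq_mult ^^ l) p) ((norm_sq_mult ^^ l) p) =
    of_real (fact l * pochhammer (m + CARD('n) / 2) l) * hermite_inner m p p"
proof -
  define P where "P = (\<Prod>r<l. 4 * real (r + 1) * (real (r + m) + CARD('n) / 2))"
  have "(laplacian ^^ l) ((norm_sq_mult ^^ l) p) = (\<lambda>x. of_real P * p x)"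
    using laplacian_funpow_norm_sq_mult_funpow[OF p harm, of l 0] by (simp add: P_def)
  then have "hermite_inner (m + 2 * l) ((norm_sq_mult ^^ l) p) ((norm_sq_mult ^^ l) p) =
      (1/4) ^ l * (of_real P * hermite_inner m p p)"
    by (simp add: hermite_inner_norm_sq_mult_funpow[OF p homogeneous_norm_sq_mult_funpow[OF p]]
        hermite_inner_cmult_right[OF p])
  moreover have "P = 4 ^ l * (fact l * pochhammer (m + CARD('n) / 2) l)"
    unfolding P_def prod.distrib fact_prod_Suc pochhammer_prod
    by (simp add: lessThan_atLeast0 algebra_simps)
  ultimately show ?thesis by (simp add: power_one_over field_simps)
qed

text \<open>Move the larger number \<open>l\<close> of factors |x|^2 across as Laplacians: more of
  them arrive than are needed to reduce |x|^(2l') q to the harmonic \<open>q\<close>.\<close>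

lemma hermite_inner_harmonic_orthogonal:
  fixes p q :: "real^'n \<Rightarrow> complex"
  assumes p: "homogeneous_poly_fun m p" and q: "homogeneous_poly_fun m' q" "laplacian q = (\<lambda>_. 0)"
    and k: "m + 2 * l = m' + 2 * l'" "l' < l"
  shows "hermite_inner (m + 2 * l) ((norm_sq_mult ^^ l) p) ((norm_sq_mult ^^ l') q) = 0"
proof -
  \<comment> \<open>After l' Laplacians only a multiple of \<open>q\<close> is left, and the
    remaining \<open>Suc i\<close>, at least one, annihilate it.\<close>
  define i where "i = l - l' - 1"
  have i: "l = Suc i + l'" using k(2) by (simp add: i_def)
  have "(laplacian ^^ l) ((norm_sq_mult ^^ l') q) = (laplacian ^^ Suc i) ((laplacian ^^ l') ((norm_sq_mult ^^ l') q))"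
    unfolding i funpow_add by simp
  also have "\<dots> = (laplacian ^^ Suc i) (\<lambda>x. of_real (\<Prod>r<l'. 4 * real (r + 1) * (real (r + m') + real CARD('n) / 2)) * q x)"
    using laplacian_funpow_norm_sq_mult_funpow[OF q, of l' 0] by simp
  also have "\<dots> = (\<lambda>_. 0)"
  proof -
    have "(laplacian ^^ Suc i) q = (\<lambda>_. 0)"
      by (simp add: funpow_swap1 q(2) laplacian_funpow_zero)
    then show ?thesis
      by (simp only: laplacian_funpow_cmult[OF q(1)] mult_zero_right)
  qed
  finally show ?thesis
    using hermite_inner_norm_sq_mult_funpow[OF p, of l "(norm_sq_mult ^^ l') q"]
      homogeneous_norm_sq_mult_funpow[OF q(1), of l'] k(1)
    by (simp add: hermite_inner_zero)
qed

lemma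
  assumes "homogeneous_poly_fun k p"
  shows integrable_transform_gauss_exp:
      "integrable lborel (\<lambda>x. transform_gauss k p x * exp (- \<i> * of_real (x \<bullet> \<xi>)))" (is ?A)
    and fourier_transform_gauss:
      "fourier (transform_gauss k p) \<xi> = (- \<i>) ^ k * transform_gauss k p \<xi>" (is ?B)
proof -
  have "?A \<and> ?B"
    using assms
  proof (induction rule: homogeneous_induct)
    case (monom \<alpha>)
    then show ?case
      using integrable_hermite_gauss_exp[of \<alpha> \<xi>] fourier_hermite_gauss[of \<alpha> \<xi>]
      by (simp add: transform_gauss_monom_fun)
  next
    case zero
    then show ?case by (simp add: transform_gauss_zero fourier_def)
  next
    case (add p q)
    then show ?case by (simp add: transform_gauss_add fourier_def distrib_left distrib_right)
  next
    case (cmult c p)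
    have p: "homogeneous_poly_fun k p" by fact
    have eq: "(\<lambda>x. transform_gauss k (\<lambda>x. c * p x) x * exp (- \<i> * of_real (x \<bullet> \<xi>))) =
        (\<lambda>x. c * (transform_gauss k p x * exp (- \<i> * of_real (x \<bullet> \<xi>))))"
      by (simp add: transform_gauss_cmult[OF p] mult.assoc)
    have IH: "integrable lborel (\<lambda>x. transform_gauss k p x * exp (- \<i> * of_real (x \<bullet> \<xi>)))"
      "fourier (transform_gauss k p) \<xi> = (- \<i>) ^ k * transform_gauss k p \<xi>"
      using cmult by blast+
    have "fourier (transform_gauss k (\<lambda>x. c * p x)) \<xi> = c * fourier (transform_gauss k p) \<xi>"
      unfolding fourier_def eq integral_mult_right_zero by (rule mult.left_commute)
    also have "\<dots> = (- \<i>) ^ k * transform_gauss k (\<lambda>x. c * p x) \<xi>"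
      unfolding IH(2) transform_gauss_cmult[OF p] by (rule mult.left_commute)
    finally show ?case
      using integrable_mult_right[OF IH(1), of c] unfolding eq by blast
  qed
  then show ?A ?B by auto
qed

text \<open>Parseval for the orthogonal monomials. It bounds each coefficient by the norm, and in
  the main proof it evaluates the norm of the projection.\<close>

lemma hermite_inner_self_ge:
  assumes p: "p = (\<lambda>x. \<Sum>\<alpha> | sum \<alpha> UNIV = k. c \<alpha> * monom_fun \<alpha> x)"
  shows "hermite_inner k p p = of_real (\<Sum>\<alpha> | sum \<alpha> UNIV = k. (norm (c \<alpha>))\<^sup>2 * hermite_weight \<alpha>)"
proof -
  let ?S = "{\<alpha> :: 'a \<Rightarrow> nat. sum \<alpha> UNIV = k}"
  have h: "homogeneous_poly_fun k (monom_fun \<alpha>)" if "\<alpha> \<in> ?S" for \<alpha> :: "'a \<Rightarrow> nat"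
    using homogeneous_monom_fun[of \<alpha>] that by simp
  have hp: "homogeneous_poly_fun k p"
    unfolding homogeneous_poly_fun_iff using p by blast
  have "hermite_inner k p p = (\<Sum>\<alpha>\<in>?S. c \<alpha> * hermite_inner k (monom_fun \<alpha>) p)"
    by (subst p, subst hermite_inner_sum_left[OF homogeneous_cmult[OF h] hp])
       (simp_all add: hermite_inner_cmult_left[OF h])
  also have "\<dots> = (\<Sum>\<alpha>\<in>?S. c \<alpha> * (cnj (c \<alpha>) * of_real (hermite_weight \<alpha>)))"
  proof (intro sum.cong refl)
    fix \<alpha> assume \<alpha>: "\<alpha> \<in> ?S"
    have "hermite_inner k (monom_fun \<alpha>) p = (\<Sum>\<beta>\<in>?S. cnj (c \<beta>) * hermite_inner k (monom_fun \<alpha>) (monom_fun \<beta>))"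
      by (subst p, subst hermite_inner_sum_right[OF homogeneous_cmult[OF h] h[OF \<alpha>]])
         (simp_all add: hermite_inner_cmult_right[OF h])
    also have "\<dots> = (\<Sum>\<beta>\<in>?S. if \<alpha> = \<beta> then cnj (c \<beta>) * of_real (hermite_weight \<alpha>) else 0)"
      using \<alpha> by (intro sum.cong refl) (auto simp: hermite_inner_monom_fun)
    also have "\<dots> = cnj (c \<alpha>) * of_real (hermite_weight \<alpha>)"
      using \<alpha> by (simp add: finite_multiindices)
    finally show "c \<alpha> * hermite_inner k (monom_fun \<alpha>) p = c \<alpha> * (cnj (c \<alpha>) * of_real (hermite_weight \<alpha>))"
      by simp
  qed
  also have "\<dots> = of_real (\<Sum>\<alpha>\<in>?S. (norm (c \<alpha>))\<^sup>2 * hermite_weight \<alpha>)"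
    by (simp only: of_real_sum of_real_mult complex_norm_square mult.assoc)
  finally show ?thesis .
qed

lemma L2_norm_transform_gauss:
  "L2_norm lborel (transform_gauss k p) = sqrt (Re (hermite_inner k p p))"
proof -
  have "hermite_inner k p p = of_real (LINT x|lborel. (norm (transform_gauss k p x))\<^sup>2)"
    unfolding hermite_inner_def L2_inner_def complex_norm_square[symmetric] integral_complex_of_real ..
  then show ?thesis by (simp add: L2_norm_def)
qed

text \<open>An equivalence of norms on a finite-dimensional space, made explicit. The point is that
  the constant serves all \<open>p\<close> of degree \<open>k\<close>, since the harmonic components
  to be estimated vary with the projection.\<close>

lemma homogeneous_bound:
  "\<exists>C>0. \<forall>p. homogeneous_poly_fun k p \<longrightarrow>
    (\<forall>x :: real^'n. norm (p x) \<le> C * L2_norm lborel (transform_gauss k p) * norm x ^ k)"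
proof -
  let ?S = "{\<alpha> :: 'n \<Rightarrow> nat. sum \<alpha> UNIV = k}"
  define C where "C = 1 + (\<Sum>\<alpha>\<in>?S. 1 / sqrt (hermite_weight \<alpha>))"
  have "C > 0" unfolding C_def by (intro add_pos_nonneg sum_nonneg) (auto intro: less_imp_le hermite_weight_pos)
  moreover have "norm (p x) \<le> C * L2_norm lborel (transform_gauss k p) * norm x ^ k"
    if p: "homogeneous_poly_fun k p" for p and x :: "real^'n"
  proof -
    obtain c where c: "p = (\<lambda>x. \<Sum>\<alpha>\<in>?S. c \<alpha> * monom_fun \<alpha> x)"
      using p unfolding homogeneous_poly_fun_iff by blast
    define L where "L = L2_norm lborel (transform_gauss k p)"
    have L: "L = sqrt (\<Sum>\<alpha>\<in>?S. (norm (c \<alpha>))\<^sup>2 * hermite_weight \<alpha>)"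
      unfolding L_def L2_norm_transform_gauss hermite_inner_self_ge[OF c] by simp
    have L0: "L \<ge> 0" unfolding L by (intro real_sqrt_ge_zero sum_nonneg mult_nonneg_nonneg less_imp_le[OF hermite_weight_pos]) auto
    have "norm (c \<alpha>) \<le> L / sqrt (hermite_weight \<alpha>)" if "\<alpha> \<in> ?S" for \<alpha>
    proof -
      have "norm (c \<alpha>) * sqrt (hermite_weight \<alpha>) = sqrt ((norm (c \<alpha>))\<^sup>2 * hermite_weight \<alpha>)"
        by (simp add: real_sqrt_mult)
      also have "\<dots> \<le> L" unfolding L
        using that by (intro real_sqrt_le_mono member_le_sum finite_multiindices mult_nonneg_nonneg less_imp_le[OF hermite_weight_pos]) auto
      finally show ?thesis using hermite_weight_pos[of \<alpha>] by (simp add: field_simps)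
    qed
    moreover have "norm (monom_fun \<alpha> x) \<le> norm x ^ k" if "\<alpha> \<in> ?S" for \<alpha>
    proof -
      have "norm (monom_fun \<alpha> x) = (\<Prod>j\<in>UNIV. \<bar>x $ j\<bar> ^ \<alpha> j)"
        unfolding monom_fun_def by (simp only: norm_of_real abs_prod power_abs)
      also have "\<dots> \<le> (\<Prod>j\<in>UNIV. norm x ^ \<alpha> j)"
        by (intro prod_mono conjI power_mono component_le_norm_cart) auto
      also have "\<dots> = norm x ^ k" using that by (simp flip: power_sum)
      finally show ?thesis .
    qed
    ultimately have "norm (c \<alpha> * monom_fun \<alpha> x) \<le> (L / sqrt (hermite_weight \<alpha>)) * norm x ^ k" if "\<alpha> \<in> ?S" for \<alpha>
      unfolding norm_mult using that L0 less_imp_le[OF hermite_weight_pos[of \<alpha>]]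
      by (intro mult_mono divide_nonneg_nonneg) auto
    then have "norm (p x) \<le> (\<Sum>\<alpha>\<in>?S. (L / sqrt (hermite_weight \<alpha>)) * norm x ^ k)"
      unfolding c by (rule sum_norm_le)
    also have "\<dots> = (C - 1) * L * norm x ^ k"
      by (simp add: C_def sum_distrib_left sum_distrib_right)
    also have "\<dots> \<le> C * L * norm x ^ k"
      using L0 by (intro mult_right_mono) auto
    finally show ?thesis unfolding L_def .
  qed
  ultimately show ?thesis by blast
qed

section \<open>Polar coordinates\<close>

lemma nn_integral_euclidean_scale:
  fixes f :: "'a::euclidean_space \<Rightarrow> ennreal"
  assumes [measurable]: "f \<in> borel_measurable borel" and c: "c > 0"
  shows "(\<integral>\<^sup>+x. f x \<partial>lborel) = ennreal (c ^ DIM('a)) * (\<integral>\<^sup>+x. f (c *\<^sub>R x) \<partial>lborel)"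
  using c by (subst lborel_affine[of c 0]) (simp_all add: nn_integral_density nn_integral_distr nn_integral_cmult)

text \<open>The inner integral left in \<open>nn_integral_polar\<close> when h(y) is pulled out;
  with R = |y| it cancels the weight |y|^n.\<close>

lemma nn_integral_tail_power:
  assumes "R > 0" "n > 0"
  shows "(\<integral>\<^sup>+s. ennreal (real n / s ^ Suc n) * indicator {R<..} s \<partial>lborel) = ennreal (1 / R ^ n)"
proof -
  have "(\<integral>\<^sup>+s. ennreal (real n / s ^ Suc n) * indicator {R<..} s \<partial>lborel) =
      (\<integral>\<^sup>+s. ennreal (real n / s ^ Suc n) * indicator {R..} s \<partial>lborel)"
    using AE_lborel_singleton[of R]
    by (intro nn_integral_cong_AE) (auto elim!: eventually_mono split: split_indicator)
  also have "\<dots> = ennreal (0 - (- 1 / R ^ n))"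
  proof (rule nn_integral_FTC_atLeast)
    show "((\<lambda>s :: real. - 1 / s ^ n) \<longlongrightarrow> 0) at_top"
      by (rule tendsto_divide_0[OF tendsto_const], rule filterlim_at_top_imp_at_infinity,
          rule filterlim_pow_at_top[OF assms(2) filterlim_ident])
    show "DERIV (\<lambda>s. - 1 / s ^ n) x :> real n / x ^ Suc n" if "R \<le> x" for x
    proof -
      have "x > 0" using that assms by simp
      then have "DERIV (\<lambda>s. - inverse (s ^ n)) x :> real n * x ^ (n - 1) * inverse ((x ^ n)\<^sup>2)"
        by (auto intro!: derivative_eq_intros simp: power2_eq_square)
      moreover have "real n * x ^ (n - 1) * inverse ((x ^ n)\<^sup>2) = real n / x ^ Suc n"
        using \<open>x > 0\<close> assms(2) by (cases n) (auto simp: field_simps power2_eq_square)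
      moreover have "(\<lambda>s :: real. - 1 / s ^ n) = (\<lambda>s. - inverse (s ^ n))"
        by (simp add: divide_inverse)
      ultimately show ?thesis by (simp only:)
    qed
  qed (use assms in auto)
  finally show ?thesis by simp
qed

text \<open>Integrals over the sphere are computed here: \<open>sphere_measure\<close> is n times
  the image of this measure under \<open>sgn\<close>.\<close>

definition punctured_ball :: "(real^'n) measure" where
  "punctured_ball = restrict_space lborel (ball 0 1 - {0})"

lemma space_punctured_ball: "space punctured_ball = ball 0 1 - {0}"
  by (simp add: punctured_ball_def space_restrict_space)

lemma finite_measure_punctured_ball: "finite_measure (punctured_ball :: (real^'n) measure)"
proof (rule finite_measureI)
  have "emeasure lborel (ball (0 :: real^'n) 1 - {0}) \<le> emeasure lborel (ball (0 :: real^'n) 1)"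
    by (intro emeasure_mono) auto
  also have "\<dots> < \<infinity>"
    using emeasure_lborel_ball_finite by blast
  finally show "emeasure punctured_ball (space (punctured_ball :: (real^'n) measure)) \<noteq> \<infinity>"
    by (simp add: space_punctured_ball) (simp add: punctured_ball_def emeasure_restrict_space)
qed

lemma borel_measurable_sgn_vec [measurable]: "(sgn :: real^'n \<Rightarrow> real^'n) \<in> borel_measurable borel"
proof -
  have "(\<lambda>x :: real^'n. x /\<^sub>R norm x) \<in> borel_measurable borel"
    by measurable
  then show ?thesis by (simp add: sgn_div_norm[abs_def])
qed

lemma measurable_punctured_ball:
  "f \<in> measurable borel N \<Longrightarrow> f \<in> measurable punctured_ball N"
  unfolding punctured_ball_def by (rule measurable_restrict_space1) simp

text \<open>Substituting \<open>r = s |x|\<close> and then \<open>y = s x\<close> in the right-hand side, the integral over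
  \<open>s > |y|\<close> that remains for each \<open>y\<close> is elementary.\<close>

lemma nn_integral_polar:
  fixes h :: "real^'n \<Rightarrow> ennreal"
  assumes [measurable]: "h \<in> borel_measurable borel"
  shows "(\<integral>\<^sup>+r. ennreal (real CARD('n) * r ^ (CARD('n) - 1)) * indicator {0<..} r *
      (\<integral>\<^sup>+x. h (r *\<^sub>R sgn x) \<partial>punctured_ball) \<partial>lborel) = (\<integral>\<^sup>+y. h y \<partial>lborel)"
proof -
  let ?n = "CARD('n)" and ?B = "ball 0 1 - {0} :: (real^'n) set"
  let ?w = "\<lambda>r. ennreal (real ?n * r ^ (?n - 1)) * indicator {0<..} r"
  have n: "?n > 0" by simp
  have [measurable]: "?B \<in> sets borel" by (intro borel_open open_Diff) auto
  have "(\<integral>\<^sup>+r. ?w r * (\<integral>\<^sup>+x. h (r *\<^sub>R sgn x) \<partial>punctured_ball) \<partial>lborel) =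
      (\<integral>\<^sup>+r. (\<integral>\<^sup>+x. ?w r * (h (r *\<^sub>R sgn x) * indicator ?B x) \<partial>lborel) \<partial>lborel)"
  proof (rule nn_integral_cong)
    fix r :: real
    have "(\<integral>\<^sup>+x. h (r *\<^sub>R sgn x) \<partial>punctured_ball) = (\<integral>\<^sup>+x. h (r *\<^sub>R sgn x) * indicator ?B x \<partial>lborel)"
      unfolding punctured_ball_def by (subst nn_integral_restrict_space) auto
    then show "?w r * (\<integral>\<^sup>+x. h (r *\<^sub>R sgn x) \<partial>punctured_ball) =
      (\<integral>\<^sup>+x. ?w r * (h (r *\<^sub>R sgn x) * indicator ?B x) \<partial>lborel)"
      by (simp only:) (rule nn_integral_cmult[symmetric], measurable)
  qed
  also have "\<dots> = (\<integral>\<^sup>+x. (\<integral>\<^sup>+r. ?w r * (h (r *\<^sub>R sgn x) * indicator ?B x) \<partial>lborel) \<partial>lborel)"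
    by (rule lborel_pair.Fubini') measurable
  also have "\<dots> = (\<integral>\<^sup>+x. (\<integral>\<^sup>+s. ?w s * (ennreal (norm x ^ ?n) * h (s *\<^sub>R x) * indicator ?B x) \<partial>lborel) \<partial>lborel)"
  proof (rule nn_integral_cong)
    fix x :: "real^'n"
    show "(\<integral>\<^sup>+r. ?w r * (h (r *\<^sub>R sgn x) * indicator ?B x) \<partial>lborel) =
      (\<integral>\<^sup>+s. ?w s * (ennreal (norm x ^ ?n) * h (s *\<^sub>R x) * indicator ?B x) \<partial>lborel)"
    proof (cases "x \<in> ?B")
      case True
      then have x: "norm x > 0" by simp
      have "(\<integral>\<^sup>+r. ?w r * (h (r *\<^sub>R sgn x) * indicator ?B x) \<partial>lborel) =
        ennreal (norm x) * (\<integral>\<^sup>+s. ?w (norm x * s) * (h ((norm x * s) *\<^sub>R sgn x) * indicator ?B x) \<partial>lborel)"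
        using x by (subst nn_integral_real_affine[where c="norm x" and t=0]) auto
      also have "\<dots> = (\<integral>\<^sup>+s. ennreal (norm x) * (?w (norm x * s) * (h ((norm x * s) *\<^sub>R sgn x) * indicator ?B x)) \<partial>lborel)"
        by (subst nn_integral_cmult) auto
      also have "\<dots> = (\<integral>\<^sup>+s. ?w s * (ennreal (norm x ^ ?n) * h (s *\<^sub>R x) * indicator ?B x) \<partial>lborel)"
      proof (rule nn_integral_cong)
        fix s :: real
        have 1: "(norm x * s) *\<^sub>R sgn x = s *\<^sub>R x"
          using x by (simp add: sgn_div_norm)
        have 2: "ennreal (norm x) * ?w (norm x * s) = ?w s * ennreal (norm x ^ ?n)"
        proof (cases "s > 0")
          case True
          have "norm x * (real ?n * (norm x * s) ^ (?n - 1)) = real ?n * s ^ (?n - 1) * norm x ^ ?n"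
            using n by (cases ?n) (auto simp: power_mult_distrib algebra_simps)
          with True x show ?thesis
            by (simp add: ennreal_mult[symmetric] zero_less_mult_iff)
        next
          case False
          then show ?thesis using x by (simp add: zero_less_mult_iff)
        qed
        show "ennreal (norm x) * (?w (norm x * s) * (h ((norm x * s) *\<^sub>R sgn x) * indicator ?B x)) =
          ?w s * (ennreal (norm x ^ ?n) * h (s *\<^sub>R x) * indicator ?B x)"
          by (simp only: 1 mult.assoc[symmetric] 2[unfolded mult.assoc[symmetric]])
      qed
      finally show ?thesis .
    qed simp
  qed
  also have "\<dots> = (\<integral>\<^sup>+s. (\<integral>\<^sup>+x. ?w s * (ennreal (norm x ^ ?n) * h (s *\<^sub>R x) * indicator ?B x) \<partial>lborel) \<partial>lborel)"
    by (rule lborel_pair.Fubini') measurable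
  also have "\<dots> = (\<integral>\<^sup>+s. (\<integral>\<^sup>+y. (ennreal (real ?n / s ^ Suc ?n) * indicator {norm y<..} s) *
      (ennreal (norm y ^ ?n) * h y * indicator (- {0}) y) \<partial>lborel) \<partial>lborel)"
  proof (rule nn_integral_cong)
    fix s :: real
    show "(\<integral>\<^sup>+x. ?w s * (ennreal (norm x ^ ?n) * h (s *\<^sub>R x) * indicator ?B x) \<partial>lborel) =
      (\<integral>\<^sup>+y. (ennreal (real ?n / s ^ Suc ?n) * indicator {norm y<..} s) *
        (ennreal (norm y ^ ?n) * h y * indicator (- {0}) y) \<partial>lborel)"
    proof (cases "s > 0")
      case True
      have "(\<integral>\<^sup>+y. (ennreal (real ?n / s ^ Suc ?n) * indicator {norm y<..} s) *
        (ennreal (norm y ^ ?n) * h y * indicator (- {0}) y) \<partial>lborel) =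
        (\<integral>\<^sup>+x. ennreal (s ^ ?n) * ((ennreal (real ?n / s ^ Suc ?n) * indicator {norm (s *\<^sub>R x)<..} s) *
        (ennreal (norm (s *\<^sub>R x) ^ ?n) * h (s *\<^sub>R x) * indicator (- {0}) (s *\<^sub>R x))) \<partial>lborel)"
      proof -
        define G where "G y = (ennreal (real ?n / s ^ Suc ?n) * indicator {norm y<..} s) *
          (ennreal (norm y ^ ?n) * h y * indicator (- {0}) y)" for y :: "real^'n"
        have ind: "(\<lambda>y :: real^'n. indicator {norm y<..} s :: ennreal) = indicator (ball 0 s)"
          by (auto simp: fun_eq_iff indicator_def)
        have [measurable]: "(\<lambda>y :: real^'n. indicator {norm y<..} s :: ennreal) \<in> borel_measurable borel"
          unfolding ind by (intro borel_measurable_indicator) simp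
        have [measurable]: "G \<in> borel_measurable borel"
          unfolding G_def[abs_def] by measurable
        have "(\<integral>\<^sup>+y. G y \<partial>lborel) = ennreal (s ^ ?n) * (\<integral>\<^sup>+x. G (s *\<^sub>R x) \<partial>lborel)"
          using nn_integral_euclidean_scale[OF \<open>G \<in> borel_measurable borel\<close> True] by simp
        also have "\<dots> = (\<integral>\<^sup>+x. ennreal (s ^ ?n) * G (s *\<^sub>R x) \<partial>lborel)"
          by (rule nn_integral_cmult[symmetric]) measurable
        finally show ?thesis unfolding G_def .
      qed
      also have "\<dots> = (\<integral>\<^sup>+x. ?w s * (ennreal (norm x ^ ?n) * h (s *\<^sub>R x) * indicator ?B x) \<partial>lborel)"
      proof (rule nn_integral_cong)
        fix x :: "real^'n"
        have 1: "indicator {norm (s *\<^sub>R x)<..} s * indicator (- {0}) (s *\<^sub>R x) = (indicator ?B x :: ennreal)"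
          using True by (auto split: split_indicator)
        have "s ^ ?n * (real ?n / s ^ Suc ?n) * norm (s *\<^sub>R x) ^ ?n = real ?n * s ^ (?n - 1) * norm x ^ ?n"
          using True n by (cases ?n) (auto simp: power_mult_distrib field_simps)
        then have 2: "ennreal (s ^ ?n) * ennreal (real ?n / s ^ Suc ?n) * ennreal (norm (s *\<^sub>R x) ^ ?n) =
            ennreal (real ?n * s ^ (?n - 1)) * ennreal (norm x ^ ?n)"
          using True by (simp only: ennreal_mult'[symmetric] ennreal_mult''[symmetric] zero_le_power norm_ge_zero less_imp_le zero_le_divide_iff of_nat_0_le_iff simp_thms zero_le_mult_iff)
        have "ennreal (s ^ ?n) * ((ennreal (real ?n / s ^ Suc ?n) * indicator {norm (s *\<^sub>R x)<..} s) *
          (ennreal (norm (s *\<^sub>R x) ^ ?n) * h (s *\<^sub>R x) * indicator (- {0}) (s *\<^sub>R x))) =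
          (ennreal (s ^ ?n) * ennreal (real ?n / s ^ Suc ?n) * ennreal (norm (s *\<^sub>R x) ^ ?n)) * h (s *\<^sub>R x) *
          (indicator {norm (s *\<^sub>R x)<..} s * indicator (- {0}) (s *\<^sub>R x))"
          by (simp only: mult_ac)
        also have "\<dots> = ?w s * (ennreal (norm x ^ ?n) * h (s *\<^sub>R x) * indicator ?B x)"
          unfolding 1 2 using True by (simp add: mult_ac)
        finally show "ennreal (s ^ ?n) * ((ennreal (real ?n / s ^ Suc ?n) * indicator {norm (s *\<^sub>R x)<..} s) *
          (ennreal (norm (s *\<^sub>R x) ^ ?n) * h (s *\<^sub>R x) * indicator (- {0}) (s *\<^sub>R x))) =
          ?w s * (ennreal (norm x ^ ?n) * h (s *\<^sub>R x) * indicator ?B x)" .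
      qed
      finally show ?thesis by simp
    next
      case False
      then have "\<not> norm y < s" for y :: "real^'n"
        by (meson le_less_trans norm_ge_zero)
      then have "(indicator {norm y<..} s :: ennreal) = 0" for y :: "real^'n"
        by (simp add: indicator_def)
      with False show ?thesis by simp
    qed
  qed
  also have "\<dots> = (\<integral>\<^sup>+y. (\<integral>\<^sup>+s. (ennreal (real ?n / s ^ Suc ?n) * indicator {norm y<..} s) *
      (ennreal (norm y ^ ?n) * h y * indicator (- {0}) y) \<partial>lborel) \<partial>lborel)"
  proof (rule lborel_pair.Fubini')
    \<comment> \<open>The indicator depends on \<open>y\<close> and \<open>s\<close> jointly; as the
      indicator of the open set norm y < s it is measurable on the product.\<close>
    have eq: "(\<lambda>(y, s). (ennreal (real ?n / s ^ Suc ?n) * indicator {norm y<..} s) *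
      (ennreal (norm y ^ ?n) * h y * indicator (- {0}) y)) =
      (\<lambda>(y, s). (ennreal (real ?n / s ^ Suc ?n) * indicator {z :: (real^'n) \<times> real. norm (fst z) < snd z} (y, s)) *
      (ennreal (norm y ^ ?n) * h y * indicator (- {0}) y))"
      by (auto simp: fun_eq_iff indicator_def)
    have [measurable]: "{z :: (real^'n) \<times> real. norm (fst z) < snd z} \<in> sets (borel \<Otimes>\<^sub>M borel)"
      unfolding borel_prod by (intro borel_open open_Collect_less continuous_intros)
    show "(\<lambda>(y, s). (ennreal (real ?n / s ^ Suc ?n) * indicator {norm y<..} s) *
      (ennreal (norm y ^ ?n) * h y * indicator (- {0}) y)) \<in> borel_measurable (lborel \<Otimes>\<^sub>M lborel)"
      unfolding eq by measurable
  qed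
  also have "\<dots> = (\<integral>\<^sup>+y. h y * indicator (- {0}) y \<partial>lborel)"
  proof (rule nn_integral_cong)
    fix y :: "real^'n"
    show "(\<integral>\<^sup>+s. (ennreal (real ?n / s ^ Suc ?n) * indicator {norm y<..} s) *
      (ennreal (norm y ^ ?n) * h y * indicator (- {0}) y) \<partial>lborel) = h y * indicator (- {0}) y"
    proof (cases "y = 0")
      case False
      then have y: "norm y > 0" by simp
      have "ennreal (1 / norm y ^ ?n) * (ennreal (norm y ^ ?n) * h y) = ennreal (1 / norm y ^ ?n * norm y ^ ?n) * h y"
        by (subst ennreal_mult) (auto simp: mult.assoc)
      also have "\<dots> = h y" using y by simp
      finally show ?thesis using False
        by (subst nn_integral_multc) (auto simp del: power_Suc simp add: nn_integral_tail_power[OF y n])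
    qed simp
  qed
  also have "\<dots> = (\<integral>\<^sup>+y. h y \<partial>lborel)"
  proof (rule nn_integral_cong_AE)
    show "AE y in lborel. h y * indicator (- {0}) y = h y"
      using AE_lborel_singleton[of "0 :: real^'n"] by eventually_elim simp
  qed
  finally show ?thesis by simp
qed

text \<open>The factor n of the surface measure is placed here, so that
  \<open>punctured_ball\<close> can enter the product unscaled.\<close>

definition radial_measure :: "nat \<Rightarrow> real measure" where
  "radial_measure n = density lborel (\<lambda>r. ennreal (real n * r ^ (n - 1)) * indicator {0<..} r)"

lemma sets_radial_measure [simp, measurable_cong]: "sets (radial_measure n) = sets borel"
  by (simp add: radial_measure_def)

lemma sigma_finite_radial_measure: "sigma_finite_measure (radial_measure n)"
  unfolding radial_measure_def
  by (subst sigma_finite_measure.sigma_finite_iff_density_finite[OF sigma_finite_lborel]) (auto simp: ennreal_mult_less_top split: split_indicator)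

lemma AE_radial_measure:
  assumes "n > 0"
  shows "(AE r in radial_measure n. P r) \<longleftrightarrow> (AE r in lborel. 0 < r \<longrightarrow> P r)"
proof -
  have "0 < ennreal (real n * r ^ (n - 1)) * indicator {0<..} r \<longleftrightarrow> 0 < r" for r :: real
    using assms by (auto split: split_indicator simp: ennreal_zero_less_mult_iff)
  then show ?thesis
    unfolding radial_measure_def by (subst AE_density) auto
qed

lemma polar_measurable: "(\<lambda>(r, x). r *\<^sub>R sgn x) \<in> borel_measurable (radial_measure n \<Otimes>\<^sub>M (punctured_ball :: (real^'n) measure))"
proof -
  have [measurable]: "(sgn :: real^'n \<Rightarrow> real^'n) \<in> borel_measurable punctured_ball"
    by (rule measurable_punctured_ball) measurable
  show ?thesis by measurable
qed

text \<open>Stated as an identity of measures, so that integrability and Fubini for vector-valued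
  integrands follow from the product measure.\<close>

lemma lborel_polar:
  "(lborel :: (real^'n) measure) =
    distr (radial_measure CARD('n) \<Otimes>\<^sub>M punctured_ball) borel (\<lambda>(r, x). r *\<^sub>R sgn x)"
proof (rule measure_eqI)
  fix A :: "(real^'n) set" assume "A \<in> sets lborel"
  then have A[measurable]: "A \<in> sets borel" by simp
  interpret B: finite_measure "punctured_ball :: (real^'n) measure" by (rule finite_measure_punctured_ball)
  interpret R: sigma_finite_measure "radial_measure CARD('n)" by (rule sigma_finite_radial_measure)
  interpret P: pair_sigma_finite "radial_measure CARD('n)" "punctured_ball :: (real^'n) measure" ..
  note [measurable] = polar_measurable[where ?'n='n]
  have meas: "(\<lambda>(r, x). indicator A (r *\<^sub>R sgn x) :: ennreal) \<in> borel_measurable (radial_measure CARD('n) \<Otimes>\<^sub>M (punctured_ball :: (real^'n) measure))"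
  proof -
    have "(\<lambda>z. indicator A ((\<lambda>(r, x). r *\<^sub>R sgn x) z) :: ennreal) \<in> borel_measurable (radial_measure CARD('n) \<Otimes>\<^sub>M (punctured_ball :: (real^'n) measure))"
      by measurable
    then show ?thesis by (simp add: case_prod_beta)
  qed
  have "emeasure lborel A = (\<integral>\<^sup>+y. indicator A y \<partial>lborel)" by simp
  also have "\<dots> = (\<integral>\<^sup>+r. ennreal (real CARD('n) * r ^ (CARD('n) - 1)) * indicator {0<..} r *
      (\<integral>\<^sup>+x. indicator A (r *\<^sub>R sgn x) \<partial>(punctured_ball :: (real^'n) measure)) \<partial>lborel)"
    by (rule nn_integral_polar[symmetric]) measurable
  also have "\<dots> = (\<integral>\<^sup>+r. (\<integral>\<^sup>+x. indicator A (r *\<^sub>R sgn x) \<partial>(punctured_ball :: (real^'n) measure)) \<partial>radial_measure CARD('n))"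
    unfolding radial_measure_def
    by (subst nn_integral_density) (use B.borel_measurable_nn_integral[OF meas] in \<open>auto simp: measurable_lborel1 radial_measure_def\<close>)
  also have "\<dots> = (\<integral>\<^sup>+z. (\<lambda>(r, x). indicator A (r *\<^sub>R sgn x)) z \<partial>(radial_measure CARD('n) \<Otimes>\<^sub>M (punctured_ball :: (real^'n) measure)))"
    using B.nn_integral_fst[OF meas] by simp
  also have "\<dots> = (\<integral>\<^sup>+z. indicator A ((\<lambda>(r, x). r *\<^sub>R sgn x) z) \<partial>(radial_measure CARD('n) \<Otimes>\<^sub>M (punctured_ball :: (real^'n) measure)))"
    by (simp add: case_prod_beta)
  also have "\<dots> = (\<integral>\<^sup>+y. indicator A y \<partial>distr (radial_measure CARD('n) \<Otimes>\<^sub>M (punctured_ball :: (real^'n) measure)) borel (\<lambda>(r, x). r *\<^sub>R sgn x))"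
    by (subst nn_integral_distr) auto
  finally show "emeasure lborel A = emeasure (distr (radial_measure CARD('n) \<Otimes>\<^sub>M punctured_ball) borel (\<lambda>(r, x). r *\<^sub>R sgn x)) A"
    by simp
qed simp

lemma
  fixes h :: "real^'n \<Rightarrow> 'b::{banach, second_countable_topology}"
  assumes h: "integrable lborel h"
  shows integral_polar: "(LINT y|lborel. h y) =
      (LINT r|radial_measure CARD('n). (LINT x|(punctured_ball :: (real^'n) measure). h (r *\<^sub>R sgn x)))"
    and AE_integrable_polar:
      "AE r in radial_measure CARD('n). integrable (punctured_ball :: (real^'n) measure) (\<lambda>x. h (r *\<^sub>R sgn x))"
proof -
  interpret B: finite_measure "punctured_ball :: (real^'n) measure" by (rule finite_measure_punctured_ball)
  interpret R: sigma_finite_measure "radial_measure CARD('n)" by (rule sigma_finite_radial_measure)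
  interpret P: pair_sigma_finite "radial_measure CARD('n)" "punctured_ball :: (real^'n) measure" ..
  have hm: "h \<in> borel_measurable borel" using borel_measurable_integrable[OF h] by simp
  have int: "integrable (radial_measure CARD('n) \<Otimes>\<^sub>M (punctured_ball :: (real^'n) measure)) (\<lambda>(r, x). h (r *\<^sub>R sgn x))"
    using h unfolding lborel_polar integrable_distr_eq[OF polar_measurable hm] by (simp add: case_prod_unfold)
  show "(LINT y|lborel. h y) = (LINT r|radial_measure CARD('n). (LINT x|(punctured_ball :: (real^'n) measure). h (r *\<^sub>R sgn x)))"
    unfolding lborel_polar integral_distr[OF polar_measurable hm]
    using P.integral_fst'[OF int] by (simp add: case_prod_unfold)
  show "AE r in radial_measure CARD('n). integrable (punctured_ball :: (real^'n) measure) (\<lambda>x. h (r *\<^sub>R sgn x))"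
    using P.AE_integrable_fst'[OF int] by simp
qed

lemma scale_measure_of_nat: "scale_measure (of_nat c) M = density M (\<lambda>_. ennreal (real c))"
  by (rule measure_eqI) (auto simp: emeasure_density nn_integral_cmult_indicator ennreal_of_nat_eq_real_of_nat)

lemma L2_inner_sphere_measure:
  fixes g :: "real^'n \<Rightarrow> complex"
  assumes [measurable]: "g \<in> borel_measurable borel" "u \<in> borel_measurable borel"
  shows "L2_inner sphere_measure g u = of_nat CARD('n) * (LINT x|punctured_ball. g (sgn x) * cnj (u (sgn x)))"
proof -
  have [measurable]: "cnj \<in> borel_measurable borel"
    by (intro borel_measurable_continuous_onI continuous_intros)
  have [measurable]: "(\<lambda>x. g x * cnj (u x)) \<in> borel_measurable (restrict_space borel (sphere 0 1))"
    by (intro measurable_restrict_space1) measurable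
  note [measurable] = sgn_measurable_sphere
  show ?thesis
    unfolding L2_inner_def sphere_measure_def scale_measure_of_nat punctured_ball_def
    by (subst integral_density) (auto simp: integral_distr scaleR_conv_of_real)
qed

lemma integral_euclidean_scale:
  fixes f :: "'a::euclidean_space \<Rightarrow> 'b::{banach, second_countable_topology}"
  assumes [measurable]: "f \<in> borel_measurable borel" and c: "c > 0"
  shows "(LINT x|lborel. f x) = c ^ DIM('a) *\<^sub>R (LINT x|lborel. f (c *\<^sub>R x))"
proof -
  have "c \<noteq> 0" using c by simp
  note aff = lborel_affine[OF this, of 0]
  show ?thesis
    using c by (subst aff) (simp add: integral_density integral_distr)
qed

section \<open>The generating function of the Laguerre coefficients\<close>

lemma integrable_gauss:
  assumes "c > 0"
  shows "integrable lborel (\<lambda>x :: real^'n. exp (- c * (norm x)\<^sup>2))"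
proof -
  have eq: "exp (- c * (norm x)\<^sup>2) = (\<Prod>j\<in>UNIV. exp (- c * (x $ j)\<^sup>2))" for x :: "real^'n"
    by (simp add: norm_vec_sq sum_distrib_left exp_sum[symmetric] flip: sum_negf)
  show ?thesis
    unfolding eq using integrable_power_gaussian[OF assms, of 0]
    by (intro integrable_lborel_prod) simp
qed

text \<open>The m-th power of the inequality u/m <= exp (u/m).\<close>

lemma power_le_exp: "(u :: real) ^ m \<le> real m ^ m * exp u" if "u \<ge> 0"
proof (cases "m = 0")
  case True
  then show ?thesis using that by simp
next
  case False
  have "u / m \<le> exp (u / m)" using exp_ge_add_one_self[of "u / m"] by linarith
  then have "(u / m) ^ m \<le> exp (u / m) ^ m" using that by (intro power_mono) auto
  also have "exp (u / m) ^ m = exp u" using False by (simp flip: exp_of_nat_mult)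
  finally show ?thesis using False by (simp add: power_divide field_simps)
qed

lemma integrable_norm_power_gauss:
  assumes "c > 0"
  shows "integrable lborel (\<lambda>x :: real^'n. norm x ^ m * exp (- c * (norm x)\<^sup>2))"
proof (rule Bochner_Integration.integrable_bound)
  \<comment> \<open>Half of the Gaussian absorbs the power: apply \<open>power_le_exp\<close> to
    (c/2)|x|^2. The summand 1 covers norm x <= 1.\<close>
  define B where "B = 1 + real m ^ m * (2 / c) ^ m"
  show "integrable lborel (\<lambda>x :: real^'n. B * exp (- (c / 2) * (norm x)\<^sup>2))"
    using assms by (intro integrable_mult_right integrable_gauss) simp
  show "(\<lambda>x :: real^'n. norm x ^ m * exp (- c * (norm x)\<^sup>2)) \<in> borel_measurable lborel" by measurable
  show "AE x in lborel. norm (norm (x :: real^'n) ^ m * exp (- c * (norm x)\<^sup>2)) \<le> norm (B * exp (- (c / 2) * (norm x)\<^sup>2))"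
  proof (rule AE_I2)
    fix x :: "real^'n"
    define y where "y = norm x"
    have y: "y \<ge> 0" by (simp add: y_def)
    have 1: "y ^ m \<le> 1 + (y\<^sup>2) ^ m"
    proof (cases "y \<le> 1")
      case True
      then have "y ^ m \<le> 1" using y by (simp add: power_le_one)
      then show ?thesis by (simp add: add_increasing2)
    next
      case False
      then have "y ^ m \<le> (y\<^sup>2) ^ m" by (intro power_mono) (auto simp: power2_eq_square)
      then show ?thesis by simp
    qed
    have 2: "(y\<^sup>2) ^ m \<le> real m ^ m * (2 / c) ^ m * exp (c / 2 * y\<^sup>2)"
    proof -
      have "(c / 2 * y\<^sup>2) ^ m \<le> real m ^ m * exp (c / 2 * y\<^sup>2)"
        using assms by (intro power_le_exp) auto
      then have "(2 / c) ^ m * (c / 2 * y\<^sup>2) ^ m \<le> (2 / c) ^ m * (real m ^ m * exp (c / 2 * y\<^sup>2))"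
        using assms by (intro mult_left_mono) auto
      moreover have "(2 / c) ^ m * (c / 2 * y\<^sup>2) ^ m = (y\<^sup>2) ^ m"
        using assms by (simp flip: power_mult_distrib)
      ultimately show ?thesis by (simp add: mult_ac)
    qed
    have "1 \<le> exp (c / 2 * y\<^sup>2)" using assms by simp
    with 1 2 have 3: "y ^ m \<le> B * exp (c / 2 * y\<^sup>2)"
      unfolding B_def distrib_right by linarith
    have "y ^ m * exp (- c * y\<^sup>2) \<le> B * exp (c / 2 * y\<^sup>2) * exp (- c * y\<^sup>2)"
      using 3 by (intro mult_right_mono) auto
    also have "\<dots> = B * exp (- (c / 2) * y\<^sup>2)"
      by (simp add: mult.assoc flip: exp_add)
    finally have "y ^ m * exp (- c * y\<^sup>2) \<le> B * exp (- (c / 2) * y\<^sup>2)" .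
    moreover have "B \<ge> 0" using assms by (simp add: B_def add_nonneg_nonneg)
    ultimately show "norm (norm x ^ m * exp (- c * (norm x)\<^sup>2)) \<le> norm (B * exp (- (c / 2) * (norm x)\<^sup>2))"
      using y unfolding y_def by (simp add: abs_mult)
  qed
qed

lemma norm_integral_le_AE:
  fixes f :: "'a \<Rightarrow> 'b::{banach, second_countable_topology}"
  assumes "integrable M f" "integrable M g" "AE x in M. norm (f x) \<le> g x"
  shows "norm (integral\<^sup>L M f) \<le> integral\<^sup>L M g"
  using assms by (intro order.trans[OF integral_norm_bound] integral_mono_AE) auto

definition gauss_moment :: "'n::finite itself \<Rightarrow> nat \<Rightarrow> real" where
  "gauss_moment _ m = (LINT x|(lborel :: (real^'n) measure). norm x ^ m * exp (- (norm x)\<^sup>2 / 2))"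

lemma gauss_moment_nonneg: "gauss_moment TYPE('n::finite) m \<ge> 0"
  unfolding gauss_moment_def by (intro integral_nonneg_AE) auto

text \<open>Scaling by sqrt c: the Jacobian gives n factors and the homogeneous weight gives m,
  hence the exponent -(m+n)/2 that runs through all later estimates.\<close>

lemma integral_norm_power_gauss:
  assumes c: "c > 0"
  shows "(LINT x|lborel. norm (x :: real^'n) ^ m * exp (- c * (norm x)\<^sup>2 / 2)) =
    gauss_moment TYPE('n) m * c powr (- real (m + CARD('n)) / 2)"
proof -
  let ?f = "\<lambda>x :: real^'n. norm x ^ m * exp (- (norm x)\<^sup>2 / 2)"
  have "gauss_moment TYPE('n) m = sqrt c ^ CARD('n) * (LINT x|lborel. ?f (sqrt c *\<^sub>R x))"
    unfolding gauss_moment_def using c by (subst integral_euclidean_scale[of ?f "sqrt c"]) auto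
  also have "(LINT x|lborel. ?f (sqrt c *\<^sub>R x)) = (LINT x|lborel. sqrt c ^ m * (norm (x :: real^'n) ^ m * exp (- c * (norm x)\<^sup>2 / 2)))"
    using c by (intro Bochner_Integration.integral_cong refl) (simp add: power_mult_distrib)
  also have "\<dots> = sqrt c ^ m * (LINT x|lborel. norm (x :: real^'n) ^ m * exp (- c * (norm x)\<^sup>2 / 2))"
    by (rule integral_mult_right_zero)
  finally have "gauss_moment TYPE('n) m = sqrt c ^ (m + CARD('n)) * (LINT x|lborel. norm (x :: real^'n) ^ m * exp (- c * (norm x)\<^sup>2 / 2))"
    by (simp add: power_add mult_ac)
  moreover have "sqrt c ^ (m + CARD('n)) = c powr (real (m + CARD('n)) / 2)"
    using c by (simp add: powr_half_sqrt[symmetric] powr_powr flip: powr_realpow)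
  moreover have "c powr (- real (m + CARD('n)) / 2) = 1 / c powr (real (m + CARD('n)) / 2)"
    by (simp only: minus_divide_left[symmetric] powr_minus_divide)
  moreover have "c powr (real (m + CARD('n)) / 2) > 0" using c by simp
  ultimately show ?thesis
    by (simp only:) simp
qed

text \<open>The constant \<open>A\<close> and the order \<open>m\<close> are kept explicit because
  later bounds must be linear in \<open>A\<close> and their exponent depends on
  \<open>m\<close>.\<close>

definition gauss_dominated :: "real \<Rightarrow> nat \<Rightarrow> real \<Rightarrow> (real^'n \<Rightarrow> complex) \<Rightarrow> bool" where
  "gauss_dominated a m A q \<longleftrightarrow> A \<ge> 0 \<and> q \<in> borel_measurable borel \<and>
    (AE x in lborel. norm (q x) \<le> A * norm x ^ m * exp (- a * (norm x)\<^sup>2 / 2))"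

definition gauss_integral :: "(real^'n \<Rightarrow> complex) \<Rightarrow> complex \<Rightarrow> complex" where
  "gauss_integral q s = (LINT x|lborel. q x * exp (- s * of_real ((norm x)\<^sup>2 / 2)))"

lemma gauss_dominated_AE:
  assumes "gauss_dominated a m A q"
  shows "AE x in lborel. norm (q x * exp (- s * of_real ((norm x)\<^sup>2 / 2))) \<le>
    A * (norm x ^ m * exp (- (a + Re s) * (norm x)\<^sup>2 / 2))"
  using assms unfolding gauss_dominated_def
proof (elim conjE eventually_mono)
  fix x assume *: "norm (q x) \<le> A * norm x ^ m * exp (- a * (norm x)\<^sup>2 / 2)"
  have "norm (exp (- s * of_real ((norm x)\<^sup>2 / 2))) = exp (- Re s * (norm x)\<^sup>2 / 2)"
    by simp
  then have "norm (q x * exp (- s * of_real ((norm x)\<^sup>2 / 2))) \<le>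
      (A * norm x ^ m * exp (- a * (norm x)\<^sup>2 / 2)) * exp (- Re s * (norm x)\<^sup>2 / 2)"
    unfolding norm_mult using * by (simp add: mult_right_mono)
  also have "\<dots> = A * (norm x ^ m * exp (- a * (norm x)\<^sup>2 / 2 + - Re s * (norm x)\<^sup>2 / 2))"
    unfolding exp_add by (simp only: mult_ac)
  also have "- a * (norm x)\<^sup>2 / 2 + - Re s * (norm x)\<^sup>2 / 2 = - (a + Re s) * (norm x)\<^sup>2 / 2"
    by (simp add: algebra_simps add_divide_distrib)
  finally show "norm (q x * exp (- s * of_real ((norm x)\<^sup>2 / 2))) \<le>
    A * (norm x ^ m * exp (- (a + Re s) * (norm x)\<^sup>2 / 2))" .
qed

lemma gauss_exp_measurable [measurable]:
  "(\<lambda>x :: real^'n. exp (- s * complex_of_real ((norm x)\<^sup>2 / 2))) \<in> borel_measurable borel"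
  by (intro borel_measurable_continuous_onI continuous_intros) auto

lemma integrable_gauss_majorant:
  assumes "b > 0"
  shows "integrable lborel (\<lambda>x :: real^'n. A * (norm x ^ m * exp (- b * (norm x)\<^sup>2 / 2)))"
  using integrable_norm_power_gauss[of "b / 2" m] assms by (intro integrable_mult_right) simp

lemma gauss_dominated_integrable:
  assumes q: "gauss_dominated a m A q" and s: "Re s > - a"
  shows "integrable lborel (\<lambda>x. q x * exp (- s * of_real ((norm x)\<^sup>2 / 2)))"
proof (rule Bochner_Integration.integrable_bound)
  show "integrable lborel (\<lambda>x :: real^'a. A * (norm x ^ m * exp (- (a + Re s) * (norm x)\<^sup>2 / 2)))"
    using s by (intro integrable_gauss_majorant) simp
  have [measurable]: "q \<in> borel_measurable borel" using q by (simp add: gauss_dominated_def)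
  show "(\<lambda>x. q x * exp (- s * of_real ((norm x)\<^sup>2 / 2))) \<in> borel_measurable lborel" by measurable
  show "AE x in lborel. norm (q x * exp (- s * of_real ((norm x)\<^sup>2 / 2))) \<le> norm (A * (norm x ^ m * exp (- (a + Re s) * (norm x)\<^sup>2 / 2)))"
    using gauss_dominated_AE[OF q] by eventually_elim (auto intro: order_trans)
qed

lemma norm_gauss_integral_le:
  fixes q :: "real^'n \<Rightarrow> complex"
  assumes q: "gauss_dominated a m A q" and s: "Re s > - a"
  shows "norm (gauss_integral q s) \<le> A * gauss_moment TYPE('n) m * (a + Re s) powr (- real (m + CARD('n)) / 2)"
proof -
  have "norm (gauss_integral q s) \<le> (LINT x|lborel. A * (norm (x :: real^'n) ^ m * exp (- (a + Re s) * (norm x)\<^sup>2 / 2)))"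
    unfolding gauss_integral_def using s
    by (intro norm_integral_le_AE gauss_dominated_integrable[OF q] integrable_gauss_majorant gauss_dominated_AE[OF q]) auto
  also have "\<dots> = A * (LINT x|lborel. norm (x :: real^'n) ^ m * exp (- (a + Re s) * (norm x)\<^sup>2 / 2))"
    by (rule integral_mult_right_zero)
  also have "\<dots> = A * (gauss_moment TYPE('n) m * (a + Re s) powr (- real (m + CARD('n)) / 2))"
    using s by (subst integral_norm_power_gauss) auto
  finally show ?thesis by (simp add: mult.assoc)
qed

lemma gauss_dominated_mult_norm_sq:
  assumes "gauss_dominated a m A q"
  shows "gauss_dominated a (m + 2) (A / 2) (\<lambda>x. - of_real ((norm x)\<^sup>2 / 2) * q x)"
proof -
  have [measurable]: "q \<in> borel_measurable borel" using assms by (simp add: gauss_dominated_def)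
  have "AE x in lborel. norm (- of_real ((norm x)\<^sup>2 / 2) * q x) \<le> A / 2 * norm x ^ (m + 2) * exp (- a * (norm x)\<^sup>2 / 2)"
    using assms unfolding gauss_dominated_def
  proof (elim conjE eventually_mono)
    fix x assume "norm (q x) \<le> A * norm x ^ m * exp (- a * (norm x)\<^sup>2 / 2)"
    then have "(norm x)\<^sup>2 / 2 * norm (q x) \<le> (norm x)\<^sup>2 / 2 * (A * norm x ^ m * exp (- a * (norm x)\<^sup>2 / 2))"
      by (intro mult_left_mono) auto
    then show "norm (- of_real ((norm x)\<^sup>2 / 2) * q x) \<le> A / 2 * norm x ^ (m + 2) * exp (- a * (norm x)\<^sup>2 / 2)"
      by (simp add: norm_mult norm_divide norm_power power_add mult_ac power2_eq_square)
  qed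
  moreover have "(\<lambda>x. - of_real ((norm x)\<^sup>2 / 2) * q x) \<in> borel_measurable borel" by measurable
  ultimately show ?thesis using assms by (simp add: gauss_dominated_def)
qed

text \<open>Differentiation under the integral by a direct estimate: the second-order remainder of
  the exponential is |h|^2 times a fixed integrable majorant, so the difference quotient converges
  with error O(|h|).\<close>

lemma gauss_integral_has_field_derivative:
  fixes q :: "real^'n \<Rightarrow> complex"
  assumes q: "gauss_dominated a m A q" and s: "Re s > - a"
  shows "(gauss_integral q has_field_derivative gauss_integral (\<lambda>x. - of_real ((norm x)\<^sup>2 / 2) * q x) s) (at s)"
proof -
  \<comment> \<open>Half the distance of \<open>s\<close> to the line Re s = -a. It pays for the
    factor exp (|h| |x|^2/2) in the remainder and leaves the other half for convergence.\<close>
  define \<epsilon> where "\<epsilon> = (a + Re s) / 2"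
  have \<epsilon>: "\<epsilon> > 0" using s by (simp add: \<epsilon>_def)
  define q' where "q' = (\<lambda>x. - of_real ((norm x)\<^sup>2 / 2) * q x)"
  have q': "gauss_dominated a (m + 2) (A / 2) q'"
    unfolding q'_def by (rule gauss_dominated_mult_norm_sq[OF q])
  have q'': "gauss_dominated a (m + 2 + 2) (A / 2 / 2) (\<lambda>x. - of_real ((norm x)\<^sup>2 / 2) * q' x)"
    by (rule gauss_dominated_mult_norm_sq[OF q'])
  define B where "B = (LINT x|lborel. A / 2 / 2 * (norm (x :: real^'n) ^ (m + 2 + 2) * exp (- \<epsilon> * (norm x)\<^sup>2 / 2)))"
  have bound: "norm ((gauss_integral q (s + h) - gauss_integral q s) / h - gauss_integral q' s) \<le> B * norm h"
    if h: "h \<noteq> 0" "norm h < \<epsilon>" for h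
  proof -
    have sh: "Re (s + h) > - a"
      using h(2) abs_Re_le_cmod[of h] s by (simp add: \<epsilon>_def)
    let ?e = "\<lambda>s x. exp (- s * of_real ((norm (x :: real^'n))\<^sup>2 / 2))"
    note int = gauss_dominated_integrable[OF q sh] gauss_dominated_integrable[OF q s] gauss_dominated_integrable[OF q' s]
    have e1: "gauss_integral q (s + h) - gauss_integral q s - h * gauss_integral q' s =
      (LINT x|lborel. q x * ?e (s + h) x - q x * ?e s x - h * (q' x * ?e s x))"
      unfolding gauss_integral_def using int by simp
    have e2: "norm (LINT x|lborel. q x * ?e (s + h) x - q x * ?e s x - h * (q' x * ?e s x)) \<le>
      (LINT x|lborel. (norm h)\<^sup>2 * (A / 2 / 2 * (norm (x :: real^'n) ^ (m + 2 + 2) * exp (- \<epsilon> * (norm x)\<^sup>2 / 2))))"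
    proof (rule norm_integral_le_AE)
      show "integrable lborel (\<lambda>x. q x * ?e (s + h) x - q x * ?e s x - h * (q' x * ?e s x))"
        using int by (intro Bochner_Integration.integrable_diff integrable_mult_right) auto
      show "integrable lborel (\<lambda>x :: real^'n. (norm h)\<^sup>2 * (A / 2 / 2 * (norm x ^ (m + 2 + 2) * exp (- \<epsilon> * (norm x)\<^sup>2 / 2))))"
        by (intro integrable_mult_right[of "(norm h)\<^sup>2"] integrable_gauss_majorant \<epsilon>)
      show "AE x in lborel. norm (q x * ?e (s + h) x - q x * ?e s x - h * (q' x * ?e s x))
          \<le> (norm h)\<^sup>2 * (A / 2 / 2 * (norm x ^ (m + 2 + 2) * exp (- \<epsilon> * (norm x)\<^sup>2 / 2)))"
        using gauss_dominated_AE[OF q'', of "s - of_real \<epsilon>"]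
      proof eventually_elim
        case (elim x)
        define y where "y = (norm x)\<^sup>2 / 2"
        have y: "y \<ge> 0" by (simp add: y_def)
        define z where "z = - h * of_real y"
        have nz: "norm z = norm h * y" using y by (simp add: z_def norm_mult)
        have "?e (s + h) x = ?e s x * exp z"
          unfolding z_def y_def[symmetric] by (simp add: algebra_simps flip: exp_add)
        then have "q x * ?e (s + h) x - q x * ?e s x - h * (q' x * ?e s x) = q x * ?e s x * (exp z - (1 + z))"
          unfolding q'_def z_def y_def[symmetric] by (simp add: algebra_simps)
        also have "norm \<dots> \<le> norm (q x * ?e s x) * (exp (norm h * y) * (norm h * y)\<^sup>2)"
          using Taylor_exp_field[of z 1] unfolding norm_mult nz
          by (intro mult_left_mono) (simp_all add: nz power2_eq_square)
        also have "\<dots> \<le> norm (q x * ?e s x) * (exp (\<epsilon> * y) * (norm h * y)\<^sup>2)"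
          using h(2) y by (intro mult_left_mono mult_right_mono) (auto intro: mult_right_mono)
        also have "\<dots> = (norm h)\<^sup>2 * norm (- of_real y * (- of_real y * q x) * ?e (s - of_real \<epsilon>) x)"
        proof -
          have "norm (?e (s - of_real \<epsilon>) x) = norm (?e s x) * exp (\<epsilon> * y)"
            unfolding y_def[symmetric] by (simp add: algebra_simps flip: exp_add)
          then show ?thesis
            using y by (simp only: norm_mult norm_minus_cancel norm_of_real abs_of_nonneg power_mult_distrib power2_eq_square mult_ac)
        qed
        also have "\<dots> \<le> (norm h)\<^sup>2 * (A / 2 / 2 * (norm x ^ (m + 2 + 2) * exp (- (a + Re (s - of_real \<epsilon>)) * (norm x)\<^sup>2 / 2)))"
          using elim unfolding q'_def y_def by (intro mult_left_mono) auto
        also have "a + Re (s - of_real \<epsilon>) = \<epsilon>" by (simp add: \<epsilon>_def field_simps)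
        finally show ?case .
      qed
    qed
    have e3: "(LINT x|lborel. (norm h)\<^sup>2 * (A / 2 / 2 * (norm (x :: real^'n) ^ (m + 2 + 2) * exp (- \<epsilon> * (norm x)\<^sup>2 / 2)))) =
        (norm h)\<^sup>2 * B"
      unfolding B_def by (rule integral_mult_right_zero)
    have "norm (gauss_integral q (s + h) - gauss_integral q s - h * gauss_integral q' s) \<le> (norm h)\<^sup>2 * B"
      using e2 unfolding e1[symmetric] e3 .
    then have "norm (gauss_integral q (s + h) - gauss_integral q s - h * gauss_integral q' s) / norm h \<le> (norm h)\<^sup>2 * B / norm h"
      by (rule divide_right_mono) (rule norm_ge_zero)
    also have "(norm h)\<^sup>2 * B / norm h = B * norm h"
      using h(1) by (simp add: power2_eq_square)
    also have "norm (gauss_integral q (s + h) - gauss_integral q s - h * gauss_integral q' s) / norm h =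
        norm ((gauss_integral q (s + h) - gauss_integral q s) / h - gauss_integral q' s)"
    proof -
      have "(gauss_integral q (s + h) - gauss_integral q s - h * gauss_integral q' s) / h =
          (gauss_integral q (s + h) - gauss_integral q s) / h - gauss_integral q' s"
        using h(1) by (simp add: diff_divide_distrib)
      then show ?thesis by (simp only: norm_divide[symmetric])
    qed
    finally show ?thesis .
  qed
  have "((\<lambda>h. (gauss_integral q (s + h) - gauss_integral q s) / h - gauss_integral q' s) \<longlongrightarrow> 0) (at 0)"
  proof (rule Lim_null_comparison)
    have "eventually (\<lambda>h. h \<noteq> 0 \<and> norm h < \<epsilon>) (at 0)"
      unfolding eventually_at using \<epsilon> by (intro exI[of _ \<epsilon>]) auto
    then show "eventually (\<lambda>h. norm ((gauss_integral q (s + h) - gauss_integral q s) / h - gauss_integral q' s) \<le> B * norm h) (at 0)"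
      by eventually_elim (use bound in auto)
    show "((\<lambda>h. B * norm h) \<longlongrightarrow> 0) (at 0)"
      by (intro tendsto_mult_right_zero tendsto_norm_zero tendsto_ident_at)
  qed
  then show ?thesis
    unfolding DERIV_def q'_def[symmetric] by (subst (asm) LIM_zero_iff) simp
qed

lemma gauss_integral_holomorphic:
  assumes "gauss_dominated a m A q"
  shows "gauss_integral q holomorphic_on {s. Re s > - a}"
proof -
  have "\<exists>D. (gauss_integral q has_field_derivative D) (at s)" if "s \<in> {s. Re s > - a}" for s
    using gauss_integral_has_field_derivative[OF assms] that by blast
  then show ?thesis
    by (subst holomorphic_on_open[OF open_halfspace_Re_gt]) auto
qed

text \<open>The Laguerre polynomials of parameter c - 1 have generating function (1-w)^(-c) exp
  (-r^2 w/(1-w)). Multiplied by exp (-r^2/2), the exponents combine to -(r^2/2)(1+w)/(1-w), whence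
  the argument of \<open>gauss_integral\<close>.\<close>

definition laguerre_gen :: "real \<Rightarrow> (real^'n \<Rightarrow> complex) \<Rightarrow> complex \<Rightarrow> complex" where
  "laguerre_gen c q w = (1 - w) powr (- of_real c) * gauss_integral q ((1 + w) / (1 - w))"

text \<open>With v = w/(1-w) the argument (1+w)/(1-w) becomes 1 + 2v, and the factor 2 turns each
  derivative into multiplication by -|x|^2.\<close>

lemma higher_deriv_gauss_integral_shift:
  fixes q :: "real^'n \<Rightarrow> complex"
  assumes "gauss_dominated a m A q" "1 + 2 * Re v > - a"
  shows "(deriv ^^ i) (\<lambda>v. gauss_integral q (1 + 2 * v)) v =
    gauss_integral (\<lambda>x. (- of_real ((norm x)\<^sup>2)) ^ i * q x) (1 + 2 * v)"
  using assms
proof (induction i arbitrary: v q m A)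
  case (Suc i)
  let ?q' = "\<lambda>x. - of_real ((norm x)\<^sup>2) * q x"
  have cm: "gauss_integral ?q' s = 2 * gauss_integral (\<lambda>x. - of_real ((norm x)\<^sup>2 / 2) * q x) s" for s
    unfolding gauss_integral_def integral_mult_right_zero[symmetric] by (simp add: algebra_simps)
  have dom: "gauss_dominated a (m + 2) A ?q'"
  proof -
    have "gauss_dominated a (m + 2) (A / 2) (\<lambda>x. - of_real ((norm x)\<^sup>2 / 2) * q x)"
      by (rule gauss_dominated_mult_norm_sq[OF Suc.prems(1)])
    moreover have [measurable]: "q \<in> borel_measurable borel" using Suc.prems(1) by (simp add: gauss_dominated_def)
    have "?q' \<in> borel_measurable borel" by measurable
    ultimately show ?thesis
      by (auto simp: gauss_dominated_def norm_mult norm_divide elim!: eventually_mono)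
  qed
  have d: "deriv (\<lambda>v. gauss_integral q (1 + 2 * v)) u = gauss_integral ?q' (1 + 2 * u)"
    if "1 + 2 * Re u > - a" for u
  proof (rule DERIV_imp_deriv)
    have "((\<lambda>v. 1 + 2 * v) has_field_derivative 2) (at u)"
      by (auto intro!: derivative_eq_intros)
    from DERIV_chain2[OF gauss_integral_has_field_derivative[OF Suc.prems(1), of "1 + 2 * u"] this]
    show "((\<lambda>v. gauss_integral q (1 + 2 * v)) has_field_derivative gauss_integral ?q' (1 + 2 * u)) (at u)"
      using that unfolding cm by (simp add: mult.commute)
  qed
  have "open {u. 1 + 2 * Re u > - a}"
    by (intro open_Collect_less continuous_intros)
  then have "eventually (\<lambda>u. u \<in> {u. 1 + 2 * Re u > - a}) (nhds v)"
    using Suc.prems(2) by (intro eventually_nhds_in_open) auto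
  then have ev: "eventually (\<lambda>u. deriv (\<lambda>v. gauss_integral q (1 + 2 * v)) u = gauss_integral ?q' (1 + 2 * u)) (nhds v)"
    by eventually_elim (use d in auto)
  have "(deriv ^^ Suc i) (\<lambda>v. gauss_integral q (1 + 2 * v)) v = (deriv ^^ i) (deriv (\<lambda>v. gauss_integral q (1 + 2 * v))) v"
    by (simp add: funpow_swap1)
  also have "\<dots> = (deriv ^^ i) (\<lambda>v. gauss_integral ?q' (1 + 2 * v)) v"
    by (rule higher_deriv_cong_ev[OF ev refl])
  also have "\<dots> = gauss_integral (\<lambda>x. (- of_real ((norm x)\<^sup>2)) ^ i * ?q' x) (1 + 2 * v)"
    by (rule Suc.IH[OF dom Suc.prems(2)])
  also have "\<dots> = gauss_integral (\<lambda>x. (- of_real ((norm x)\<^sup>2)) ^ Suc i * q x) (1 + 2 * v)"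
    by (simp add: mult_ac)
  finally show ?case .
qed simp

text \<open>Expand the integral in powers of v = w/(1-w). The i-th power combines with (1-w)^(-c) to
  w^i (1-w)^(-c-i), whose coefficients are binomial; the results are the coefficients of the
  Laguerre polynomial of parameter c - 1.\<close>

lemma laguerre_gen_coeff:
  fixes q :: "real^'n \<Rightarrow> complex"
  assumes q: "gauss_dominated a m A q" and a: "a > 0"
  shows "(deriv ^^ l) (laguerre_gen c q) 0 / fact l =
    (\<Sum>i\<le>l. of_real ((-1) ^ i / fact i * (pochhammer (c + real i) (l - i) / fact (l - i))) *
      (LINT x|lborel. q x * of_real (norm x ^ (2 * i) * exp (- (norm x)\<^sup>2 / 2))))"
proof -
  let ?J = "\<lambda>v. gauss_integral q (1 + 2 * v)"
  define F where "F = fps_expansion ?J 0"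
  have "open {u. 1 + 2 * Re u > - a}"
    by (intro open_Collect_less continuous_intros)
  moreover have "?J holomorphic_on {u. 1 + 2 * Re u > - a}"
    by (rule holomorphic_on_compose_gen[OF _ gauss_integral_holomorphic[OF q], of "\<lambda>v. 1 + 2 * v", unfolded o_def])
       (auto intro!: holomorphic_intros)
  ultimately have "?J analytic_on {0}"
    using a unfolding analytic_at by (intro exI[of _ "{u. 1 + 2 * Re u > - a}"]) auto
  then have F: "?J has_fps_expansion F"
    unfolding F_def by (rule analytic_at_imp_has_fps_expansion_0)
  have Fn: "F $ i = of_real ((-1) ^ i / fact i) * (LINT x|lborel. q x * of_real (norm x ^ (2 * i) * exp (- (norm x)\<^sup>2 / 2)))" for i
  proof -
    have "F $ i = (deriv ^^ i) ?J 0 / fact i" by (rule fps_nth_fps_expansion[OF F])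
    also have "(deriv ^^ i) ?J 0 = gauss_integral (\<lambda>x. (- of_real ((norm x)\<^sup>2)) ^ i * q x) 1"
      using higher_deriv_gauss_integral_shift[OF q, of 0 i] a by simp
    also have "\<dots> = (LINT x|lborel. (-1) ^ i * (q x * of_real (norm x ^ (2 * i) * exp (- (norm x)\<^sup>2 / 2))))"
      unfolding gauss_integral_def
    proof (intro Bochner_Integration.integral_cong refl)
      fix x :: "real^'n"
      have "(- of_real ((norm x)\<^sup>2)) ^ i = (-1) ^ i * complex_of_real (norm x ^ (2 * i))"
        by (subst power_minus) (simp add: power_mult)
      moreover have "exp (- 1 * complex_of_real ((norm x)\<^sup>2 / 2)) = of_real (exp (- (norm x)\<^sup>2 / 2))"
        by (simp flip: exp_of_real)
      ultimately show "(- complex_of_real ((norm x)\<^sup>2)) ^ i * q x * exp (- 1 * complex_of_real ((norm x)\<^sup>2 / 2)) =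
        (-1) ^ i * (q x * of_real (norm x ^ (2 * i) * exp (- (norm x)\<^sup>2 / 2)))"
        by (simp only: of_real_mult mult_ac)
    qed
    also have "\<dots> = (-1) ^ i * (LINT x|lborel. q x * of_real (norm x ^ (2 * i) * exp (- (norm x)\<^sup>2 / 2)))"
      by (rule integral_mult_right_zero)
    finally show ?thesis by simp
  qed
  \<comment> \<open>The series of w/(1-w). Its constant term vanishes, so composing with it is
    legitimate and its i-th power starts at degree i.\<close>
  define V where "V = fps_X * inverse (1 - fps_X :: complex fps)"
  have V: "(\<lambda>w. w * inverse (1 - w)) has_fps_expansion V"
    unfolding V_def by (intro fps_expansion_intros) auto
  have V0: "V $ 0 = 0" by (simp add: V_def)
  let ?X = "- fps_X :: complex fps"
  define P where "P b = fps_compose (fps_binomial b) ?X" for b :: complex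
  have P: "(\<lambda>w. (1 - w) powr b) has_fps_expansion P b" for b
  proof -
    have "((\<lambda>x. (1 + x) powr b) \<circ> (\<lambda>w. - w)) has_fps_expansion P b"
      unfolding P_def by (intro has_fps_expansion_compose has_fps_expansion_binomial_complex has_fps_expansion_minus has_fps_expansion_fps_X) auto
    then show ?thesis by (simp add: o_def)
  qed
  have Pmult: "P (b + d) = P b * P d" for b d
    unfolding P_def fps_binomial_add_mult by (rule fps_compose_mult_distrib) simp
  have Pnat: "P (- of_nat i) = inverse (1 - fps_X) ^ i" for i
  proof -
    have "P 1 = 1 - fps_X"
      unfolding P_def fps_binomial_1 by (simp add: fps_compose_add_distrib)
    moreover have "P 1 * P (- 1) = 1"
      using Pmult[of 1 "-1"] by (simp add: P_def)
    ultimately have "P (-1) = inverse (1 - fps_X)"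
      by (metis fps_inverse_unique)
    moreover have "P (- of_nat i) = P (-1) ^ i"
    proof (induction i)
      case 0
      then show ?case by (simp add: P_def)
    next
      case (Suc i)
      then show ?case using Pmult[of "-1" "- of_nat i"] by simp
    qed
    ultimately show ?thesis by simp
  qed
  have PV: "(P (- of_real c) * V ^ i) $ l = of_real (pochhammer (c + real i) (l - i) / fact (l - i))" if "i \<le> l" for i l
  proof -
    have "P (- of_real c) * V ^ i = P (- of_real c + (- of_nat i)) * fps_X ^ i"
      unfolding V_def Pmult Pnat by (simp add: power_mult_distrib mult_ac)
    then have "(P (- of_real c) * V ^ i) $ l = P (- of_real c + (- of_nat i)) $ (l - i)"
      using that by (simp add: fps_X_power_mult_right_nth)
    also have "\<dots> = (-1) ^ (l - i) * ((- of_real c + (- of_nat i)) gchoose (l - i))"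
      by (simp add: P_def fps_compose_uminus')
    also have "\<dots> = pochhammer (of_real c + of_nat i) (l - i) / fact (l - i)"
      by (subst gbinomial_pochhammer) (simp add: add.commute flip: power_mult_distrib mult.assoc)
    also have "\<dots> = of_real (pochhammer (c + real i) (l - i) / fact (l - i))"
      by (simp flip: pochhammer_of_real)
    finally show ?thesis .
  qed
  have PV0: "(V ^ i) $ k = 0" if "k < i" for i k
    using startsby_zero_power_prefix[OF V0, of i] that by blast
  have fe: "(\<lambda>w. (1 - w) powr (- of_real c) * (?J \<circ> (\<lambda>w. w * inverse (1 - w))) w) has_fps_expansion
      P (- of_real c) * fps_compose F V"
    by (intro has_fps_expansion_mult P has_fps_expansion_compose F V V0)
  have ev: "eventually (\<lambda>w. (1 - w) powr (- of_real c) * (?J \<circ> (\<lambda>w. w * inverse (1 - w))) w = laguerre_gen c q w) (nhds 0)"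
  proof -
    have "eventually (\<lambda>w :: complex. w \<noteq> 1) (nhds 0)"
      by (rule t1_space_nhds) simp
    then show ?thesis
    proof eventually_elim
      case (elim w)
      then have "1 + 2 * (w * inverse (1 - w)) = (1 + w) / (1 - w)" by (simp add: field_simps)
      then show ?case by (simp add: laguerre_gen_def o_def)
    qed
  qed
  have "laguerre_gen c q has_fps_expansion P (- of_real c) * fps_compose F V"
    using fe unfolding has_fps_expansion_cong[OF ev refl] .
  then have "(deriv ^^ l) (laguerre_gen c q) 0 / fact l = (P (- of_real c) * fps_compose F V) $ l"
    by (rule fps_nth_fps_expansion[symmetric])
  also have "\<dots> = (\<Sum>k=0..l. P (- of_real c) $ k * (\<Sum>i=0..l - k. F $ i * (V ^ i) $ (l - k)))"
    by (simp add: fps_mult_nth fps_compose_nth)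
  \<comment> \<open>Powers of V beyond l - k contribute nothing, so the inner range is extended to
    \<open>l\<close>; only then can the two sums be interchanged.\<close>
  also have "\<dots> = (\<Sum>k=0..l. P (- of_real c) $ k * (\<Sum>i=0..l. F $ i * (V ^ i) $ (l - k)))"
    by (intro sum.cong refl arg_cong[of _ _ "(*) _"] sum.mono_neutral_left) (auto simp: PV0)
  also have "\<dots> = (\<Sum>i=0..l. F $ i * (P (- of_real c) * V ^ i) $ l)"
    unfolding fps_mult_nth sum_distrib_left by (subst sum.swap) (simp add: mult_ac)
  also have "\<dots> = (\<Sum>i\<le>l. of_real ((-1) ^ i / fact i * (pochhammer (c + real i) (l - i) / fact (l - i))) *
      (LINT x|lborel. q x * of_real (norm x ^ (2 * i) * exp (- (norm x)\<^sup>2 / 2))))"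
    unfolding atMost_atLeast0
  proof (rule sum.cong[OF refl])
    fix i assume "i \<in> {0..l}"
    then have "i \<le> l" by simp
    then show "F $ i * (P (- of_real c) * V ^ i) $ l =
      of_real ((-1) ^ i / fact i * (pochhammer (c + real i) (l - i) / fact (l - i))) *
        (LINT x|lborel. q x * of_real (norm x ^ (2 * i) * exp (- (norm x)\<^sup>2 / 2)))"
      unfolding Fn by (subst PV) (simp_all only: of_real_mult mult_ac)
  qed
  finally show ?thesis .
qed

section \<open>Spherical harmonics and finiteness\<close>

lemma spherical_harmonics_obtain:
  fixes Y :: "real^'n \<Rightarrow> complex"
  assumes "Y \<in> spherical_harmonics m"
  obtains p where "homogeneous_poly_fun m p" "laplacian p = (\<lambda>_. 0)" "Y = (\<lambda>x. if x \<in> sphere 0 1 then p x else 0)"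
  using assms unfolding spherical_harmonics_def by (auto simp: fun_eq_iff)

lemma spherical_harmonics_measurable:
  fixes Y :: "real^'n \<Rightarrow> complex"
  assumes "Y \<in> spherical_harmonics m"
  shows "Y \<in> borel_measurable borel"
proof -
  obtain p where p: "homogeneous_poly_fun m p" "Y = (\<lambda>x. if x \<in> sphere 0 1 then p x else 0)"
    using spherical_harmonics_obtain[OF assms] by metis
  have [measurable]: "p \<in> borel_measurable borel" by (rule homogeneous_measurable[OF p(1)])
  have [measurable]: "sphere (0 :: real^'n) 1 \<in> sets borel" by (intro borel_closed closed_sphere)
  show ?thesis unfolding p(2) by measurable
qed

lemma spherical_harmonics_bounded:
  fixes Y :: "real^'n \<Rightarrow> complex"
  assumes "Y \<in> spherical_harmonics m"
  obtains B where "\<And>x. norm (Y x) \<le> B"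
proof -
  obtain p where p: "homogeneous_poly_fun m p" "Y = (\<lambda>x. if x \<in> sphere 0 1 then p x else 0)"
    using spherical_harmonics_obtain[OF assms] by metis
  have "compact (p ` sphere 0 1)"
    by (intro compact_continuous_image continuous_on_subset[OF homogeneous_continuous[OF p(1)]]) auto
  then have "bounded (p ` sphere 0 1)"
    by (rule compact_imp_bounded)
  then obtain B where B: "\<And>x. x \<in> sphere 0 1 \<Longrightarrow> norm (p x) \<le> B"
    unfolding bounded_iff by blast
  have "norm (Y x) \<le> max B 0" for x
    unfolding p(2) using B[of x] by auto
  then show ?thesis using that by blast
qed

lemma sum_fun_apply: "(\<Sum>i\<in>I. f i) x = (\<Sum>i\<in>I. f i x)" for f :: "'i \<Rightarrow> 'a \<Rightarrow> complex"
  by (induction I rule: infinite_finite_induct) auto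

text \<open>Orthonormality gives linear independence, and \<open>d\<close> independent elements of a
  d-dimensional space span it. Finite dimension has to be established first, for otherwise the
  number \<open>cfun.dim\<close> would carry no such information.\<close>

lemma spherical_harmonics_orthonormal_spanning:
  fixes Y :: "nat \<Rightarrow> real^'n \<Rightarrow> complex" and d m :: nat
  assumes dim: "d = cfun.dim (spherical_harmonics m :: (real^'n \<Rightarrow> complex) set)"
    and Y: "\<And>j. j \<in> {1..d} \<Longrightarrow> Y j \<in> spherical_harmonics m"
    and orth: "\<And>i j. i \<in> {1..d} \<Longrightarrow> j \<in> {1..d} \<Longrightarrow>
      L2_inner sphere_measure (Y i) (Y j) = (if i = j then 1 else 0)"
    and v: "v \<in> spherical_harmonics m"
  shows "\<exists>c. v = (\<lambda>x. \<Sum>j=1..d. c j * Y j x)"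
proof -
  let ?SH = "spherical_harmonics m :: (real^'n \<Rightarrow> complex) set"
  \<comment> \<open>A finite spanning set for all restrictions of homogeneous polynomials to the
    sphere; it forces the basis \<open>B\<close> to be finite.\<close>
  let ?T = "(\<lambda>\<alpha> x. if x \<in> sphere 0 1 then monom_fun \<alpha> x else 0) ` {\<alpha> :: 'n \<Rightarrow> nat. sum \<alpha> UNIV = m}"
  have "?SH \<subseteq> cfun.span ?T"
  proof
    fix w :: "real^'n \<Rightarrow> complex" assume "w \<in> ?SH"
    then obtain p where p: "homogeneous_poly_fun m p" "laplacian p = (\<lambda>_. 0)"
      "w = (\<lambda>x. if x \<in> sphere 0 1 then p x else 0)"
      by (rule spherical_harmonics_obtain)
    from p(1) have "(\<lambda>x. if x \<in> sphere 0 1 then p x else 0) \<in> cfun.span ?T"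
    proof (induction rule: homogeneous_induct)
      case (monom \<alpha>)
      then show ?case by (intro cfun.span_base) auto
    next
      case zero
      show ?case using cfun.span_zero[of ?T] by (simp add: zero_fun_def)
    next
      case (add p q)
      have "(\<lambda>x. if x \<in> sphere 0 1 then p x + q x else 0) =
        (\<lambda>x. if x \<in> sphere 0 1 then p x else 0) + (\<lambda>x. if x \<in> sphere 0 1 then q x else 0)"
        by auto
      then show ?case using add by (simp only: cfun.span_add)
    next
      case (cmult c p)
      have "(\<lambda>x. if x \<in> sphere 0 1 then c * p x else 0) =
        (\<lambda>x. c * (if x \<in> sphere 0 1 then p x else 0))"
        by auto
      then show ?case using cfun.span_scale[OF cmult(2), of c] by (simp only:)
    qed
    then show "w \<in> cfun.span ?T" unfolding p(3) .
  qed
  moreover have "finite ?T" by (intro finite_imageI finite_multiindices)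
  moreover obtain B where B: "B \<subseteq> ?SH" "cfun.independent B" "?SH \<subseteq> cfun.span B" "card B = d"
    using cfun.basis_exists[of ?SH] dim by metis
  ultimately have finB: "finite B"
    using cfun.independent_span_bound[of ?T B] by blast
  let ?S = "Y ` {1..d}"
  have inj: "inj_on Y {1..d}"
  proof (rule inj_onI)
    fix i j assume "i \<in> {1..d}" "j \<in> {1..d}" "Y i = Y j"
    then have "(if i = j then 1 else 0) = (1 :: complex)" using orth[of i j] orth[of j j] by simp
    then show "i = j" by (auto split: if_splits)
  qed
  have int: "integrable punctured_ball (\<lambda>x. Y i (sgn x) * cnj (Y j (sgn x)))"
    if ij: "i \<in> {1..d}" "j \<in> {1..d}" for i j
  proof -
    obtain Bi where Bi: "\<And>x. norm (Y i x) \<le> Bi" using spherical_harmonics_bounded[OF Y[OF ij(1)]] by metis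
    obtain Bj where Bj: "\<And>x. norm (Y j x) \<le> Bj" using spherical_harmonics_bounded[OF Y[OF ij(2)]] by metis
    have B0: "0 \<le> Bi" using order_trans[OF norm_ge_zero Bi] .
    have [measurable]: "Y i \<in> borel_measurable borel" "Y j \<in> borel_measurable borel" "cnj \<in> borel_measurable borel"
      using Y ij by (auto intro: spherical_harmonics_measurable borel_measurable_continuous_onI continuous_intros)
    show ?thesis
    proof (rule finite_measure.integrable_const_bound[OF finite_measure_punctured_ball, where B="Bi * Bj"])
      show "AE x in punctured_ball. norm (Y i (sgn x) * cnj (Y j (sgn x))) \<le> Bi * Bj"
        using Bi Bj B0 by (intro AE_I2) (auto simp: norm_mult intro!: mult_mono)
    qed (intro measurable_punctured_ball, measurable)
  qed
  have ind: "cfun.independent ?S"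
  proof (rule cfun.independent_if_scalars_zero)
    fix u :: "(real^'n \<Rightarrow> complex) \<Rightarrow> complex" and w
    assume sum0: "(\<Sum>w\<in>?S. (\<lambda>x. u w * w x)) = 0" and w: "w \<in> ?S"
    obtain i where i: "i \<in> {1..d}" "w = Y i" using w by auto
    have s: "(\<Sum>j\<in>{1..d}. u (Y j) * Y j x) = 0" for x
      using fun_cong[OF sum0, of x] unfolding sum_fun_apply sum.reindex[OF inj] by (simp only: o_def zero_fun_def)
    have meas: "Y j \<in> borel_measurable borel" if "j \<in> {1..d}" for j
      using Y that by (auto intro: spherical_harmonics_measurable)
    have "0 = of_nat CARD('n) * (LINT x|punctured_ball. (\<Sum>j\<in>{1..d}. u (Y j) * Y j (sgn x)) * cnj (Y i (sgn (x :: real^'n))))"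
      by (simp only: s mult_zero_left Bochner_Integration.integral_zero mult_zero_right)
    also have "\<dots> = of_nat CARD('n) * (LINT x|punctured_ball. (\<Sum>j\<in>{1..d}. u (Y j) * (Y j (sgn x) * cnj (Y i (sgn (x :: real^'n))))))"
      by (simp add: sum_distrib_right mult.assoc)
    also have "\<dots> = (\<Sum>j\<in>{1..d}. u (Y j) * L2_inner sphere_measure (Y j) (Y i))"
      using i by (subst Bochner_Integration.integral_sum)
        (auto simp: int L2_inner_sphere_measure[OF meas meas] sum_distrib_left mult_ac intro!: sum.cong integrable_mult_right)
    also have "\<dots> = (\<Sum>j\<in>{1..d}. if j = i then u (Y j) else 0)"
      using i by (intro sum.cong refl) (auto simp: orth)
    also have "\<dots> = u w" using i by simp
    finally show "u w = 0" by simp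
  qed auto
  have vS: "v \<in> cfun.span ?S"
  \<comment> \<open>A missing \<open>v\<close> would give d + 1 independent elements in the span of
    the d-element set \<open>B\<close>.\<close>
  proof (rule ccontr)
    assume n: "v \<notin> cfun.span ?S"
    have vn: "v \<notin> ?S" using n cfun.span_base[of v ?S] by argo
    have "cfun.independent (insert v ?S)"
      unfolding cfun.independent_insert using n ind vn by simp
    moreover have "insert v ?S \<subseteq> cfun.span B"
      using B(3) v Y by auto
    ultimately have "card (insert v ?S) \<le> card B"
      by (rule conjunct2[OF cfun.independent_span_bound[OF finB]])
    moreover have "card (insert v ?S) = Suc d"
      using vn card_image[OF inj] by simp
    ultimately show False using B(4) by simp
  qed
  then obtain u where "v = (\<Sum>w\<in>?S. (\<lambda>x. u w * w x))"
    using cfun.span_finite[of ?S] by auto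
  then have "v = (\<lambda>x. \<Sum>j=1..d. u (Y j) * Y j x)"
    by (simp only: fun_eq_iff sum_fun_apply sum.reindex[OF inj] o_def simp_thms)
  then show ?thesis by (intro exI[of _ "\<lambda>j. u (Y j)"])
qed

text \<open>On almost every sphere of radius r the integral is a combination of the coefficients of
  degree \<open>m\<close>, times a factor depending on r only, because \<open>p\<close> restricted
  to the sphere lies in the span of the Y m j. For large \<open>m\<close> these coefficients vanish
  almost everywhere.\<close>

lemma On_finite_orthogonal:
  fixes f :: "real^'n \<Rightarrow> complex"
  assumes basis: "spherical_harmonic_basis d Y" and fin: "On_finite d Y f"
    and f: "integrable lborel f"
  shows "\<exists>M. \<forall>m>M. \<forall>p \<phi>. homogeneous_poly_fun m p \<longrightarrow> laplacian p = (\<lambda>_. 0) \<longrightarrow>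
    integrable lborel (\<lambda>x. f x * (\<phi> (norm x) * cnj (p x))) \<longrightarrow>
    (LINT x|lborel. f x * (\<phi> (norm x) * cnj (p x))) = 0"
proof -
  let ?bad = "{(m, j) \<in> index_pairs d. \<not> (AE r in lborel. 0 < r \<longrightarrow> spherical_coeff Y f m j r = 0)}"
  have finb: "finite ?bad" using fin by (simp add: On_finite_def)
  \<comment> \<open>The largest degree with a nonvanishing coefficient; the inserted 0 covers the
    case that there is none.\<close>
  define M where "M = Max (insert 0 (fst ` ?bad))"
  have M: "AE r in lborel. 0 < r \<longrightarrow> spherical_coeff Y f m j r = 0" if "m > M" "j \<in> {1..d m}" for m j
  proof (rule ccontr)
    assume "\<not> ?thesis"
    then have "(m, j) \<in> ?bad" using that by (simp add: index_pairs_def)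
    then have "m \<le> M" unfolding M_def using finb by (intro Max_ge) force+
    then show False using that by simp
  qed
  have "(LINT x|lborel. f x * (\<phi> (norm x) * cnj (p x))) = 0"
    if m: "m > M" and p: "homogeneous_poly_fun m p" "laplacian p = (\<lambda>_. 0)"
      and int: "integrable lborel (\<lambda>x. f x * (\<phi> (norm x) * cnj (p x)))" for m p \<phi>
  proof -
    have YSH: "Y m j \<in> spherical_harmonics m" if "j \<in> {1..d m}" for j
      using basis that by (auto simp: spherical_harmonic_basis_def index_pairs_def)
    have orth: "L2_inner sphere_measure (Y m i) (Y m j) = (if i = j then 1 else 0)"
      if ij: "i \<in> {1..d m}" "j \<in> {1..d m}" for i j
    proof -
      have b: "\<forall>(m, j)\<in>index_pairs d. \<forall>(m', j')\<in>index_pairs d.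
        L2_inner sphere_measure (Y m j) (Y m' j') = (if (m, j) = (m', j') then 1 else 0)"
        using basis by (simp add: spherical_harmonic_basis_def)
      have "(m, i) \<in> index_pairs d" "(m, j) \<in> index_pairs d"
        using ij by (auto simp: index_pairs_def)
      from bspec[OF b this(1), simplified] this(2) show ?thesis by auto
    qed
    have "(\<lambda>x. if x \<in> sphere 0 1 then p x else 0) \<in> spherical_harmonics m"
      unfolding spherical_harmonics_def using p by auto
    from spherical_harmonics_orthonormal_spanning[OF _ YSH orth this]
    obtain c where c: "(\<lambda>x. if x \<in> sphere 0 1 then p x else 0) = (\<lambda>x. \<Sum>j=1..d m. c j * Y m j x)"
      using basis by (auto simp: spherical_harmonic_basis_def)
    have pc: "p x = (\<Sum>j=1..d m. c j * Y m j x)" if "norm x = 1" for x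
      using fun_cong[OF c, of x] that by simp
    have fm [measurable]: "f \<in> borel_measurable borel" using borel_measurable_integrable[OF f] by simp
    \<comment> \<open>Each j has its own null set of radii; there are finitely many j, so one null
      set serves them all.\<close>
    have 1: "AE r in radial_measure CARD('n). \<forall>j\<in>{1..d m}. spherical_coeff Y f m j r = 0"
      using M[OF m] by (subst AE_ball_countable) (auto simp: AE_radial_measure)
    have 2: "AE r in radial_measure CARD('n). 0 < r"
      by (simp add: AE_radial_measure)
    note 3 = AE_integrable_polar[OF f]
    have "AE r in radial_measure CARD('n).
      (LINT x|(punctured_ball :: (real^'n) measure). f (r *\<^sub>R sgn x) * (\<phi> (norm (r *\<^sub>R sgn x)) * cnj (p (r *\<^sub>R sgn x)))) = 0"
      using 1 2 3
    proof eventually_elim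
      case (elim r)
      have int_j: "integrable punctured_ball (\<lambda>x. f (r *\<^sub>R sgn x) * cnj (Y m j (sgn x)))"
        if j: "j \<in> {1..d m}" for j
      proof -
        obtain B where B: "\<And>x. norm (Y m j x) \<le> B"
          using spherical_harmonics_bounded[OF YSH[OF j]] by metis
        have [measurable]: "Y m j \<in> borel_measurable borel" "cnj \<in> borel_measurable borel"
          using spherical_harmonics_measurable[OF YSH[OF j]]
          by (auto intro: borel_measurable_continuous_onI continuous_intros)
        show ?thesis
        proof (rule Bochner_Integration.integrable_bound)
          show "integrable punctured_ball (\<lambda>x. of_real B * f (r *\<^sub>R sgn x))"
            by (intro integrable_mult_right elim)
          show "(\<lambda>x. f (r *\<^sub>R sgn x) * cnj (Y m j (sgn x))) \<in> borel_measurable punctured_ball"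
            by (intro measurable_punctured_ball) measurable
          show "AE x in punctured_ball. norm (f (r *\<^sub>R sgn x) * cnj (Y m j (sgn x))) \<le> norm (of_real B * f (r *\<^sub>R sgn x))"
            using B order_trans[OF B abs_ge_self] by (intro AE_I2) (auto simp: norm_mult mult.commute intro!: mult_right_mono)
        qed
      qed
      have j0: "(LINT x|punctured_ball. f (r *\<^sub>R sgn x) * cnj (Y m j (sgn x))) = 0" if j: "j \<in> {1..d m}" for j
      proof -
        have "(\<lambda>\<omega>. f (r *\<^sub>R \<omega>)) \<in> borel_measurable borel" by measurable
        then have "spherical_coeff Y f m j r = of_nat CARD('n) * (LINT x|punctured_ball. f (r *\<^sub>R sgn x) * cnj (Y m j (sgn x)))"
          unfolding spherical_coeff_def
          by (rule L2_inner_sphere_measure[OF _ spherical_harmonics_measurable[OF YSH[OF j]]])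
        then show ?thesis using elim(1) j by simp
      qed
      have "(LINT x|(punctured_ball :: (real^'n) measure). f (r *\<^sub>R sgn x) * (\<phi> (norm (r *\<^sub>R sgn x)) * cnj (p (r *\<^sub>R sgn x)))) =
        (LINT x|punctured_ball. (\<Sum>j=1..d m. (\<phi> r * of_real r ^ m * cnj (c j)) * (f (r *\<^sub>R sgn x) * cnj (Y m j (sgn x)))))"
      proof (intro Bochner_Integration.integral_cong refl)
        fix x :: "real^'n" assume "x \<in> space punctured_ball"
        then have x: "norm (sgn x) = 1" by (auto simp: space_punctured_ball norm_sgn)
        show "f (r *\<^sub>R sgn x) * (\<phi> (norm (r *\<^sub>R sgn x)) * cnj (p (r *\<^sub>R sgn x))) =
          (\<Sum>j=1..d m. (\<phi> r * of_real r ^ m * cnj (c j)) * (f (r *\<^sub>R sgn x) * cnj (Y m j (sgn x))))"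
          unfolding homogeneous_scaleR[OF p(1)] pc[OF x]
          using x elim(2) by (simp add: sum_distrib_left mult_ac)
      qed
      also have "\<dots> = (\<Sum>j=1..d m. (\<phi> r * of_real r ^ m * cnj (c j)) * (LINT x|punctured_ball. f (r *\<^sub>R sgn x) * cnj (Y m j (sgn x))))"
        by (subst Bochner_Integration.integral_sum) (auto intro!: integrable_mult_right int_j)
      also have "\<dots> = 0" by (simp add: j0)
      finally show ?case .
    qed
    then have "(LINT r|radial_measure CARD('n). (LINT x|(punctured_ball :: (real^'n) measure).
      f (r *\<^sub>R sgn x) * (\<phi> (norm (r *\<^sub>R sgn x)) * cnj (p (r *\<^sub>R sgn x))))) = 0"
      by (rule integral_eq_zero_AE)
    then show ?thesis using integral_polar[OF int] by simp
  qed
  then show ?thesis by blast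
qed

section \<open>The Hecke--Bochner identity\<close>

lemma fourier_measurable:
  fixes f :: "real^'n \<Rightarrow> complex"
  assumes [measurable]: "f \<in> borel_measurable borel"
  shows "fourier f \<in> borel_measurable borel"
proof -
  have [measurable]: "(\<lambda>(\<xi>, x). exp (- \<i> * complex_of_real (x \<bullet> \<xi>))) \<in> borel_measurable (borel \<Otimes>\<^sub>M (lborel :: (real^'n) measure))"
  proof -
    have "(\<lambda>z :: (real^'n) \<times> (real^'n). exp (- \<i> * complex_of_real (snd z \<bullet> fst z))) \<in> borel_measurable borel"
      by (intro borel_measurable_continuous_onI continuous_intros)
    then show ?thesis by (simp add: borel_prod[symmetric] case_prod_unfold cong: measurable_cong_sets)
  qed
  have "(\<lambda>\<xi>. LINT x|lborel. f x * exp (- \<i> * complex_of_real (x \<bullet> \<xi>))) \<in> borel_measurable borel"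
    by (rule lborel.borel_measurable_lebesgue_integral) measurable
  then show ?thesis unfolding fourier_def[abs_def] by measurable
qed

lemma multiplication_formula:
  fixes f g :: "real^'n \<Rightarrow> complex"
  assumes f: "integrable lborel f" and g: "integrable lborel g"
  shows "(LINT x|lborel. f x * fourier g x) = (LINT x|lborel. fourier f x * g x)"
proof -
  let ?c = "complex_of_real ((2 * pi) powr (- real CARD('n) / 2))"
  let ?e = "\<lambda>x \<xi> :: real^'n. exp (- \<i> * complex_of_real (x \<bullet> \<xi>))"
  have [measurable]: "f \<in> borel_measurable borel" "g \<in> borel_measurable borel"
    using f g by (auto dest: borel_measurable_integrable)
  have [measurable]: "(\<lambda>(x, \<xi>). ?e x \<xi>) \<in> borel_measurable ((lborel :: (real^'n) measure) \<Otimes>\<^sub>M (lborel :: (real^'n) measure))"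
  proof -
    have "(\<lambda>z :: (real^'n) \<times> (real^'n). ?e (fst z) (snd z)) \<in> borel_measurable borel"
      by (intro borel_measurable_continuous_onI continuous_intros)
    then show ?thesis by (simp add: lborel_prod case_prod_unfold cong: measurable_cong_sets)
  qed
  have int: "integrable (lborel \<Otimes>\<^sub>M lborel) (\<lambda>(x, \<xi>). f x * g \<xi> * ?e x \<xi>)"
  proof (rule lborel_pair.Fubini_integrable)
    show "(\<lambda>(x, \<xi>). f x * g \<xi> * ?e x \<xi>) \<in> borel_measurable (lborel \<Otimes>\<^sub>M lborel)" by measurable
    have "(LINT \<xi>|lborel. norm (f x * g \<xi> * ?e x \<xi>)) = norm (f x) * (LINT \<xi>|lborel. norm (g \<xi>))" for x
      by (simp add: norm_mult)
    then show "integrable lborel (\<lambda>x. LINT \<xi>|lborel. norm (case (x, \<xi>) of (x, \<xi>) \<Rightarrow> f x * g \<xi> * ?e x \<xi>))"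
      using f by simp
    have "integrable lborel (\<lambda>\<xi>. f x * g \<xi> * ?e x \<xi>)" for x
      by (rule Bochner_Integration.integrable_bound[OF integrable_mult_right[OF g, of "f x"]])
         (auto simp: norm_mult intro!: borel_measurable_times borel_measurable_continuous_onI continuous_intros)
    then show "AE x in lborel. integrable lborel (\<lambda>\<xi>. case (x, \<xi>) of (x, \<xi>) \<Rightarrow> f x * g \<xi> * ?e x \<xi>)"
      by simp
  qed
  have "(LINT x|lborel. f x * fourier g x) = (LINT x|lborel. (LINT \<xi>|lborel. ?c * (f x * g \<xi> * ?e x \<xi>)))"
  proof (rule Bochner_Integration.integral_cong[OF refl])
    fix x
    have "f x * fourier g x = (?c * f x) * (LINT \<xi>|lborel. g \<xi> * exp (- \<i> * complex_of_real (\<xi> \<bullet> x)))"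
      by (simp add: fourier_def)
    also have "\<dots> = (LINT \<xi>|lborel. (?c * f x) * (g \<xi> * exp (- \<i> * complex_of_real (\<xi> \<bullet> x))))"
      by (rule integral_mult_right_zero[symmetric])
    also have "\<dots> = (LINT \<xi>|lborel. ?c * (f x * g \<xi> * ?e x \<xi>))"
      by (simp only: mult.assoc inner_commute)
    finally show "f x * fourier g x = (LINT \<xi>|lborel. ?c * (f x * g \<xi> * ?e x \<xi>))" .
  qed
  also have "\<dots> = ?c * (LINT x|lborel. (LINT \<xi>|lborel. f x * g \<xi> * ?e x \<xi>))"
    by (simp only: integral_mult_right_zero)
  also have "(LINT x|lborel. (LINT \<xi>|lborel. f x * g \<xi> * ?e x \<xi>)) = (LINT \<xi>|lborel. (LINT x|lborel. f x * g \<xi> * ?e x \<xi>))"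
    by (rule lborel_pair.Fubini_integral[OF int, symmetric])
  also have "?c * \<dots> = (LINT \<xi>|lborel. ?c * (LINT x|lborel. f x * g \<xi> * ?e x \<xi>))"
    by (rule integral_mult_right_zero[symmetric])
  also have "\<dots> = (LINT \<xi>|lborel. fourier f \<xi> * g \<xi>)"
  proof (rule Bochner_Integration.integral_cong[OF refl])
    fix \<xi>
    have "(LINT x|lborel. f x * g \<xi> * ?e x \<xi>) = (LINT x|lborel. g \<xi> * (f x * ?e x \<xi>))"
      by (simp only: mult_ac)
    also have "\<dots> = g \<xi> * (LINT x|lborel. f x * ?e x \<xi>)"
      by (rule integral_mult_right_zero)
    finally show "?c * (LINT x|lborel. f x * g \<xi> * ?e x \<xi>) = fourier f \<xi> * g \<xi>"
      by (simp add: fourier_def)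
  qed
  finally show ?thesis .
qed

lemma homogeneous_norm_bound:
  assumes "homogeneous_poly_fun k (p :: real^'n \<Rightarrow> complex)"
  obtains A where "A \<ge> 0" "\<And>x. norm (p x) \<le> A * norm x ^ k"
proof -
  obtain C where C: "C > 0" "\<And>x. norm (p x) \<le> C * L2_norm lborel (transform_gauss k p) * norm x ^ k"
    using homogeneous_bound[where ?'n='n and k=k] assms by metis
  have "L2_norm lborel (transform_gauss k p) \<ge> 0"
    by (simp add: L2_norm_def)
  with C show ?thesis by (intro that[of "C * L2_norm lborel (transform_gauss k p)"]) auto
qed

lemma integrable_homogeneous_gauss:
  assumes p: "homogeneous_poly_fun k (p :: real^'n \<Rightarrow> complex)" and c: "c > 0"
  shows "integrable lborel (\<lambda>x. p x * of_real (exp (- c * (norm x)\<^sup>2)))"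
proof -
  obtain A where A: "A \<ge> 0" "\<And>x. norm (p x) \<le> A * norm x ^ k"
    using homogeneous_norm_bound[OF p] by blast
  have [measurable]: "p \<in> borel_measurable borel" by (rule homogeneous_measurable[OF p])
  show ?thesis
  proof (rule Bochner_Integration.integrable_bound)
    show "integrable lborel (\<lambda>x :: real^'n. A * (norm x ^ k * exp (- c * (norm x)\<^sup>2)))"
      by (intro integrable_mult_right integrable_norm_power_gauss c)
    show "(\<lambda>x. p x * of_real (exp (- c * (norm x)\<^sup>2))) \<in> borel_measurable lborel" by measurable
    show "AE x in lborel. norm (p x * of_real (exp (- c * (norm x)\<^sup>2))) \<le> norm (A * (norm x ^ k * exp (- c * (norm x)\<^sup>2)))"
      using A by (intro AE_I2) (auto simp: norm_mult abs_mult mult.assoc[symmetric] intro!: mult_right_mono)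
  qed
qed

text \<open>A harmonic \<open>p\<close> is fixed by the Hermite transform, so p exp (-|x|^2/2) is an
  eigenfunction of the Fourier transform. Rescaling by sqrt s gives the power s^(n/2) from the
  Jacobian and s^(m/2) twice from homogeneity, once on each side.\<close>

lemma Hecke_Bochner:
  fixes p :: "real^'n \<Rightarrow> complex"
  assumes p: "homogeneous_poly_fun m p" and harm: "laplacian p = (\<lambda>_. 0)" and s: "s > 0"
  shows "fourier (\<lambda>\<xi>. p \<xi> * of_real (exp (- (norm \<xi>)\<^sup>2 / (2 * s)))) x =
    (- \<i>) ^ m * of_real (s powr (m + CARD('n) / 2)) * (p x * of_real (exp (- s * (norm x)\<^sup>2 / 2)))"
proof -
  let ?c = "complex_of_real ((2 * pi) powr (- real CARD('n) / 2))"
  let ?g = "\<lambda>\<xi>. p \<xi> * of_real (exp (- (norm \<xi>)\<^sup>2 / (2 * s))) * exp (- \<i> * complex_of_real (\<xi> \<bullet> x))"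
  have tg: "transform_gauss m p = (\<lambda>x. p x * of_real (exp (- (norm x)\<^sup>2 / 2)))"
    by (simp add: transform_gauss_def[abs_def] hermite_transform_harmonic[OF harm])
  have [measurable]: "p \<in> borel_measurable borel" by (rule homogeneous_measurable[OF p])
  have "?g \<in> borel_measurable borel"
    by (intro borel_measurable_times borel_measurable_continuous_onI continuous_intros homogeneous_continuous[OF p])
       (use s in auto)
  then have "(LINT \<xi>|lborel. ?g \<xi>) = sqrt s ^ CARD('n) *\<^sub>R (LINT \<eta>|lborel. ?g (sqrt s *\<^sub>R \<eta>))"
    using s by (subst integral_euclidean_scale[of ?g "sqrt s"]) auto
  also have "(LINT \<eta>|lborel. ?g (sqrt s *\<^sub>R \<eta>)) =
      (LINT \<eta>|lborel. of_real (sqrt s ^ m) * (transform_gauss m p \<eta> * exp (- \<i> * complex_of_real (\<eta> \<bullet> (sqrt s *\<^sub>R x)))))"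
    using s by (intro Bochner_Integration.integral_cong refl)
      (simp add: tg homogeneous_scaleR[OF p] power_mult_distrib)
  also have "\<dots> = of_real (sqrt s ^ m) * (LINT \<eta>|lborel. transform_gauss m p \<eta> * exp (- \<i> * complex_of_real (\<eta> \<bullet> (sqrt s *\<^sub>R x))))"
    by (rule integral_mult_right_zero)
  finally have "fourier (\<lambda>\<xi>. p \<xi> * of_real (exp (- (norm \<xi>)\<^sup>2 / (2 * s)))) x =
      of_real (sqrt s ^ CARD('n)) * of_real (sqrt s ^ m) * fourier (transform_gauss m p) (sqrt s *\<^sub>R x)"
    unfolding fourier_def by (simp only: scaleR_conv_of_real mult_ac)
  also have "fourier (transform_gauss m p) (sqrt s *\<^sub>R x) =
      (- \<i>) ^ m * of_real (sqrt s ^ m) * (p x * of_real (exp (- s * (norm x)\<^sup>2 / 2)))"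
    unfolding fourier_transform_gauss[OF p] using s
    by (simp add: tg homogeneous_scaleR[OF p] power_mult_distrib)
  also have "of_real (sqrt s ^ CARD('n)) * of_real (sqrt s ^ m) * ((- \<i>) ^ m * of_real (sqrt s ^ m) * (p x * of_real (exp (- s * (norm x)\<^sup>2 / 2)))) =
     (- \<i>) ^ m * of_real (sqrt s ^ CARD('n) * (sqrt s ^ m * sqrt s ^ m)) * (p x * of_real (exp (- s * (norm x)\<^sup>2 / 2)))"
    by (simp only: of_real_mult mult_ac)
  also have "sqrt s ^ CARD('n) * (sqrt s ^ m * sqrt s ^ m) = s powr (m + CARD('n) / 2)"
  proof -
    have "sqrt s ^ CARD('n) = s powr (CARD('n) / 2)"
      using s by (simp add: powr_half_sqrt[symmetric] powr_powr flip: powr_realpow)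
    moreover have "sqrt s ^ m * sqrt s ^ m = s powr m"
      using s by (simp add: powr_realpow flip: power_mult_distrib)
    ultimately show ?thesis using s by (simp add: powr_add)
  qed
  finally show ?thesis .
qed

text \<open>Move the Fourier transform from the Gaussian to \<open>f\<close> by the multiplication
  formula. Real \<open>s\<close> is enough: the identity theorem extends the resulting symmetry
  later.\<close>

lemma gauss_integral_fourier:
  fixes f p :: "real^'n \<Rightarrow> complex"
  assumes f: "integrable lborel f"
    and p: "homogeneous_poly_fun m p" and harm: "laplacian p = (\<lambda>_. 0)" and s: "s > 0"
  shows "gauss_integral (\<lambda>x. f x * p x) (of_real s) =
    \<i> ^ m * of_real (s powr (- (m + CARD('n) / 2))) * gauss_integral (\<lambda>x. fourier f x * p x) (of_real (1 / s))"
proof -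
  let ?g = "\<lambda>\<xi>. p \<xi> * of_real (exp (- (norm \<xi>)\<^sup>2 / (2 * s)))"
  let ?K = "(- \<i>) ^ m * complex_of_real (s powr (m + CARD('n) / 2))"
  have g: "integrable lborel ?g"
    using integrable_homogeneous_gauss[OF p, of "1 / (2 * s)"] s by simp
  have "gauss_integral (\<lambda>x. fourier f x * p x) (of_real (1 / s)) = (LINT x|lborel. fourier f x * ?g x)"
    unfolding gauss_integral_def
  proof (rule Bochner_Integration.integral_cong[OF refl])
    fix x :: "real^'n"
    have "- complex_of_real (1 / s) * of_real ((norm x)\<^sup>2 / 2) = of_real (- (norm x)\<^sup>2 / (2 * s))"
      by simp
    then have "exp (- complex_of_real (1 / s) * of_real ((norm x)\<^sup>2 / 2)) = of_real (exp (- (norm x)\<^sup>2 / (2 * s)))"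
      by (simp only: exp_of_real)
    then show "fourier f x * p x * exp (- complex_of_real (1 / s) * of_real ((norm x)\<^sup>2 / 2)) = fourier f x * ?g x"
      by (simp only: mult.assoc)
  qed
  also have "\<dots> = (LINT x|lborel. f x * fourier ?g x)"
    by (rule multiplication_formula[OF f g, symmetric])
  also have "\<dots> = (LINT x|lborel. ?K * (f x * p x * exp (- of_real s * of_real ((norm x)\<^sup>2 / 2))))"
  proof (rule Bochner_Integration.integral_cong[OF refl])
    fix x :: "real^'n"
    have "- complex_of_real s * of_real ((norm x)\<^sup>2 / 2) = of_real (- s * (norm x)\<^sup>2 / 2)"
      by simp
    then have "exp (- complex_of_real s * of_real ((norm x)\<^sup>2 / 2)) = of_real (exp (- s * (norm x)\<^sup>2 / 2))"
      by (simp only: exp_of_real)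
    then show "f x * fourier ?g x = ?K * (f x * p x * exp (- of_real s * of_real ((norm x)\<^sup>2 / 2)))"
      unfolding Hecke_Bochner[OF p harm s] by (simp only: mult_ac)
  qed
  also have "\<dots> = ?K * gauss_integral (\<lambda>x. f x * p x) (of_real s)"
    unfolding gauss_integral_def by (rule integral_mult_right_zero)
  finally have eq: "gauss_integral (\<lambda>x. fourier f x * p x) (of_real (1 / s)) = ?K * gauss_integral (\<lambda>x. f x * p x) (of_real s)" .
  have "\<i> ^ m * of_real (s powr (- (m + CARD('n) / 2))) * ?K =
      (\<i> ^ m * (- \<i>) ^ m) * of_real (s powr (- (m + CARD('n) / 2)) * s powr (m + CARD('n) / 2))"
    by (simp only: of_real_mult mult_ac)
  also have "\<i> ^ m * (- \<i>) ^ m = 1" by (simp flip: power_mult_distrib)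
  also have "s powr (- (m + CARD('n) / 2)) * s powr (m + CARD('n) / 2) = 1"
    using s by (simp flip: powr_add)
  finally show ?thesis unfolding eq by (simp only: mult.assoc[symmetric]) simp
qed

text \<open>Replacing x by -x inverts s = (1+x)/(1-x), and the power of s from the transform changes
  (1-x)^(-c) into (1+x)^(-c).\<close>

lemma laguerre_gen_fourier:
  fixes f p :: "real^'n \<Rightarrow> complex"
  assumes f: "integrable lborel f"
    and p: "homogeneous_poly_fun m p" and harm: "laplacian p = (\<lambda>_. 0)" and x: "- 1 < x" "x < 1"
  shows "laguerre_gen (m + CARD('n) / 2) (\<lambda>x. f x * p x) (of_real x) =
    \<i> ^ m * laguerre_gen (m + CARD('n) / 2) (\<lambda>x. fourier f x * p x) (- of_real x)"
proof -
  let ?c = "m + CARD('n) / 2 :: real"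
  define s where "s = (1 + x) / (1 - x)"
  have s: "s > 0" using x by (simp add: s_def)
  have "(1 - complex_of_real x) powr (- of_real ?c) = of_real ((1 - x) powr (- ?c))"
    using x powr_of_real[of "1 - x" "- ?c"] by simp
  moreover have "(1 - (- complex_of_real x)) powr (- of_real ?c) = of_real ((1 + x) powr (- ?c))"
    using x powr_of_real[of "1 + x" "- ?c"] by simp
  moreover have "(1 + complex_of_real x) / (1 - of_real x) = of_real s"
    by (simp add: s_def)
  moreover have "(1 + (- complex_of_real x)) / (1 - (- of_real x)) = of_real (1 / s)"
    by (simp add: s_def)
  moreover have "(1 - x) powr (- ?c) * s powr (- ?c) = (1 + x) powr (- ?c)"
  proof -
    have "(1 - x) powr (- ?c) * s powr (- ?c) = ((1 - x) * s) powr (- ?c)"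
      by (rule powr_mult[symmetric])
    also have "(1 - x) * s = 1 + x" using x by (simp add: s_def)
    finally show ?thesis .
  qed
  then have "complex_of_real ((1 - x) powr (- ?c)) * of_real (s powr (- ?c)) = of_real ((1 + x) powr (- ?c))"
    by (simp only: of_real_mult[symmetric])
  ultimately show ?thesis
    unfolding laguerre_gen_def using gauss_integral_fourier[OF f p harm s]
    by (simp only: mult_ac)
qed

section \<open>Coefficient bounds on two overlapping discs\<close>

text \<open>In the application \<open>u\<close> is a zero of cos (2 pi t), near which |cos| stays
  above 4|t - u|. Splitting at \<open>u\<close> leaves two elementary integrals.\<close>

lemma has_integral_abs_powr:
  fixes u \<epsilon> p :: real
  assumes u: "0 \<le> u" "u \<le> 1" and \<epsilon>: "\<epsilon> > 0" and p: "p > 1"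
  shows "((\<lambda>t. (\<epsilon> + 4 * \<bar>t - u\<bar>) powr (- p)) has_integral
    ((\<epsilon> powr (1 - p) - (\<epsilon> + 4 * u) powr (1 - p)) + (\<epsilon> powr (1 - p) - (\<epsilon> + 4 * (1 - u)) powr (1 - p))) / (4 * (p - 1))) {0..1}"
proof -
  let ?c = "4 * (p - 1)"
  have c: "?c > 0" using p by simp
  have "((\<lambda>t. (\<epsilon> + 4 * (u - t)) powr (- p)) has_integral
      (\<epsilon> + 4 * (u - u)) powr (1 - p) / ?c - (\<epsilon> + 4 * (u - 0)) powr (1 - p) / ?c) {0..u}"
  proof (rule fundamental_theorem_of_calculus[OF u(1)])
    fix t assume t: "t \<in> {0..u}"
    then have pos: "\<epsilon> + 4 * (u - t) > 0" using \<epsilon> by auto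
    have "((\<lambda>t. (\<epsilon> + 4 * (u - t)) powr (1 - p) / ?c) has_real_derivative (\<epsilon> + 4 * (u - t)) powr (- p)) (at t within {0..u})"
    proof -
      have "((\<lambda>t. (\<epsilon> + 4 * (u - t)) powr (1 - p) / ?c) has_real_derivative
          (1 - p) * (\<epsilon> + 4 * (u - t)) powr (1 - p - 1) * (- 4) / ?c) (at t within {0..u})"
        using pos p by (auto intro!: derivative_eq_intros)
      moreover have "(1 - p) * X * (- 4) / ?c = X" for X using p by (simp add: field_simps)
      ultimately show ?thesis by simp
    qed
    then show "((\<lambda>t. (\<epsilon> + 4 * (u - t)) powr (1 - p) / ?c) has_vector_derivative (\<epsilon> + 4 * (u - t)) powr (- p)) (at t within {0..u})"
      by (simp add: has_real_derivative_iff_has_vector_derivative)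
  qed
  then have 1: "((\<lambda>t. (\<epsilon> + 4 * \<bar>t - u\<bar>) powr (- p)) has_integral
      (\<epsilon> powr (1 - p) - (\<epsilon> + 4 * u) powr (1 - p)) / ?c) {0..u}"
    by (subst has_integral_cong[where g="\<lambda>t. (\<epsilon> + 4 * (u - t)) powr (- p)"]) (auto simp: diff_divide_distrib)
  have "((\<lambda>t. (\<epsilon> + 4 * (t - u)) powr (- p)) has_integral
      - ((\<epsilon> + 4 * (1 - u)) powr (1 - p) / ?c) - - ((\<epsilon> + 4 * (u - u)) powr (1 - p) / ?c)) {u..1}"
  proof (rule fundamental_theorem_of_calculus[OF u(2)])
    fix t assume t: "t \<in> {u..1}"
    then have pos: "\<epsilon> + 4 * (t - u) > 0" using \<epsilon> by auto
    have "((\<lambda>t. - ((\<epsilon> + 4 * (t - u)) powr (1 - p) / ?c)) has_real_derivative (\<epsilon> + 4 * (t - u)) powr (- p)) (at t within {u..1})"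
    proof -
      have "((\<lambda>t. - ((\<epsilon> + 4 * (t - u)) powr (1 - p) / ?c)) has_real_derivative
          - ((1 - p) * (\<epsilon> + 4 * (t - u)) powr (1 - p - 1) * 4 / ?c)) (at t within {u..1})"
        using pos p by (auto intro!: derivative_eq_intros)
      moreover have "- ((1 - p) * X * 4 / ?c) = X" for X using p by (simp add: field_simps)
      ultimately show ?thesis by simp
    qed
    then show "((\<lambda>t. - ((\<epsilon> + 4 * (t - u)) powr (1 - p) / ?c)) has_vector_derivative (\<epsilon> + 4 * (t - u)) powr (- p)) (at t within {u..1})"
      by (simp add: has_real_derivative_iff_has_vector_derivative)
  qed
  then have 2: "((\<lambda>t. (\<epsilon> + 4 * \<bar>t - u\<bar>) powr (- p)) has_integral
      (\<epsilon> powr (1 - p) - (\<epsilon> + 4 * (1 - u)) powr (1 - p)) / ?c) {u..1}"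
    by (subst has_integral_cong[where g="\<lambda>t. (\<epsilon> + 4 * (t - u)) powr (- p)"]) (auto simp: diff_divide_distrib)
  show ?thesis
    using has_integral_combine[OF u 1 2] by (simp only: add_divide_distrib)
qed

text \<open>Concavity gives sin y >= 2y/pi on [0, pi/2]. Applied around the zeros t = 1/4 and t =
  3/4, the slope is (2/pi)(2 pi) = 4.\<close>

lemma abs_cos_lower_bound:
  assumes "0 \<le> t" "t \<le> 1"
  shows "4 * \<bar>t - 1/4\<bar> \<le> \<bar>cos (2 * pi * t)\<bar> \<or> 4 * \<bar>t - 3/4\<bar> \<le> \<bar>cos (2 * pi * t)\<bar>"
proof -
  have sin: "2 / pi * \<bar>x\<bar> \<le> \<bar>sin x\<bar>" if "\<bar>x\<bar> \<le> pi / 2" for x :: real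
  proof -
    have "2 / pi * y \<le> sin y" if "0 \<le> y" "y \<le> pi / 2" for y
    proof -
      have "concave_on {0..pi} sin"
        by (rule f''_le0_imp_concave[where f'=cos and f''="\<lambda>x. - sin x"])
           (auto intro!: derivative_eq_intros sin_ge_zero)
      from concave_onD[OF this, of "2 * y / pi" 0 "pi / 2"]
      show ?thesis using that pi_gt_zero by (simp add: field_simps)
    qed
    from this[of "\<bar>x\<bar>"] that show ?thesis
      by (cases "x \<ge> 0") (auto simp: abs_if split: if_splits)
  qed
  show ?thesis
  proof (cases "t \<le> 1/2")
    case True
    have "cos (2 * pi * t) = - sin (2 * pi * (t - 1/4))"
      by (simp add: algebra_simps sin_diff)
    moreover have "\<bar>2 * pi * (t - 1/4)\<bar> \<le> pi / 2"
      using True assms by (simp add: abs_mult abs_if field_simps)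
    ultimately have "2 / pi * \<bar>2 * pi * (t - 1/4)\<bar> \<le> \<bar>cos (2 * pi * t)\<bar>"
      using sin[of "2 * pi * (t - 1/4)"] by simp
    then show ?thesis by (simp add: abs_mult)
  next
    case False
    have "sin (pi * 3 / 2) = -1"
      using sin_3over2_pi by (simp add: mult.commute)
    moreover have "cos (pi * 3 / 2) = 0"
      using cos_3over2_pi by (simp add: mult.commute)
    ultimately have "cos (2 * pi * t) = sin (2 * pi * (t - 3/4))"
      by (simp add: algebra_simps sin_diff)
    moreover have "\<bar>2 * pi * (t - 3/4)\<bar> \<le> pi / 2"
      using False assms by (simp add: abs_mult abs_if field_simps)
    ultimately have "2 / pi * \<bar>2 * pi * (t - 3/4)\<bar> \<le> \<bar>cos (2 * pi * t)\<bar>"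
      using sin[of "2 * pi * (t - 3/4)"] by simp
    then show ?thesis by (simp add: abs_mult)
  qed
qed

text \<open>Averaging over the circle costs \<epsilon>^(1-p), while the supremum of the integrand
  has size \<epsilon>^(-p). The gained power decides the final exponent.\<close>

lemma integral_cos_powr_le:
  fixes \<epsilon> p :: real
  assumes \<epsilon>: "\<epsilon> > 0" and p: "p > 1"
  shows "integral {0..1} (\<lambda>t. (\<epsilon> + \<bar>cos (2 * pi * t)\<bar>) powr (- p)) \<le> \<epsilon> powr (1 - p) / (p - 1)"
proof -
  let ?h = "\<lambda>u t. (\<epsilon> + 4 * \<bar>t - u\<bar>) powr (- p)"
  have h: "?h u integrable_on {0..1} \<and> integral {0..1} (?h u) \<le> \<epsilon> powr (1 - p) / (2 * (p - 1))" if u: "0 \<le> u" "u \<le> 1" for u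
  proof -
    note hi = has_integral_abs_powr[OF u \<epsilon> p]
    have "((\<epsilon> powr (1 - p) - (\<epsilon> + 4 * u) powr (1 - p)) + (\<epsilon> powr (1 - p) - (\<epsilon> + 4 * (1 - u)) powr (1 - p))) / (4 * (p - 1))
      \<le> 2 * \<epsilon> powr (1 - p) / (4 * (p - 1))"
      using p powr_ge_zero[of "\<epsilon> + 4 * u" "1 - p"] powr_ge_zero[of "\<epsilon> + 4 * (1 - u)" "1 - p"]
      by (intro divide_right_mono) (linarith, simp)
    also have "2 * \<epsilon> powr (1 - p) / (4 * (p - 1)) = \<epsilon> powr (1 - p) / (2 * (p - 1))"
      using p by (simp add: divide_simps)
    finally show ?thesis
      unfolding integral_unique[OF hi] using has_integral_integrable[OF hi] by blast
  qed
  have "integral {0..1} (\<lambda>t. (\<epsilon> + \<bar>cos (2 * pi * t)\<bar>) powr (- p)) \<le> integral {0..1} (\<lambda>t. ?h (1/4) t + ?h (3/4) t)"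
  proof (rule integral_le)
    show "(\<lambda>t. (\<epsilon> + \<bar>cos (2 * pi * t)\<bar>) powr (- p)) integrable_on {0..1}"
      using \<epsilon> by (intro integrable_continuous_interval continuous_intros) (auto intro: add_pos_nonneg less_imp_neq[symmetric])
    show "(\<lambda>t. ?h (1/4) t + ?h (3/4) t) integrable_on {0..1}"
      using h[of "1/4"] h[of "3/4"] by (intro integrable_add) auto
    fix t :: real assume t: "t \<in> {0..1}"
    have "(\<epsilon> + \<bar>cos (2 * pi * t)\<bar>) powr (- p) \<le> ?h u t" if "4 * \<bar>t - u\<bar> \<le> \<bar>cos (2 * pi * t)\<bar>" for u
      using that \<epsilon> p by (intro powr_mono2') (auto intro: add_pos_nonneg)
    moreover have "?h u t \<ge> 0" for u by simp
    ultimately show "(\<epsilon> + \<bar>cos (2 * pi * t)\<bar>) powr (- p) \<le> ?h (1/4) t + ?h (3/4) t"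
      using abs_cos_lower_bound[of t] t by (smt (verit) atLeastAtMost_iff)
  qed
  also have "\<dots> = integral {0..1} (?h (1/4)) + integral {0..1} (?h (3/4))"
    using h[of "1/4"] h[of "3/4"] by (intro integral_add) auto
  also have "\<dots> \<le> \<epsilon> powr (1 - p) / (2 * (p - 1)) + \<epsilon> powr (1 - p) / (2 * (p - 1))"
    using h[of "1/4"] h[of "3/4"] by (intro add_mono) auto
  also have "\<dots> = \<epsilon> powr (1 - p) / (p - 1)"
  proof -
    have "x / (2 * c) + x / (2 * c) = x / c" for x c :: real
      by (cases "c = 0") (auto simp: field_simps)
    then show ?thesis .
  qed
  finally show ?thesis .
qed

text \<open>The power \<open>R\<^sup>2 - |w|\<^sup>2 - (R\<^sup>2 - 1) Re w\<close> of the point \<open>w\<close> with respect to the circle through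
  \<open>1\<close>, \<open>iR\<close> and \<open>-iR\<close>. This disc and its mirror image cover the disc \<open>|w| < R\<close>.\<close>

definition disc_power :: "real \<Rightarrow> complex \<Rightarrow> real" where
  "disc_power R w = R\<^sup>2 - (norm w)\<^sup>2 - (R\<^sup>2 - 1) * Re w"

definition disc_center :: "real \<Rightarrow> complex" where
  "disc_center R = of_real (- ((R\<^sup>2 - 1) / 2))"

definition disc_radius :: "real \<Rightarrow> real" where
  "disc_radius R = (R\<^sup>2 + 1) / 2"

lemma disc_power_eq: "disc_power R w = (disc_radius R)\<^sup>2 - (norm (w - disc_center R))\<^sup>2"
  unfolding disc_power_def disc_center_def disc_radius_def cmod_power2
  by (simp add: power2_eq_square field_simps)

lemma disc_radius_pos: "disc_radius R > 0"
  unfolding disc_radius_def by (simp add: add_nonneg_pos)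

lemma disc_power_pos_iff: "disc_power R w > 0 \<longleftrightarrow> w \<in> ball (disc_center R) (disc_radius R)"
proof -
  have "disc_power R w > 0 \<longleftrightarrow> (norm (w - disc_center R))\<^sup>2 < (disc_radius R)\<^sup>2"
    unfolding disc_power_eq by simp
  also have "\<dots> \<longleftrightarrow> norm (w - disc_center R) < disc_radius R"
    using disc_radius_pos[of R] power_strict_mono[of "norm (w - disc_center R)" "disc_radius R" 2]
      power_less_imp_less_base[of "norm (w - disc_center R)" 2 "disc_radius R"] by auto
  finally show ?thesis by (simp add: dist_norm norm_minus_commute)
qed

text \<open>Cauchy's inequality on a disc around \<open>w\<close> reaching half way to the boundary
  circle. On it \<open>disc_power\<close> shrinks at most by the factor 4, while its radius is at
  least \<open>disc_power R w\<close> over four times the radius of the big disc.\<close>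

lemma disc_power_deriv_bound:
  assumes hol: "g holomorphic_on {w. disc_power R w > 0}"
    and bd: "\<And>w. disc_power R w > 0 \<Longrightarrow> norm (g w) \<le> C * disc_power R w powr (- \<beta>)"
    and \<beta>: "\<beta> \<ge> 0" and C: "C \<ge> 0" and w: "disc_power R w > 0"
  shows "norm (deriv g w) \<le> C * 4 powr (\<beta> + 1) * disc_radius R * disc_power R w powr (- (\<beta> + 1))"
proof -
  \<comment> \<open>\<open>d\<close> is half the distance from \<open>w\<close> to the boundary
    circle, whose power of a point factors as (r - \<rho>)(r + \<rho>).\<close>
  define r c \<rho> d where "r = disc_radius R" and "c = disc_center R" and "\<rho> = norm (w - c)" and "d = (r - \<rho>) / 2"
  have r: "r > 0" unfolding r_def by (rule disc_radius_pos)
  have \<rho>: "0 \<le> \<rho>" "\<rho> < r"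
    using w unfolding disc_power_pos_iff r_def \<rho>_def c_def by (auto simp: dist_norm norm_minus_commute)
  have d: "d > 0" using \<rho> by (simp add: d_def)
  let ?N = "disc_power R w"
  have N: "?N = (r - \<rho>) * (r + \<rho>)"
    unfolding disc_power_eq r_def \<rho>_def c_def by (simp add: power2_eq_square algebra_simps)
  have Nle: "?N \<le> 4 * r * d"
  proof -
    have "(r - \<rho>) * (r + \<rho>) \<le> (r - \<rho>) * (2 * r)" using \<rho> by (intro mult_left_mono) auto
    then show ?thesis unfolding N d_def by (simp add: algebra_simps)
  qed
  have N': "disc_power R z \<ge> ?N / 4" if z: "z \<in> cball w d" for z
  proof -
    define \<rho>' where "\<rho>' = norm (z - c)"
    have "\<rho>' \<le> norm (z - w) + \<rho>"
      unfolding \<rho>'_def \<rho>_def using norm_triangle_ineq[of "z - w" "w - c"] by simp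
    also have "norm (z - w) \<le> d" using z by (simp add: dist_norm norm_minus_commute)
    finally have "r - \<rho>' \<ge> d" by (simp add: d_def field_simps)
    moreover have "\<rho>' \<ge> 0" by (simp add: \<rho>'_def)
    ultimately have "d * r \<le> (r - \<rho>') * (r + \<rho>')"
      using d r by (intro mult_mono) auto
    also have "\<dots> = disc_power R z"
      unfolding disc_power_eq r_def \<rho>'_def c_def by (simp add: power2_eq_square algebra_simps)
    finally show ?thesis using Nle by (simp add: mult.commute)
  qed
  have sub: "cball w d \<subseteq> {w. disc_power R w > 0}"
    using N' w by force
  have "norm ((deriv ^^ 1) g w) \<le> fact 1 * (C * (?N / 4) powr (- \<beta>)) / d ^ 1"
  proof (rule Cauchy_inequality)
    show "g holomorphic_on ball w d" using holomorphic_on_subset[OF hol] sub ball_subset_cball by blast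
    show "continuous_on (cball w d) g" using holomorphic_on_imp_continuous_on[OF hol] continuous_on_subset sub by blast
    fix z assume "norm (w - z) = d"
    then have z: "z \<in> cball w d" by (simp add: dist_norm)
    have "norm (g z) \<le> C * disc_power R z powr (- \<beta>)" using bd sub z by auto
    also have "\<dots> \<le> C * (?N / 4) powr (- \<beta>)"
      using N'[OF z] w \<beta> C by (intro mult_left_mono powr_mono2') auto
    finally show "norm (g z) \<le> C * (?N / 4) powr (- \<beta>)" .
  qed (rule d)
  also have "\<dots> = C * (?N / 4) powr (- \<beta>) * (1 / d)" by simp
  also have "\<dots> \<le> C * (?N / 4) powr (- \<beta>) * (4 * r / ?N)"
    using Nle w d C by (intro mult_left_mono) (auto simp: field_simps)
  also have "\<dots> = C * 4 powr (\<beta> + 1) * r * ?N powr (- (\<beta> + 1))"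
    using w by (simp add: powr_divide powr_minus powr_add powr_diff field_simps)
  finally show ?thesis by (simp add: r_def)
qed

text \<open>Integrate over the circle of radius R(1 - 1/L) with L = k + 2. Its relative distance 1/L
  from |w| = R yields L^(p-1) through \<open>integral_cos_powr_le\<close>, while replacing the
  radius by \<open>R\<close> in the k-th power costs at most the factor e.\<close>

lemma holomorphic_coeff_bound:
  assumes R: "R > 1" and p: "p > 1" and C: "C \<ge> 0"
    and hol: "g holomorphic_on ball 0 R"
    and bd: "\<And>w. norm w < R \<Longrightarrow> norm (g w) \<le> C * ((R - norm w) / R + \<bar>Re w\<bar> / R) powr (- p)"
  shows "norm ((deriv ^^ k) g 0 / fact k) \<le> C * (2 powr p * exp 1 / (p - 1)) * (real k + 2) powr (p - 1) * R powr (- real k)"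
proof -
  \<comment> \<open>The shift by 2 keeps the radius at or above R/2 even for k = 0.\<close>
  define L where "L = real k + 2"
  define \<rho> where "\<rho> = R * (1 - 1 / L)"
  have L: "L \<ge> 2" by (simp add: L_def)
  have \<rho>: "R / 2 \<le> \<rho>" "\<rho> < R" "\<rho> > 0"
    using L R by (auto simp: \<rho>_def field_simps)
  have gc: "g holomorphic_on ball 0 \<rho>" "continuous_on (cball 0 \<rho>) g"
  proof -
    have "cball 0 \<rho> \<subseteq> ball 0 R" using \<rho> by (auto simp: dist_norm)
    then show "continuous_on (cball 0 \<rho>) g"
      using holomorphic_on_imp_continuous_on[OF hol] continuous_on_subset by blast
    show "g holomorphic_on ball 0 \<rho>"
      by (rule holomorphic_on_subset[OF hol]) (use \<rho> in auto)
  qed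
  let ?F = "\<lambda>u. g u / (u - 0) ^ Suc k"
  let ?\<gamma> = "circlepath 0 \<rho>"
  let ?I = "2 * pi * \<i> / fact k * (deriv ^^ k) g 0"
  have hc: "(?F has_contour_integral ?I) ?\<gamma>"
    using Cauchy_has_contour_integral_higher_derivative_circlepath[OF gc(2,1), of 0 k] \<rho> by simp
  have \<gamma>: "?\<gamma> t = of_real \<rho> * exp (2 * of_real pi * \<i> * of_real t)" for t
    by (simp add: circlepath)
  have n\<gamma>: "norm (?\<gamma> t) = \<rho>" for t
    using \<rho>(3) by (simp add: \<gamma> norm_mult)
  have Re\<gamma>: "Re (?\<gamma> t) = \<rho> * cos (2 * pi * t)" for t
    by (simp add: \<gamma> Re_exp)
  let ?M = "\<lambda>t. 2 * pi * \<rho> powr (- real k) * C * 2 powr p * (1 / L + \<bar>cos (2 * pi * t)\<bar>) powr (- p)"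
  have hi: "((\<lambda>t. ?F (?\<gamma> t) * vector_derivative ?\<gamma> (at t)) has_integral ?I) {0..1}"
    using hc unfolding has_contour_integral .
  have Mi: "?M integrable_on {0..1}"
  proof -
    have pos: "0 < 1 / L + \<bar>cos (2 * pi * t)\<bar>" for t
      using L by (simp add: add_pos_nonneg)
    have "1 / L + \<bar>cos (2 * pi * t)\<bar> \<noteq> 0" for t
      using pos[of t] by linarith
    then show ?thesis
      by (intro integrable_continuous_interval continuous_intros ballI) (simp_all only: not_False_eq_True)
  qed
  have "norm ?I \<le> integral {0..1} ?M"
  proof (rule order.trans[OF _ integral_norm_bound_integral[OF has_integral_integrable[OF hi] Mi]])
    show "norm ?I \<le> norm (integral {0..1} (\<lambda>t. ?F (?\<gamma> t) * vector_derivative ?\<gamma> (at t)))"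
      unfolding integral_unique[OF hi] by (rule order_refl)
    fix t :: real assume t: "t \<in> {0..1}"
    have "norm (g (?\<gamma> t)) \<le> C * ((R - \<rho>) / R + \<bar>\<rho> * cos (2 * pi * t)\<bar> / R) powr (- p)"
      using bd[of "?\<gamma> t"] \<rho> by (simp only: n\<gamma> Re\<gamma>)
    also have "\<dots> \<le> C * (1 / 2 * (1 / L + \<bar>cos (2 * pi * t)\<bar>)) powr (- p)"
    proof (intro mult_left_mono powr_mono2' C)
      have gen: "1 / 2 * (a + c) \<le> a' + d" if "a' = a" "1 / 2 * c \<le> d" "0 < a" for a a' c d :: real
        using that by simp
      have "(R - \<rho>) / R = 1 / L" using R by (simp add: \<rho>_def field_simps)
      moreover have "1 / 2 * \<bar>cos (2 * pi * t)\<bar> \<le> \<bar>\<rho> * cos (2 * pi * t)\<bar> / R"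
      proof -
        have "R / 2 * \<bar>cos (2 * pi * t)\<bar> \<le> \<rho> * \<bar>cos (2 * pi * t)\<bar>"
          using \<rho> by (intro mult_right_mono) auto
        also have "\<dots> = \<bar>\<rho> * cos (2 * pi * t)\<bar>" using \<rho>(3) by (simp add: abs_mult)
        finally show ?thesis using R by (simp add: field_simps)
      qed
      moreover have "0 < 1 / L" using L by simp
      ultimately show "1 / 2 * (1 / L + \<bar>cos (2 * pi * t)\<bar>) \<le> (R - \<rho>) / R + \<bar>\<rho> * cos (2 * pi * t)\<bar> / R"
        by (rule gen)
      show "0 < 1 / 2 * (1 / L + \<bar>cos (2 * pi * t)\<bar>)" using L by (simp add: add_pos_nonneg)
    qed (use p in auto)
    also have "\<dots> = C * (2 powr p * (1 / L + \<bar>cos (2 * pi * t)\<bar>) powr (- p))"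
    proof -
      have "(1 / 2 * (1 / L + \<bar>cos (2 * pi * t)\<bar>)) powr (- p) = (1 / 2) powr (- p) * (1 / L + \<bar>cos (2 * pi * t)\<bar>) powr (- p)"
        by (rule powr_mult)
      also have "(1 / 2 :: real) powr (- p) = 2 powr p" by (simp add: powr_minus powr_divide field_simps)
      finally show ?thesis by simp
    qed
    finally have 1: "norm (g (?\<gamma> t)) \<le> C * (2 powr p * (1 / L + \<bar>cos (2 * pi * t)\<bar>) powr (- p))" .
    have 2: "norm (vector_derivative ?\<gamma> (at t)) = 2 * pi * \<rho>"
      using \<rho>(3) by (simp add: vector_derivative_circlepath norm_mult)
    have 3: "\<rho> powr (- real k) * \<rho> ^ Suc k = \<rho>"
      using \<rho>(3) by (simp add: powr_minus powr_realpow)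
    have "norm (?F (?\<gamma> t) * vector_derivative ?\<gamma> (at t)) = norm (g (?\<gamma> t)) / \<rho> ^ Suc k * (2 * pi * \<rho>)"
      by (simp only: norm_mult norm_divide norm_power n\<gamma> 2 diff_zero)
    also have "\<dots> = 2 * pi * \<rho> powr (- real k) * norm (g (?\<gamma> t))"
    proof -
      have "\<rho> ^ Suc k > 0" using \<rho>(3) by simp
      then have "\<rho> / \<rho> ^ Suc k = \<rho> powr (- real k)" using 3 by (simp only: divide_eq_eq) simp
      then show ?thesis by (metis mult.assoc mult.commute times_divide_eq_left)
    qed
    also have "\<dots> \<le> 2 * pi * \<rho> powr (- real k) * (C * (2 powr p * (1 / L + \<bar>cos (2 * pi * t)\<bar>) powr (- p)))"
      using 1 by (intro mult_left_mono) auto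
    finally show "norm (?F (?\<gamma> t) * vector_derivative ?\<gamma> (at t)) \<le> ?M t" by (simp only: mult.assoc)
  qed
  also have "integral {0..1} ?M = 2 * pi * \<rho> powr (- real k) * C * 2 powr p * integral {0..1} (\<lambda>t. (1 / L + \<bar>cos (2 * pi * t)\<bar>) powr (- p))"
    by (rule integral_mult_right)
  also have "\<dots> \<le> 2 * pi * \<rho> powr (- real k) * C * 2 powr p * ((1 / L) powr (1 - p) / (p - 1))"
    using L p C by (intro mult_left_mono integral_cos_powr_le) auto
  also have "(1 / L) powr (1 - p) = L powr (p - 1)"
    using L by (simp add: powr_divide powr_minus[symmetric] powr_minus_divide[symmetric])
  also have "norm ?I = 2 * pi * norm ((deriv ^^ k) g 0 / fact k)"
    by (simp add: norm_mult norm_divide)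
  finally have "2 * pi * norm ((deriv ^^ k) g 0 / fact k) \<le> 2 * pi * (\<rho> powr (- real k) * C * 2 powr p * (L powr (p - 1) / (p - 1)))"
    by (simp only: mult.assoc)
  then have "norm ((deriv ^^ k) g 0 / fact k) \<le> \<rho> powr (- real k) * C * 2 powr p * (L powr (p - 1) / (p - 1))"
    by (rule mult_left_le_imp_le) simp
  then have h1: "norm ((deriv ^^ k) g 0 / fact k) \<le> \<rho> powr (- real k) * (C * 2 powr p * (L powr (p - 1) / (p - 1)))"
    by (simp only: mult.assoc)
  \<comment> \<open>1/(1 - 1/L) = 1 + 1/(L-1) <= exp (1/(L-1)), and k/(L-1) = k/(k+1) <= 1.\<close>
  have h2: "\<rho> powr (- real k) \<le> exp 1 * R powr (- real k)"
  proof -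
    have "1 / (1 - 1 / L) \<le> exp (1 / (L - 1))"
      using exp_ge_add_one_self[of "1 / (L - 1)"] L by (simp add: field_simps)
    then have "(1 / (1 - 1 / L)) ^ k \<le> exp (1 / (L - 1)) ^ k"
      using L by (intro power_mono) auto
    also have "\<dots> = exp (real k / (L - 1))" by (simp flip: exp_of_nat_mult)
    also have "\<dots> \<le> exp 1" by (simp add: L_def)
    finally have "(1 / (1 - 1 / L)) ^ k \<le> exp 1" .
    moreover have "\<rho> powr (- real k) = (1 / (1 - 1 / L)) ^ k * R powr (- real k)"
    proof -
      have "1 - 1 / L > 0" using L by simp
      then have "(1 - 1 / L) powr (- real k) = (1 / (1 - 1 / L)) ^ k"
        by (simp add: powr_minus powr_realpow power_one_over inverse_eq_divide)
      then show ?thesis unfolding \<rho>_def powr_mult by (simp only: mult.commute)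
    qed
    ultimately show ?thesis by (simp add: mult_right_mono)
  qed
  have "0 \<le> C * 2 powr p * (L powr (p - 1) / (p - 1))"
    using C p by simp
  from order.trans[OF h1 mult_right_mono[OF h2 this]]
  show ?thesis by (simp add: L_def mult_ac)
qed

text \<open>G1 and \<kappa> G2(-w) glue to one holomorphic function on the union of the two discs.
  The mean-value estimate is applied to its derivative, whose exponent \<beta> + 1 exceeds 1; the
  division by l restores \<beta> - 1. \<open>K\<close> is chosen before all functions, so that it is
  uniform in them.\<close>

lemma two_disc_coeff_bound:
  assumes R: "R > 1" and \<beta>: "\<beta> > 0"
  shows "\<exists>K>0. \<forall>G1 G2 C \<kappa> l.
    G1 holomorphic_on {w. disc_power R w > 0} \<longrightarrow> G2 holomorphic_on {w. disc_power R w > 0} \<longrightarrow>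
    (\<forall>w. disc_power R w > 0 \<longrightarrow> norm (G1 w) \<le> C * disc_power R w powr (- \<beta>)) \<longrightarrow>
    (\<forall>w. disc_power R w > 0 \<longrightarrow> norm (G2 w) \<le> C * disc_power R w powr (- \<beta>)) \<longrightarrow>
    C \<ge> 0 \<longrightarrow> norm \<kappa> = 1 \<longrightarrow>
    (\<forall>x. - 1 < x \<longrightarrow> x < 1 \<longrightarrow> G1 (of_real x) = \<kappa> * G2 (- of_real x)) \<longrightarrow>
    norm ((deriv ^^ l) G1 0 / fact l) \<le> K * C * (real l + 1) powr (\<beta> - 1) * R powr (- real l)"
proof -
  \<comment> \<open>\<kappa>0 is the best constant for which R(R - |w|) + (R^2 - 1)|Re w| is at
    least \<kappa>0 ((R - |w|)/R + |Re w|/R) term by term.\<close>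
  define p r \<kappa>0 where "p = \<beta> + 1" and "r = disc_radius R" and "\<kappa>0 = min (R\<^sup>2) ((R\<^sup>2 - 1) * R)"
  have R2: "R\<^sup>2 > 1" using R by simp
  have \<kappa>0: "\<kappa>0 > 0" using R R2 by (simp add: \<kappa>0_def)
  have r: "r > 0" unfolding r_def by (rule disc_radius_pos)
  have p: "p > 1" using \<beta> by (simp add: p_def)
  define B where "B = 4 powr p * r * \<kappa>0 powr (- p)"
  have B: "B > 0" using r \<kappa>0 by (simp add: B_def)
  \<comment> \<open>The factor 2R pays for passing from index k of the derivative to index l = k +
    1: R^(-k) = R R^(-l), and l + 1 <= 2l.\<close>
  define K where "K = 1 + 2 * R * (B * (2 powr p * exp 1 / (p - 1)))"
  have K: "K \<ge> 1" "2 * R * (B * (2 powr p * exp 1 / (p - 1))) \<le> K"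
    using R B p by (auto simp: K_def)
  let ?D = "{w. disc_power R w > 0}"
  let ?D' = "{w. disc_power R (- w) > 0}"
  have D: "?D = ball (disc_center R) (disc_radius R)" using disc_power_pos_iff by auto
  have D': "?D' = ball (- disc_center R) (disc_radius R)"
  proof -
    have "norm (- disc_center R - w) = norm (disc_center R + w)" for w
      by (metis minus_add_distrib norm_minus_cancel uminus_add_conv_diff add.commute minus_diff_eq diff_minus_eq_add)
    then show ?thesis by (auto simp: disc_power_pos_iff dist_norm)
  qed
  have main: "norm ((deriv ^^ l) G1 0 / fact l) \<le> K * C * (real l + 1) powr (\<beta> - 1) * R powr (- real l)"
    if hol: "G1 holomorphic_on ?D" "G2 holomorphic_on ?D"
      and bd: "\<And>w. disc_power R w > 0 \<Longrightarrow> norm (G1 w) \<le> C * disc_power R w powr (- \<beta>)"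
        "\<And>w. disc_power R w > 0 \<Longrightarrow> norm (G2 w) \<le> C * disc_power R w powr (- \<beta>)"
      and C: "C \<ge> 0" and \<kappa>: "norm \<kappa> = 1"
      and sym: "\<And>x. - 1 < x \<Longrightarrow> x < 1 \<Longrightarrow> G1 (of_real x) = \<kappa> * G2 (- of_real x)" for G1 G2 C \<kappa> l
  proof -
    define G2' where "G2' w = \<kappa> * G2 (- w)" for w
    have hol2: "G2' holomorphic_on ?D'"
      unfolding G2'_def by (intro holomorphic_intros holomorphic_on_compose_gen[OF _ hol(2), of uminus, unfolded o_def]) auto
    have real_in: "complex_of_real x \<in> ?D \<inter> ?D'" if "- 1 < x" "x < 1" for x
    proof -
      have "disc_power R (of_real x) = (R\<^sup>2 + x) * (1 - x)"
        unfolding disc_power_def by (simp add: power2_eq_square algebra_simps)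
      moreover have "disc_power R (- of_real x) = (R\<^sup>2 - x) * (1 + x)"
        unfolding disc_power_def by (simp add: power2_eq_square algebra_simps)
      moreover have "R\<^sup>2 + x > 0" "R\<^sup>2 - x > 0" using that R2 by auto
      ultimately show ?thesis using that by simp
    qed
    \<comment> \<open>The overlap of the two discs is convex, hence connected, and the symmetry is
      known on a real interval through 0.\<close>
    have agree: "G1 w = G2' w" if w: "w \<in> ?D \<inter> ?D'" for w
    proof -
      have "G1 w - G2' w = 0"
      proof (rule analytic_continuation[where f="\<lambda>w. G1 w - G2' w" and S="?D \<inter> ?D'" and U="complex_of_real ` {- 1<..<1}" and \<xi>=0])
        show "(\<lambda>w. G1 w - G2' w) holomorphic_on ?D \<inter> ?D'"
          by (intro holomorphic_intros holomorphic_on_subset[OF hol(1)] holomorphic_on_subset[OF hol2]) auto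
        show "open (?D \<inter> ?D')" unfolding D D' by (intro open_Int open_ball)
        show "connected (?D \<inter> ?D')" unfolding D D' by (intro convex_connected convex_Int convex_ball)
        show "complex_of_real ` {- 1<..<1} \<subseteq> ?D \<inter> ?D'" using real_in by auto
        show "0 \<in> ?D \<inter> ?D'" using real_in[of 0] by simp
        show "0 islimpt complex_of_real ` {- 1<..<1}"
          unfolding islimpt_approachable
        proof (intro allI impI)
          fix e :: real assume e: "e > 0"
          define y where "y = min e 1 / 2"
          have y: "0 < y" "y < 1" "y < e" using e by (auto simp: y_def)
          show "\<exists>x'\<in>complex_of_real ` {- 1<..<1}. x' \<noteq> 0 \<and> dist x' 0 < e"
            by (rule bexI[of _ "complex_of_real y"]) (use y in \<open>auto simp: dist_norm\<close>)
        qed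
      qed (use sym w in \<open>auto simp: G2'_def\<close>)
      then show ?thesis by simp
    qed
    define G where "G w = (if w \<in> ?D then G1 w else G2' w)" for w
    have G1: "G w = G1 w" if "w \<in> ?D" for w using that by (simp add: G_def)
    have G2: "G w = G2' w" if "w \<in> ?D'" for w using that agree by (auto simp: G_def)
    have oD: "open ?D" "open ?D'" unfolding D D' by auto
    have "G holomorphic_on ?D \<union> ?D'"
    proof (rule holomorphic_on_Un)
      show "G holomorphic_on ?D" using hol(1) by (rule holomorphic_transform) (simp add: G1)
      show "G holomorphic_on ?D'" using hol2 by (rule holomorphic_transform) (simp add: G2)
    qed (rule oD)+
    \<comment> \<open>For Re w <= 0 the term -(R^2 - 1) Re w helps, so the first disc alone covers
      this half of |w| < R; its mirror image covers the other half.\<close>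
    have lower: "\<kappa>0 * ((R - norm w) / R + \<bar>Re w\<bar> / R) \<le> disc_power R w \<and> 0 < disc_power R w"
      if w: "norm w < R" "Re w \<le> 0" for w
    proof -
      have "R * (R - norm w) \<le> (R + norm w) * (R - norm w)"
        using w(1) by (intro mult_right_mono) auto
      then have "R * (R - norm w) + (R\<^sup>2 - 1) * \<bar>Re w\<bar> \<le> disc_power R w"
        using w(2) unfolding disc_power_def by (simp add: power2_eq_square algebra_simps)
      moreover have "\<kappa>0 * ((R - norm w) / R) \<le> R\<^sup>2 * ((R - norm w) / R)"
        using w R by (intro mult_right_mono) (auto simp: \<kappa>0_def)
      moreover have "\<kappa>0 * (\<bar>Re w\<bar> / R) \<le> ((R\<^sup>2 - 1) * R) * (\<bar>Re w\<bar> / R)"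
        using R by (intro mult_right_mono) (auto simp: \<kappa>0_def)
      moreover have "R\<^sup>2 * ((R - norm w) / R) = R * (R - norm w)" "((R\<^sup>2 - 1) * R) * (\<bar>Re w\<bar> / R) = (R\<^sup>2 - 1) * \<bar>Re w\<bar>"
        using R by (auto simp: power2_eq_square)
      moreover have "R * (R - norm w) > 0" using R w by simp
      moreover have "(R\<^sup>2 - 1) * \<bar>Re w\<bar> \<ge> 0" by (rule mult_nonneg_nonneg) (use R2 in simp_all)
      ultimately show ?thesis by (simp add: distrib_left)
    qed
    have cover: "ball (0 :: complex) R \<subseteq> ?D \<union> ?D'"
    proof
      fix w :: complex assume "w \<in> ball 0 R"
      then have "norm w < R" by simp
      then show "w \<in> ?D \<union> ?D'"
        using lower[of w] lower[of "- w"] by (cases "Re w \<le> 0") auto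
    qed
    have holG: "G holomorphic_on ball 0 R"
      using \<open>G holomorphic_on ?D \<union> ?D'\<close> cover by (rule holomorphic_on_subset)
    have bd': "norm (deriv G w) \<le> C * B * ((R - norm w) / R + \<bar>Re w\<bar> / R) powr (- p)" if w: "norm w < R" for w
    proof -
      have *: "C * 4 powr p * r * disc_power R v powr (- p) \<le> C * B * ((R - norm w) / R + \<bar>Re w\<bar> / R) powr (- p)"
        if v: "norm v = norm w" "\<bar>Re v\<bar> = \<bar>Re w\<bar>" "Re v \<le> 0" for v
      proof -
        let ?b = "(R - norm w) / R + \<bar>Re w\<bar> / R"
        have b: "?b > 0" using w R by (intro add_pos_nonneg) auto
        have "disc_power R v powr (- p) \<le> (\<kappa>0 * ?b) powr (- p)"
          using lower[of v] v w b \<kappa>0 p by (intro powr_mono2') auto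
        also have "\<dots> = \<kappa>0 powr (- p) * ?b powr (- p)" by (rule powr_mult)
        finally have "C * 4 powr p * r * disc_power R v powr (- p) \<le> C * 4 powr p * r * (\<kappa>0 powr (- p) * ?b powr (- p))"
          using C r by (intro mult_left_mono) auto
        then show ?thesis by (simp add: B_def mult_ac)
      qed
      show ?thesis
      proof (cases "Re w \<le> 0")
        case True
        have wD: "disc_power R w > 0" using lower[OF w True] by simp
        have "eventually (\<lambda>u. G u = G1 u) (nhds w)"
          using eventually_nhds_in_open[OF oD(1), of w] wD by (auto elim!: eventually_mono simp: G1)
        then have "deriv G w = deriv G1 w" by (rule deriv_cong_ev) simp
        then have "norm (deriv G w) \<le> C * 4 powr p * r * disc_power R w powr (- p)"
          using disc_power_deriv_bound[OF hol(1) bd(1) _ C wD] \<beta> by (simp add: p_def r_def)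
        also note *[of w]
        finally show ?thesis using True by simp
      next
        case False
        have wD: "disc_power R (- w) > 0" using lower[of "- w"] w False by simp
        have "eventually (\<lambda>u. G u = G2' u) (nhds w)"
          using eventually_nhds_in_open[OF oD(2), of w] wD by (auto elim!: eventually_mono simp: G2)
        then have "deriv G w = deriv G2' w" by (rule deriv_cong_ev) simp
        also have "deriv G2' w = - \<kappa> * deriv G2 (- w)"
        proof (rule DERIV_imp_deriv)
          have "open ?D" by (rule oD(1))
          have "(G2 has_field_derivative deriv G2 (- w)) (at (- w))"
            using holomorphic_derivI[OF hol(2) oD(1), of "- w" UNIV] wD by simp
          then have "((\<lambda>u. G2 (- u)) has_field_derivative deriv G2 (- w) * (- 1)) (at w)"
            by (rule DERIV_chain2) (auto intro!: derivative_eq_intros)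
          then show "(G2' has_field_derivative - \<kappa> * deriv G2 (- w)) (at w)"
            unfolding G2'_def by (auto intro!: derivative_eq_intros)
        qed
        finally have "norm (deriv G w) = norm (deriv G2 (- w))" using \<kappa> by (simp add: norm_mult)
        also have "\<dots> \<le> C * 4 powr p * r * disc_power R (- w) powr (- p)"
          using disc_power_deriv_bound[OF hol(2) bd(2) _ C wD] \<beta> by (simp add: p_def r_def)
        also note *[of "- w"]
        finally show ?thesis using False by simp
      qed
    qed
    have "eventually (\<lambda>u. G1 u = G u) (nhds 0)"
      using eventually_nhds_in_open[OF oD(1), of 0] real_in[of 0] by (auto elim!: eventually_mono simp: G1)
    then have GG: "(deriv ^^ l) G1 0 = (deriv ^^ l) G 0"
      by (rule higher_deriv_cong_ev) simp
    show ?thesis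
    \<comment> \<open>The zeroth coefficient is lost in the derivative. It is bounded directly,
      since \<open>disc_power\<close> at 0 equals R^2 >= 1.\<close>
    proof (cases l)
      case 0
      have "norm (G1 0) \<le> C * disc_power R 0 powr (- \<beta>)" using bd(1)[of 0] R by (simp add: disc_power_def)
      also have "\<dots> \<le> C * 1"
      proof (intro mult_left_mono C)
        have "disc_power R 0 powr (- \<beta>) \<le> 1 powr (- \<beta>)"
          using R2 \<beta> by (intro powr_mono2') (auto simp: disc_power_def)
        then show "disc_power R 0 powr (- \<beta>) \<le> 1" by simp
      qed
      also have "\<dots> \<le> K * C" using mult_right_mono[OF K(1) C] by simp
      finally show ?thesis using 0 R by simp
    next
      case (Suc k)
      have "norm ((deriv ^^ k) (deriv G) 0 / fact k) \<le> C * B * (2 powr p * exp 1 / (p - 1)) * (real k + 2) powr (p - 1) * R powr (- real k)"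
        using R p C B holomorphic_deriv[OF holG open_ball] bd'
        by (intro holomorphic_coeff_bound) auto
      moreover have "(deriv ^^ l) G 0 = (deriv ^^ k) (deriv G) 0"
        unfolding Suc funpow_Suc_right by simp
      ultimately have 1: "norm ((deriv ^^ l) G 0 / fact k) \<le> C * B * (2 powr p * exp 1 / (p - 1)) * (real l + 1) powr \<beta> * R powr (- real k)"
        by (simp add: Suc p_def add.commute)
      have "(real l + 1) powr \<beta> / real l \<le> 2 * (real l + 1) powr (\<beta> - 1)"
      proof -
        have "(real l + 1) powr \<beta> = (real l + 1) powr (\<beta> - 1) * (real l + 1)"
          by (simp add: powr_diff)
        moreover have "real l + 1 \<le> 2 * real l" using Suc by simp
        ultimately have "(real l + 1) powr \<beta> \<le> (real l + 1) powr (\<beta> - 1) * (2 * real l)"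
          by (simp only:) (intro mult_left_mono, auto)
        then show ?thesis using Suc by (simp add: field_simps)
      qed
      note 2 = this
      have 3: "R powr (- real k) = R * R powr (- real l)"
      proof -
        have "- real l = - real k + (- 1)" by (simp add: Suc)
        then have "R powr (- real l) = R powr (- real k) * R powr (- 1)"
          by (simp only: powr_add)
        then show ?thesis using R by (simp add: powr_minus)
      qed
      have "norm ((deriv ^^ l) G 0 / fact l) = norm ((deriv ^^ l) G 0 / fact k) / real l"
        by (simp add: Suc norm_divide norm_mult field_simps del: of_nat_Suc)
      also have "\<dots> \<le> C * B * (2 powr p * exp 1 / (p - 1)) * (real l + 1) powr \<beta> * R powr (- real k) / real l"
        using 1 by (rule divide_right_mono) simp
      also have "\<dots> = (C * B * (2 powr p * exp 1 / (p - 1)) * R powr (- real k)) * ((real l + 1) powr \<beta> / real l)"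
        by simp
      also have "\<dots> \<le> (C * B * (2 powr p * exp 1 / (p - 1)) * R powr (- real k)) * (2 * (real l + 1) powr (\<beta> - 1))"
        using C B p by (intro mult_left_mono 2) auto
      also have "\<dots> = (2 * R * (B * (2 powr p * exp 1 / (p - 1)))) * (C * (real l + 1) powr (\<beta> - 1) * R powr (- real l))"
        unfolding 3 by (simp only: mult_ac)
      also have "\<dots> \<le> K * (C * (real l + 1) powr (\<beta> - 1) * R powr (- real l))"
        using C K(2) by (intro mult_right_mono) auto
      finally show ?thesis unfolding GG by (simp only: mult.assoc)
    qed
  qed
  show ?thesis
    by (rule exI[of _ K]) (use K(1) main in auto)
qed

section \<open>Estimates for the projections\<close>

lemma disc_power_Re_less:
  assumes "R > 1" "disc_power R w > 0"
  shows "Re w < 1"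
proof (rule ccontr)
  assume "\<not> Re w < 1"
  then have w: "Re w \<ge> 1" by simp
  have "disc_power R w \<le> (R\<^sup>2 + Re w) * (1 - Re w)"
    unfolding disc_power_def cmod_power2 by (simp add: power2_eq_square algebra_simps)
  also have "\<dots> \<le> 0" using w by (intro mult_nonneg_nonpos) (auto intro: add_nonneg_nonneg)
  finally show False using assms by simp
qed

text \<open>A quantitative form of the statement that (1+w)/(1-w) maps the disc into the half-plane
  Re s > -a: the distance to the boundary line equals \<open>disc_power\<close> up to the factor 2 /
  ((R^2+1) |1-w|^2).\<close>

lemma disc_power_Re_Moebius:
  assumes R: "R > 1" and w: "disc_power R w > 0"
  shows "(R\<^sup>2 - 1) / (R\<^sup>2 + 1) + Re ((1 + w) / (1 - w)) = 2 * disc_power R w / ((R\<^sup>2 + 1) * (norm (1 - w))\<^sup>2)"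
proof -
  have d: "(1 - Re w)\<^sup>2 + (Im w)\<^sup>2 > 0"
    using disc_power_Re_less[OF R w] by (intro add_pos_nonneg) auto
  have R2: "R\<^sup>2 + 1 > 0" by (simp add: add_nonneg_pos)
  have 1: "Re ((1 + w) / (1 - w)) = (1 - (Re w)\<^sup>2 - (Im w)\<^sup>2) / ((1 - Re w)\<^sup>2 + (Im w)\<^sup>2)"
    unfolding Re_divide by (simp add: power2_eq_square algebra_simps)
  have 2: "(norm (1 - w))\<^sup>2 = (1 - Re w)\<^sup>2 + (Im w)\<^sup>2"
    by (simp add: cmod_power2)
  have gen: "x / S + y / D = 2 * z / (S * D)" if "S > 0" "D > 0" "x * D + y * S = 2 * z" for x y z S D :: real
    using that by (simp add: field_simps)
  show ?thesis
    unfolding 1 2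
  proof (rule gen[OF R2 d])
    show "(R\<^sup>2 - 1) * ((1 - Re w)\<^sup>2 + (Im w)\<^sup>2) + (1 - (Re w)\<^sup>2 - (Im w)\<^sup>2) * (R\<^sup>2 + 1) = 2 * disc_power R w"
      unfolding disc_power_def cmod_power2 by (simp add: power2_eq_square algebra_simps)
  qed
qed

lemma disc_power_Moebius_gt:
  assumes R: "R > 1" and w: "disc_power R w > 0"
  shows "Re ((1 + w) / (1 - w)) > - ((R\<^sup>2 - 1) / (R\<^sup>2 + 1))"
proof -
  have "norm (1 - w) > 0" using disc_power_Re_less[OF R w] by auto
  then have "2 * disc_power R w / ((R\<^sup>2 + 1) * (norm (1 - w))\<^sup>2) > 0"
    using w by (intro divide_pos_pos mult_pos_pos) (auto simp: add_nonneg_pos)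
  with disc_power_Re_Moebius[OF R w] show ?thesis by linarith
qed

lemma laguerre_gen_holomorphic:
  assumes R: "R > 1" and q: "gauss_dominated ((R\<^sup>2 - 1) / (R\<^sup>2 + 1)) m A q"
  shows "laguerre_gen c q holomorphic_on {w. disc_power R w > 0}"
proof -
  have ne: "1 - w \<noteq> 0" "1 - w \<notin> \<real>\<^sub>\<le>\<^sub>0" if "disc_power R w > 0" for w
    using disc_power_Re_less[OF R that] by (auto simp: complex_nonpos_Reals_iff)
  have "(\<lambda>w. gauss_integral q ((1 + w) / (1 - w))) holomorphic_on {w. disc_power R w > 0}"
    by (rule holomorphic_on_compose_gen[OF _ gauss_integral_holomorphic[OF q], of "\<lambda>w. (1 + w) / (1 - w)", unfolded o_def])
       (use ne disc_power_Moebius_gt[OF R] in \<open>auto intro!: holomorphic_intros\<close>)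
  then show ?thesis
    unfolding laguerre_gen_def[abs_def] using ne by (intro holomorphic_intros) auto
qed

text \<open>The half-plane bound contributes |1-w|^(m+n) and the prefactor |1-w|^(-m-n/2). The
  product |1-w|^(n/2) is bounded on the disc, so the point w = 1 causes no worse growth than the
  rest of the circle.\<close>

lemma laguerre_gen_bound:
  assumes R: "R > 1"
  shows "\<exists>K\<ge>0. \<forall>q A w. gauss_dominated ((R\<^sup>2 - 1) / (R\<^sup>2 + 1)) m A (q :: real^'n \<Rightarrow> complex) \<longrightarrow> disc_power R w > 0 \<longrightarrow>
    norm (laguerre_gen (m + CARD('n) / 2) q w) \<le> K * A * disc_power R w powr (- ((m + CARD('n)) / 2))"
proof -
  let ?a = "(R\<^sup>2 - 1) / (R\<^sup>2 + 1)" and ?c = "m + CARD('n) / 2 :: real" and ?\<beta> = "(m + CARD('n)) / 2 :: real"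
  define K where "K = gauss_moment TYPE('n) m * ((2 / (R\<^sup>2 + 1)) powr (- ?\<beta>) * (R\<^sup>2 + 1) powr (CARD('n) / 2))"
  have R2: "R\<^sup>2 + 1 > 0" by (simp add: add_nonneg_pos)
  have K: "K \<ge> 0" unfolding K_def by (intro mult_nonneg_nonneg gauss_moment_nonneg) auto
  moreover have "norm (laguerre_gen ?c q w) \<le> K * A * disc_power R w powr (- ?\<beta>)"
    if q: "gauss_dominated ?a m A q" and w: "disc_power R w > 0" for q :: "real^'n \<Rightarrow> complex" and A w
  proof -
    let ?N = "disc_power R w" and ?d = "norm (1 - w)"
    have d: "?d > 0" using disc_power_Re_less[OF R w] by auto
    have A: "A \<ge> 0" using q by (simp add: gauss_dominated_def)
    \<comment> \<open>The point 1 lies on the boundary circle, so its distance to \<open>w\<close>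
      is at most the diameter.\<close>
    have "?d \<le> R\<^sup>2 + 1"
    proof -
      have "norm (w - disc_center R) < disc_radius R"
        using w by (simp add: disc_power_pos_iff dist_norm norm_minus_commute)
      moreover have "norm (1 - disc_center R) = disc_radius R"
      proof -
        have "1 - disc_center R = of_real (disc_radius R)"
          by (simp add: disc_center_def disc_radius_def complex_eq_iff field_simps)
        then show ?thesis using disc_radius_pos[of R] by (simp only: norm_of_real)
      qed
      moreover have "?d \<le> norm (1 - disc_center R) + norm (w - disc_center R)"
        by (metis norm_triangle_ineq4 diff_diff_eq2 diff_add_cancel add_diff_cancel_right diff_add_eq)
      ultimately have "?d \<le> 2 * disc_radius R" by linarith
      then show ?thesis by (simp add: disc_radius_def)
    qed
    then have dR: "?d powr (CARD('n) / 2) \<le> (R\<^sup>2 + 1) powr (CARD('n) / 2)"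
      using d by (intro powr_mono2) auto
    have "norm (laguerre_gen ?c q w) = ?d powr (- ?c) * norm (gauss_integral q ((1 + w) / (1 - w)))"
    proof -
      have "norm ((1 - w) powr (- of_real ?c)) = ?d powr (- ?c)"
        using norm_powr_real_powr'[of "- of_real ?c" "1 - w"] by simp
      then show ?thesis unfolding laguerre_gen_def norm_mult by simp
    qed
    also have "\<dots> \<le> ?d powr (- ?c) * (A * gauss_moment TYPE('n) m * (?a + Re ((1 + w) / (1 - w))) powr (- real (m + CARD('n)) / 2))"
      by (intro mult_left_mono norm_gauss_integral_le[OF q] disc_power_Moebius_gt[OF R w]) simp
    also have "(?a + Re ((1 + w) / (1 - w))) powr (- real (m + CARD('n)) / 2) =
        (2 / (R\<^sup>2 + 1)) powr (- ?\<beta>) * ?N powr (- ?\<beta>) * (?d powr (2 * ?\<beta>))"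
    proof -
      have "?a + Re ((1 + w) / (1 - w)) = (2 / (R\<^sup>2 + 1)) * ?N * (?d powr (- 2))"
        unfolding disc_power_Re_Moebius[OF R w] using d by (simp add: powr_minus divide_inverse)
      then have "(?a + Re ((1 + w) / (1 - w))) powr (- ?\<beta>) = ((2 / (R\<^sup>2 + 1)) * ?N * (?d powr (- 2))) powr (- ?\<beta>)"
        by (rule arg_cong)
      also have "\<dots> = (2 / (R\<^sup>2 + 1)) powr (- ?\<beta>) * ?N powr (- ?\<beta>) * (?d powr (2 * ?\<beta>))"
        by (simp only: powr_mult powr_powr minus_mult_minus)
      finally show ?thesis by (simp only: minus_divide_left[symmetric])
    qed
    also have "?d powr (- ?c) * (A * gauss_moment TYPE('n) m * ((2 / (R\<^sup>2 + 1)) powr (- ?\<beta>) * ?N powr (- ?\<beta>) * (?d powr (2 * ?\<beta>)))) =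
        gauss_moment TYPE('n) m * (2 / (R\<^sup>2 + 1)) powr (- ?\<beta>) * A * ?N powr (- ?\<beta>) * (?d powr (- ?c) * ?d powr (2 * ?\<beta>))"
      by (simp only: mult_ac)
    also have "?d powr (- ?c) * ?d powr (2 * ?\<beta>) = ?d powr (CARD('n) / 2)"
      unfolding powr_add[symmetric] by (rule arg_cong[of _ _ "(powr) ?d"]) (simp add: field_simps)
    also have "gauss_moment TYPE('n) m * (2 / (R\<^sup>2 + 1)) powr (- ?\<beta>) * A * ?N powr (- ?\<beta>) * ?d powr (CARD('n) / 2) \<le>
      gauss_moment TYPE('n) m * (2 / (R\<^sup>2 + 1)) powr (- ?\<beta>) * A * ?N powr (- ?\<beta>) * (R\<^sup>2 + 1) powr (CARD('n) / 2)"
      using A by (intro mult_left_mono dR mult_nonneg_nonneg gauss_moment_nonneg) auto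
    finally show ?thesis by (simp only: K_def mult_ac)
  qed
  ultimately show ?thesis by blast
qed

lemma gauss_dominated_mult_poly:
  fixes f p :: "real^'n \<Rightarrow> complex"
  assumes f: "f \<in> borel_measurable borel" "AE x in lborel. norm (f x) \<le> C0 * exp (- (1/2) * a * (norm x)\<^sup>2)" "C0 \<ge> 0"
    and p: "p \<in> borel_measurable borel" "\<And>x. norm (p x) \<le> A * norm x ^ m" "A \<ge> 0"
  shows "gauss_dominated a m (C0 * A) (\<lambda>x. f x * p x)"
  unfolding gauss_dominated_def
proof (intro conjI)
  show "(\<lambda>x. f x * p x) \<in> borel_measurable borel" using f p by measurable
  show "AE x in lborel. norm (f x * p x) \<le> C0 * A * norm x ^ m * exp (- a * (norm x)\<^sup>2 / 2)"
    using f(2)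
  proof eventually_elim
    case (elim x)
    have "norm (f x * p x) \<le> (C0 * exp (- (1/2) * a * (norm x)\<^sup>2)) * (A * norm x ^ m)"
      unfolding norm_mult using elim p f(3) by (intro mult_mono) auto
    also have "- (1/2) * a * (norm x)\<^sup>2 = - a * (norm x)\<^sup>2 / 2" by simp
    finally show ?case by (simp only: mult_ac)
  qed
qed (use f p in simp)

text \<open>The coefficient of x^i in the Laguerre polynomial of degree \<open>l\<close> and
  parameter c - 1.\<close>

definition laguerre_coeff :: "real \<Rightarrow> nat \<Rightarrow> nat \<Rightarrow> real" where
  "laguerre_coeff c l i = (-1) ^ i / fact i * (pochhammer (c + real i) (l - i) / fact (l - i))"

text \<open>Both generating functions, for \<open>f\<close> and for its transform, obey the same
  bound on the same disc; the factor relating them at opposite real points is i^m, of modulus one.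
  The constant is free of \<open>l\<close> and linear in \<open>A\<close>.\<close>

lemma laguerre_pairing_bound:
  fixes f :: "real^'n \<Rightarrow> complex"
  assumes R: "R > 1" and L1: "integrable lborel f" and C0: "C0 \<ge> 0"
    and f_bound: "AE x in lborel. norm (f x) \<le> C0 * exp (- (1/2) * ((R\<^sup>2 - 1) / (R\<^sup>2 + 1)) * (norm x)\<^sup>2)"
    and fhat_bound: "\<And>x. norm (fourier f x) \<le> C0 * exp (- (1/2) * ((R\<^sup>2 - 1) / (R\<^sup>2 + 1)) * (norm x)\<^sup>2)"
  shows "\<exists>K>0. \<forall>A p l. A \<ge> 0 \<longrightarrow> homogeneous_poly_fun m p \<longrightarrow> laplacian p = (\<lambda>_. 0) \<longrightarrow>
    (\<forall>x. norm (p x) \<le> A * norm x ^ m) \<longrightarrow>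
    norm (\<Sum>i\<le>l. of_real (laguerre_coeff (m + CARD('n) / 2) l i) *
        (LINT x|lborel. f x * p x * of_real (norm x ^ (2 * i) * exp (- (norm x)\<^sup>2 / 2))))
      \<le> K * A * (real l + 1) powr ((m + CARD('n)) / 2 - 1) * R powr (- real l)"
proof -
  let ?a = "(R\<^sup>2 - 1) / (R\<^sup>2 + 1)" and ?c = "m + CARD('n) / 2 :: real" and ?\<beta> = "(m + CARD('n)) / 2 :: real"
  have R2: "R\<^sup>2 > 1" using R by simp
  have a: "?a > 0" using R2 by simp
  have \<beta>: "?\<beta> > 0" by (simp add: add_nonneg_pos)
  obtain K1 where K1: "K1 \<ge> 0" "\<And>q A w. gauss_dominated ?a m A (q :: real^'n \<Rightarrow> complex) \<Longrightarrow> disc_power R w > 0 \<Longrightarrow>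
    norm (laguerre_gen ?c q w) \<le> K1 * A * disc_power R w powr (- ?\<beta>)"
    using laguerre_gen_bound[OF R, where ?'n='n and m=m] by blast
  note td = two_disc_coeff_bound[OF R \<beta>]
  obtain K2 where K2: "K2 > 0" and K2b: "\<And>G1 G2 C \<kappa> l.
    G1 holomorphic_on {w. disc_power R w > 0} \<Longrightarrow> G2 holomorphic_on {w. disc_power R w > 0} \<Longrightarrow>
    (\<And>w. disc_power R w > 0 \<Longrightarrow> norm (G1 w) \<le> C * disc_power R w powr (- ?\<beta>)) \<Longrightarrow>
    (\<And>w. disc_power R w > 0 \<Longrightarrow> norm (G2 w) \<le> C * disc_power R w powr (- ?\<beta>)) \<Longrightarrow>
    C \<ge> 0 \<Longrightarrow> norm \<kappa> = 1 \<Longrightarrow>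
    (\<And>x. - 1 < x \<Longrightarrow> x < 1 \<Longrightarrow> G1 (of_real x) = \<kappa> * G2 (- of_real x)) \<Longrightarrow>
    norm ((deriv ^^ l) G1 0 / fact l) \<le> K2 * C * (real l + 1) powr (?\<beta> - 1) * R powr (- real l)"
    using td by metis
  define K where "K = 1 + K2 * K1 * C0"
  have K: "K > 0" using K2 K1 C0 by (simp add: K_def add_pos_nonneg)
  have fm: "f \<in> borel_measurable borel" using borel_measurable_integrable[OF L1] by simp
  have "norm (\<Sum>i\<le>l. of_real (laguerre_coeff ?c l i) *
        (LINT x|lborel. f x * p x * of_real (norm x ^ (2 * i) * exp (- (norm x)\<^sup>2 / 2))))
      \<le> K * A * (real l + 1) powr (?\<beta> - 1) * R powr (- real l)"
    if A: "A \<ge> 0" and p: "homogeneous_poly_fun m p" and harm: "laplacian p = (\<lambda>_. 0)"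
      and pb: "\<And>x. norm (p x) \<le> A * norm x ^ m" for A p l
  proof -
    have pm: "p \<in> borel_measurable borel" by (rule homogeneous_measurable[OF p])
    have d1: "gauss_dominated ?a m (C0 * A) (\<lambda>x. f x * p x)"
      by (rule gauss_dominated_mult_poly[OF fm f_bound C0 pm pb A])
    have d2: "gauss_dominated ?a m (C0 * A) (\<lambda>x. fourier f x * p x)"
      by (rule gauss_dominated_mult_poly[OF fourier_measurable[OF fm] AE_I2[OF fhat_bound] C0 pm pb A])
    have "(\<Sum>i\<le>l. of_real (laguerre_coeff ?c l i) *
        (LINT x|lborel. f x * p x * of_real (norm x ^ (2 * i) * exp (- (norm x)\<^sup>2 / 2)))) =
      (deriv ^^ l) (laguerre_gen ?c (\<lambda>x. f x * p x)) 0 / fact l"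
      unfolding laguerre_coeff_def by (rule laguerre_gen_coeff[OF d1 a, symmetric])
    also have "norm \<dots> \<le> K2 * (K1 * (C0 * A)) * (real l + 1) powr (?\<beta> - 1) * R powr (- real l)"
    proof (rule K2b[where \<kappa>="\<i> ^ m"])
      show "laguerre_gen ?c (\<lambda>x. f x * p x) holomorphic_on {w. disc_power R w > 0}"
        "laguerre_gen ?c (\<lambda>x. fourier f x * p x) holomorphic_on {w. disc_power R w > 0}"
        by (rule laguerre_gen_holomorphic[OF R d1] laguerre_gen_holomorphic[OF R d2])+
      show "K1 * (C0 * A) \<ge> 0" using K1 C0 A by simp
      show "norm (\<i> ^ m) = 1" by (simp add: norm_power)
    qed (use K1(2)[OF d1] K1(2)[OF d2] laguerre_gen_fourier[OF L1 p harm] in auto)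
    also have "\<dots> = (K2 * K1 * C0) * (A * (real l + 1) powr (?\<beta> - 1) * R powr (- real l))"
      by (simp only: mult_ac)
    also have "\<dots> \<le> K * (A * (real l + 1) powr (?\<beta> - 1) * R powr (- real l))"
      using A by (intro mult_right_mono) (auto simp: K_def)
    finally show ?thesis by (simp only: mult.assoc)
  qed
  with K show ?thesis by blast
qed

text \<open>Gamma's product sequence l! l^c / (c)_(l+1) converges, hence is bounded. The case l = 0
  is separate because l^c degenerates there.\<close>

lemma fact_div_pochhammer_le:
  assumes c: "c > (0 :: real)"
  shows "\<exists>\<kappa>>0. \<forall>l. fact l / pochhammer c l \<le> \<kappa> * (real l + 1) powr (1 - c)"
proof -
  have "Gamma_series c \<longlonglongrightarrow> Gamma c" by (rule Gamma_series_LIMSEQ)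
  then have "Bseq (Gamma_series c)" by (rule convergentI[THEN convergent_imp_Bseq])
  then obtain B where B: "B > 0" "\<And>n. norm (Gamma_series c n) \<le> B"
    unfolding Bseq_def by blast
  define \<kappa> where "\<kappa> = 1 + B * (c + 1) * 2 powr c"
  have \<kappa>: "\<kappa> \<ge> 1" using B c by (simp add: \<kappa>_def)
  have "fact l / pochhammer c l \<le> \<kappa> * (real l + 1) powr (1 - c)" for l
  proof (cases "l = 0")
    case True
    then show ?thesis using \<kappa> by simp
  next
    case False
    then have l: "real l > 0" by simp
    have poch: "pochhammer c l > 0" using c by (rule pochhammer_pos)
    have "Gamma_series c l = fact l * real l powr c / (pochhammer c l * (c + real l))"
      using l by (simp add: Gamma_series_def pochhammer_Suc powr_def)
    then have "fact l * real l powr c / (pochhammer c l * (c + real l)) \<le> B"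
      using B(2)[of l] unfolding real_norm_def by linarith
    then have "(fact l / pochhammer c l) * (real l powr c / (c + real l)) \<le> B" by simp
    moreover have "real l powr c / (c + real l) > 0" using l c by simp
    ultimately have "fact l / pochhammer c l \<le> B / (real l powr c / (c + real l))"
      by (simp only: pos_le_divide_eq)
    also have "\<dots> = B * (c + real l) * real l powr (- c)" by (simp add: powr_minus field_simps)
    also have "\<dots> \<le> B * ((c + 1) * (real l + 1)) * (2 powr c * (real l + 1) powr (- c))"
    proof (rule mult_mono)
      show "B * (c + real l) \<le> B * ((c + 1) * (real l + 1))"
        using B c by (intro mult_left_mono) (auto simp: algebra_simps)
      have "real l powr (- c) \<le> ((real l + 1) / 2) powr (- c)"
        using False c by (intro powr_mono2') auto
      also have "\<dots> = 2 powr c * (real l + 1) powr (- c)"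
        by (simp add: powr_divide powr_minus field_simps)
      finally show "real l powr (- c) \<le> 2 powr c * (real l + 1) powr (- c)" .
    qed (use B c in auto)
    also have "\<dots> = (B * (c + 1) * 2 powr c) * ((real l + 1) * (real l + 1) powr (- c))" by (simp only: mult_ac)
    also have "(real l + 1) * (real l + 1) powr (- c) = (real l + 1) powr (1 - c)"
      by (simp add: powr_diff powr_minus divide_inverse)
    also have "(B * (c + 1) * 2 powr c) * (real l + 1) powr (1 - c) \<le> \<kappa> * (real l + 1) powr (1 - c)"
      by (intro mult_right_mono) (auto simp: \<kappa>_def)
    finally show ?thesis .
  qed
  with \<kappa> show ?thesis by (intro exI[of _ \<kappa>]) auto
qed

section \<open>Laguerre form of the Fischer components and their pairing with
  \<open>f\<close>\<close>

lemma prod_fact_shift: "fact j * (\<Prod>r<k. real (j + r + 1)) = fact (j + k)"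
proof (induction k)
  case (Suc k)
  have "fact j * (\<Prod>r<Suc k. real (j + r + 1)) = (fact j * (\<Prod>r<k. real (j + r + 1))) * real (j + k + 1)"
    by (simp only: prod.lessThan_Suc mult.assoc)
  then show ?case unfolding Suc.IH by (simp add: algebra_simps)
qed simp

text \<open>Links the two halves of the proof: a Fischer component of a Hermite function is (-1)^l
  l! times a Laguerre polynomial in |x|^2, times p(x) exp (-|x|^2/2).\<close>

lemma transform_gauss_harmonic:
  fixes p :: "real^'n \<Rightarrow> complex"
  assumes p: "homogeneous_poly_fun m p" and harm: "laplacian p = (\<lambda>_. 0)"
  shows "transform_gauss (m + 2 * l) ((norm_sq_mult ^^ l) p) x =
    of_real ((-1) ^ l * fact l * (\<Sum>i\<le>l. laguerre_coeff (m + CARD('n) / 2) l i * (norm x ^ (2 * i) * exp (- (norm x)\<^sup>2 / 2)))) * p x"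
proof -
  let ?c = "m + CARD('n) / 2 :: real"
  let ?P = "\<lambda>j k. \<Prod>r<k. 4 * real (j + r + 1) * (real (j + r + m) + real CARD('n) / 2)"
  have z: "(laplacian ^^ i) ((norm_sq_mult ^^ l) p) = (\<lambda>_. 0)" if "i > l" for i
  proof -
    define j where "j = i - l - 1"
    have i: "i = Suc j + l" using that by (simp add: j_def)
    have "(laplacian ^^ l) ((norm_sq_mult ^^ l) p) = (\<lambda>x. of_real (?P 0 l) * p x)"
      using laplacian_funpow_norm_sq_mult_funpow[OF p harm, of l 0] by simp
    moreover have "(laplacian ^^ Suc j) p = (\<lambda>_. 0)"
      by (simp add: funpow_swap1 harm laplacian_funpow_zero)
    ultimately show ?thesis
      unfolding i funpow_add by (simp only: o_apply laplacian_funpow_cmult[OF p] mult_zero_right)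
  qed
  have "hermite_transform (m + 2 * l) ((norm_sq_mult ^^ l) p) x =
      (\<Sum>i\<le>l. heat_coeff i * (laplacian ^^ i) ((norm_sq_mult ^^ l) p) x)"
    unfolding hermite_transform_def by (rule sum.mono_neutral_right) (auto simp: z)
  \<comment> \<open>The sum is reversed so that i counts the powers of |x|^2 that survive the
    Laplacians, as in the Laguerre polynomial.\<close>
  also have "\<dots> = (\<Sum>i<Suc l. heat_coeff (l - i) * (laplacian ^^ (l - i)) ((norm_sq_mult ^^ l) p) x)"
    using sum.nat_diff_reindex[of "\<lambda>i. heat_coeff i * (laplacian ^^ i) ((norm_sq_mult ^^ l) p) x" "Suc l"]
    by (simp only: lessThan_Suc_atMost diff_Suc_Suc)
  also have "\<dots> = (\<Sum>i\<le>l. of_real ((-1) ^ l * fact l * (laguerre_coeff ?c l i * norm x ^ (2 * i))) * p x)"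
    unfolding lessThan_Suc_atMost
  proof (rule sum.cong[OF refl])
    fix i assume "i \<in> {..l}"
    then have i: "i \<le> l" by simp
    define k where "k = l - i"
    have l: "l = i + k" using i by (simp add: k_def)
    have P: "?P i k = 4 ^ k * (fact l / fact i) * pochhammer (?c + real i) k"
    proof -
      have "?P i k = 4 ^ k * (\<Prod>r<k. real (i + r + 1)) * (\<Prod>r<k. (?c + real i + real r))"
      proof -
        have "real (i + r + m) + real CARD('n) / 2 = ?c + real i + real r" for r by simp
        then show ?thesis by (simp only: prod.distrib prod_constant card_lessThan)
      qed
      also have "(\<Prod>r<k. real (i + r + 1)) = fact l / fact i"
        using prod_fact_shift[of i k] l by (simp add: field_simps)
      also have "(\<Prod>r<k. (?c + real i + real r)) = pochhammer (?c + real i) k"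
        by (simp add: pochhammer_prod lessThan_atLeast0)
      finally show ?thesis .
    qed
    have "heat_coeff k * of_real (?P i k) = of_real ((-1) ^ l * fact l * laguerre_coeff ?c l i)"
    proof -
      have "heat_coeff k = of_real ((-1/4) ^ k / fact k)" by (simp add: heat_coeff_def)
      moreover have "(-1/4) ^ k / fact k * ?P i k = (-1) ^ l * fact l * laguerre_coeff ?c l i"
      proof -
        have "(-1/4 :: real) ^ k * 4 ^ k = (-1) ^ k" by (simp flip: power_mult_distrib)
        moreover have "(-1 :: real) ^ l * (-1) ^ i = (-1) ^ k"
          by (simp add: l power_add mult_ac flip: power_mult_distrib)
        moreover have "(-1/4) ^ k / fact k * ?P i k = ((-1/4) ^ k * 4 ^ k) * (fact l * pochhammer (?c + real i) k / (fact i * fact k))"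
          unfolding P by (simp add: mult_ac)
        moreover have "(-1) ^ l * fact l * laguerre_coeff ?c l i = ((-1) ^ l * (-1) ^ i) * (fact l * pochhammer (?c + real i) k / (fact i * fact k))"
          unfolding laguerre_coeff_def k_def by simp
        ultimately show ?thesis by simp
      qed
      ultimately show ?thesis by (simp only: of_real_mult[symmetric])
    qed
    moreover have "(laplacian ^^ k) ((norm_sq_mult ^^ l) p) x = of_real (?P i k) * (of_real (norm x ^ (2 * i)) * p x)"
      using laplacian_funpow_norm_sq_mult_funpow[OF p harm, of k i] by (simp add: l norm_sq_mult_funpow)
    ultimately show "heat_coeff (l - i) * (laplacian ^^ (l - i)) ((norm_sq_mult ^^ l) p) x =
        of_real ((-1) ^ l * fact l * (laguerre_coeff ?c l i * norm x ^ (2 * i))) * p x"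
      unfolding k_def[symmetric] by (simp only: of_real_mult mult.assoc[symmetric])
  qed
  finally show ?thesis
    unfolding transform_gauss_def
    by (simp add: sum_distrib_left sum_distrib_right mult_ac)
qed

lemma gauss_dominated_norm_power_mult:
  assumes "gauss_dominated a m A q"
  shows "gauss_dominated a (m + i) A (\<lambda>x. q x * of_real (norm x ^ i))"
proof -
  have [measurable]: "q \<in> borel_measurable borel" using assms by (simp add: gauss_dominated_def)
  have "AE x in lborel. norm (q x * of_real (norm x ^ i)) \<le> A * norm x ^ (m + i) * exp (- a * (norm x)\<^sup>2 / 2)"
    using assms unfolding gauss_dominated_def
  proof (elim conjE eventually_mono)
    fix x assume "norm (q x) \<le> A * norm x ^ m * exp (- a * (norm x)\<^sup>2 / 2)"
    then have "norm (q x) * norm x ^ i \<le> (A * norm x ^ m * exp (- a * (norm x)\<^sup>2 / 2)) * norm x ^ i"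
      by (intro mult_right_mono) auto
    then show "norm (q x * of_real (norm x ^ i)) \<le> A * norm x ^ (m + i) * exp (- a * (norm x)\<^sup>2 / 2)"
      by (simp add: norm_mult norm_power power_add mult_ac)
  qed
  moreover have "(\<lambda>x. q x * of_real (norm x ^ i)) \<in> borel_measurable borel" by measurable
  ultimately show ?thesis using assms by (simp add: gauss_dominated_def)
qed

lemma integrable_gauss_dominated_gauss:
  assumes q: "gauss_dominated a m A q" and a: "a > 0"
  shows "integrable lborel (\<lambda>x. q x * of_real (norm x ^ i * exp (- (norm x)\<^sup>2 / 2)))"
proof -
  have "integrable lborel (\<lambda>x. q x * of_real (norm x ^ i) * exp (- 1 * of_real ((norm x)\<^sup>2 / 2)))"
    by (rule gauss_dominated_integrable[OF gauss_dominated_norm_power_mult[OF q]]) (use a in simp)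
  moreover have "exp (- 1 * complex_of_real ((norm x)\<^sup>2 / 2)) = of_real (exp (- (norm x)\<^sup>2 / 2))" for x :: "real^'a"
    by (simp flip: exp_of_real)
  ultimately show ?thesis by (simp only: of_real_mult mult.assoc)
qed

lemma integrable_mult_transform_gauss:
  fixes f p :: "real^'n \<Rightarrow> complex"
  assumes f: "f \<in> borel_measurable borel" "AE x in lborel. norm (f x) \<le> C0 * exp (- (1/2) * a * (norm x)\<^sup>2)" "C0 \<ge> 0"
    and a: "a > 0" and p: "homogeneous_poly_fun k p"
  shows "integrable lborel (\<lambda>x. f x * cnj (transform_gauss k p x))"
proof -
  have int: "integrable lborel (\<lambda>x. f x * cnj (q x) * of_real (exp (- (norm x)\<^sup>2 / 2)))"
    if q: "homogeneous_poly_fun j q" for q :: "real^'n \<Rightarrow> complex" and j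
  proof -
    obtain A where A: "A \<ge> 0" "\<And>x. norm (q x) \<le> A * norm x ^ j"
      using homogeneous_norm_bound[OF q] by blast
    have "gauss_dominated a j (C0 * A) (\<lambda>x. f x * cnj (q x))"
      by (rule gauss_dominated_mult_poly[OF f homogeneous_measurable[OF homogeneous_cnj[OF q]] _ A(1)])
         (use A in simp)
    from integrable_gauss_dominated_gauss[OF this a, of 0] show ?thesis by simp
  qed
  have "(\<lambda>x. f x * cnj (transform_gauss k p x)) =
    (\<lambda>x. \<Sum>i\<le>k. cnj (heat_coeff i) * (f x * cnj ((laplacian ^^ i) p x) * of_real (exp (- (norm x)\<^sup>2 / 2))))"
    unfolding transform_gauss_def hermite_transform_def
    by (simp add: sum_distrib_left sum_distrib_right mult_ac)
  then show ?thesis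
    using int[OF homogeneous_laplacian_funpow[OF p]] by (auto intro!: integrable_mult_right)
qed

lemma L2_inner_transform_gauss_harmonic:
  fixes f p :: "real^'n \<Rightarrow> complex"
  assumes f: "f \<in> borel_measurable borel" "AE x in lborel. norm (f x) \<le> C0 * exp (- (1/2) * a * (norm x)\<^sup>2)" "C0 \<ge> 0"
    and a: "a > 0" and p: "homogeneous_poly_fun m p" and harm: "laplacian p = (\<lambda>_. 0)"
  shows "L2_inner lborel f (transform_gauss (m + 2 * l) ((norm_sq_mult ^^ l) p)) =
    of_real ((-1) ^ l * fact l) * (\<Sum>i\<le>l. of_real (laguerre_coeff (m + CARD('n) / 2) l i) *
      (LINT x|lborel. f x * cnj (p x) * of_real (norm x ^ (2 * i) * exp (- (norm x)\<^sup>2 / 2))))"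
proof -
  let ?c = "m + CARD('n) / 2 :: real"
  obtain A where A: "A \<ge> 0" "\<And>x. norm (p x) \<le> A * norm x ^ m"
    using homogeneous_norm_bound[OF p] by blast
  have "gauss_dominated a m (C0 * A) (\<lambda>x. f x * cnj (p x))"
    by (rule gauss_dominated_mult_poly[OF f homogeneous_measurable[OF homogeneous_cnj[OF p]] _ A(1)])
       (use A in simp)
  note int = integrable_gauss_dominated_gauss[OF this a]
  have "f x * cnj (transform_gauss (m + 2 * l) ((norm_sq_mult ^^ l) p) x) =
    of_real ((-1) ^ l * fact l) * (\<Sum>i\<le>l. of_real (laguerre_coeff ?c l i) *
      (f x * cnj (p x) * of_real (norm x ^ (2 * i) * exp (- (norm x)\<^sup>2 / 2))))" for x
  proof -
    have "f x * cnj (transform_gauss (m + 2 * l) ((norm_sq_mult ^^ l) p) x) =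
      of_real ((-1) ^ l * fact l) * (of_real (\<Sum>i\<le>l. laguerre_coeff ?c l i * (norm x ^ (2 * i) * exp (- (norm x)\<^sup>2 / 2))) * (f x * cnj (p x)))"
      unfolding transform_gauss_harmonic[OF p harm] by (simp only: complex_cnj_mult complex_cnj_complex_of_real of_real_mult mult_ac)
    also have "of_real (\<Sum>i\<le>l. laguerre_coeff ?c l i * (norm x ^ (2 * i) * exp (- (norm x)\<^sup>2 / 2))) * (f x * cnj (p x)) =
      (\<Sum>i\<le>l. of_real (laguerre_coeff ?c l i) * (f x * cnj (p x) * of_real (norm x ^ (2 * i) * exp (- (norm x)\<^sup>2 / 2))))"
      unfolding of_real_sum sum_distrib_right by (simp only: of_real_mult mult_ac)
    finally show ?thesis .
  qed
  then have "L2_inner lborel f (transform_gauss (m + 2 * l) ((norm_sq_mult ^^ l) p)) =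
    (LINT x|lborel. of_real ((-1) ^ l * fact l) * (\<Sum>i\<le>l. of_real (laguerre_coeff ?c l i) *
      (f x * cnj (p x) * of_real (norm x ^ (2 * i) * exp (- (norm x)\<^sup>2 / 2)))))"
    unfolding L2_inner_def by presburger
  also have "\<dots> = of_real ((-1) ^ l * fact l) * (LINT x|lborel. (\<Sum>i\<le>l. of_real (laguerre_coeff ?c l i) *
      (f x * cnj (p x) * of_real (norm x ^ (2 * i) * exp (- (norm x)\<^sup>2 / 2)))))"
    by (rule integral_mult_right_zero)
  also have "(LINT x|lborel. (\<Sum>i\<le>l. of_real (laguerre_coeff ?c l i) *
      (f x * cnj (p x) * of_real (norm x ^ (2 * i) * exp (- (norm x)\<^sup>2 / 2))))) =
    (\<Sum>i\<le>l. of_real (laguerre_coeff ?c l i) * (LINT x|lborel. f x * cnj (p x) * of_real (norm x ^ (2 * i) * exp (- (norm x)\<^sup>2 / 2))))"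
    by (subst Bochner_Integration.integral_sum) (auto intro!: integrable_mult_right int simp only: integral_mult_right_zero)
  finally show ?thesis .
qed

text \<open>The inner product conjugates its second argument, so the pairing bound is applied to the
  conjugate of \<open>p\<close>, which must again be harmonic.\<close>

lemma laplacian_cnj:
  assumes p: "homogeneous_poly_fun k (p :: real^'n \<Rightarrow> complex)"
  shows "laplacian (\<lambda>x. cnj (p x)) = (\<lambda>x. cnj (laplacian p x))"
proof -
  have pd: "partial_deriv j (\<lambda>x. cnj (q x)) = (\<lambda>x. cnj (partial_deriv j q x))"
    if q: "homogeneous_poly_fun l q" for j l and q :: "real^'n \<Rightarrow> complex"
  proof
    fix x
    have "(q has_derivative frechet_derivative q (at x)) (at x)"
      using homogeneous_differentiable[OF q] frechet_derivative_works by blast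
    then have "((\<lambda>x. cnj (q x)) has_derivative (\<lambda>h. cnj (frechet_derivative q (at x) h))) (at x)"
      by (rule has_derivative_cnj)
    from frechet_derivative_at[OF this, symmetric]
    show "partial_deriv j (\<lambda>x. cnj (q x)) x = cnj (partial_deriv j q x)"
      by (simp add: partial_deriv_def)
  qed
  show ?thesis
    unfolding laplacian_def[abs_def] pd[OF p] pd[OF homogeneous_partial_deriv[OF p]] by simp
qed

text \<open>Each summand \<open>|x|\<^sup>2\<^sup>l p\<close> of the Fischer decomposition contributes
  \<open>l! \<cdot> O((l + 1)\<^bsup>(m+n)/2-1\<^esup> R\<^bsup>-l\<^esup>)\<close> while its own norm is \<open>sqrt (l! (m + n/2)\<^sub>l)\<close> times that of \<open>p\<close>.\<close>

lemma harmonic_component_bound: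
  fixes f :: "real^'n \<Rightarrow> complex"
  assumes R: "R > 1" and L1: "integrable lborel f" and C0: "C0 \<ge> 0"
    and f_bound: "AE x in lborel. norm (f x) \<le> C0 * exp (- (1/2) * ((R\<^sup>2 - 1) / (R\<^sup>2 + 1)) * (norm x)\<^sup>2)"
    and fhat_bound: "\<And>x. norm (fourier f x) \<le> C0 * exp (- (1/2) * ((R\<^sup>2 - 1) / (R\<^sup>2 + 1)) * (norm x)\<^sup>2)"
  shows "\<exists>K>0. \<forall>p l. homogeneous_poly_fun m p \<longrightarrow> laplacian p = (\<lambda>_. 0) \<longrightarrow>
    norm (L2_inner lborel f (transform_gauss (m + 2 * l) ((norm_sq_mult ^^ l) p))) \<le>
      K * (real l + 1) powr ((real CARD('n) - 2) / 4) * R powr (- real l) *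
      L2_norm lborel (transform_gauss (m + 2 * l) ((norm_sq_mult ^^ l) p))"
proof -
  let ?c = "m + CARD('n) / 2 :: real" and ?a = "(R\<^sup>2 - 1) / (R\<^sup>2 + 1)"
  have a: "?a > 0" using R by (simp add: add_nonneg_pos)
  have c: "?c > 0" by (simp add: add_nonneg_pos)
  have fm: "f \<in> borel_measurable borel" using borel_measurable_integrable[OF L1] by simp
  obtain K1 where K1: "K1 > 0" "\<And>A p l. A \<ge> 0 \<Longrightarrow> homogeneous_poly_fun m p \<Longrightarrow> laplacian p = (\<lambda>_. 0) \<Longrightarrow>
    (\<And>x. norm (p x) \<le> A * norm x ^ m) \<Longrightarrow>
    norm (\<Sum>i\<le>l. of_real (laguerre_coeff ?c l i) *
        (LINT x|lborel. f x * p x * of_real (norm x ^ (2 * i) * exp (- (norm x)\<^sup>2 / 2))))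
      \<le> K1 * A * (real l + 1) powr ((m + CARD('n)) / 2 - 1) * R powr (- real l)"
    using laguerre_pairing_bound[OF R L1 C0 f_bound fhat_bound, of m] by blast
  obtain K2 where K2: "K2 > 0" "\<And>p x. homogeneous_poly_fun m p \<Longrightarrow>
    norm (p (x :: real^'n)) \<le> K2 * L2_norm lborel (transform_gauss m p) * norm x ^ m"
    using homogeneous_bound[where ?'n='n and k=m] by blast
  obtain \<kappa> where \<kappa>: "\<kappa> > 0" "\<And>l. fact l / pochhammer ?c l \<le> \<kappa> * (real l + 1) powr (1 - ?c)"
    using fact_div_pochhammer_le[OF c] by blast
  define K where "K = K1 * K2 * sqrt \<kappa>"
  have "K > 0" using K1 K2 \<kappa> by (simp add: K_def)
  moreover have "norm (L2_inner lborel f (transform_gauss (m + 2 * l) ((norm_sq_mult ^^ l) p))) \<le>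
      K * (real l + 1) powr ((real CARD('n) - 2) / 4) * R powr (- real l) *
      L2_norm lborel (transform_gauss (m + 2 * l) ((norm_sq_mult ^^ l) p))"
    if p: "homogeneous_poly_fun m p" and harm: "laplacian p = (\<lambda>_. 0)" for p l
  proof -
    let ?u = "transform_gauss (m + 2 * l) ((norm_sq_mult ^^ l) p)"
    define N where "N = L2_norm lborel (transform_gauss m p)"
    have N0: "N \<ge> 0" by (simp add: N_def L2_norm_def)
    have poch: "pochhammer ?c l > 0" using c by (rule pochhammer_pos)
    have u: "L2_norm lborel ?u = sqrt (fact l * pochhammer ?c l) * N"
    proof -
      have "L2_norm lborel ?u = sqrt (fact l * pochhammer ?c l * Re (hermite_inner m p p))"
        unfolding L2_norm_transform_gauss hermite_inner_harmonic_self[OF p harm] by simp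
      then show ?thesis unfolding N_def L2_norm_transform_gauss by (simp only: real_sqrt_mult)
    qed
    have cp: "homogeneous_poly_fun m (\<lambda>x. cnj (p x))" "laplacian (\<lambda>x. cnj (p x)) = (\<lambda>_. 0)"
      using homogeneous_cnj[OF p] laplacian_cnj[OF p] harm by simp_all
    have b: "norm (cnj (p x)) \<le> (K2 * N) * norm x ^ m" for x
      using K2(2)[OF p] by (simp add: N_def)
    have "norm (L2_inner lborel f ?u) \<le> fact l * (K1 * (K2 * N) * (real l + 1) powr ((m + CARD('n)) / 2 - 1) * R powr (- real l))"
    proof -
      have "norm (complex_of_real ((-1) ^ l * fact l)) = fact l"
        by (simp only: norm_of_real abs_mult power_abs abs_minus_cancel abs_one power_one fact_ge_zero abs_of_nonneg mult_1)
      then show ?thesis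
        unfolding L2_inner_transform_gauss_harmonic[OF fm f_bound C0 a p harm] norm_mult
        using K1(2)[OF _ cp b, of l] K2(1) N0 by (simp only:) (intro mult_left_mono, auto)
    qed
    also have "\<dots> = (K1 * K2 * N * R powr (- real l) * (real l + 1) powr ((m + CARD('n)) / 2 - 1)) * fact l"
      by (simp only: mult_ac)
    \<comment> \<open>l! is split so that one root supplies the norm of the component and the other
      decays like a power of l.\<close>
    also have "(fact l :: real) = sqrt (fact l / pochhammer ?c l) * sqrt (fact l * pochhammer ?c l)"
    proof -
      have "fact l / pochhammer ?c l * (fact l * pochhammer ?c l) = (fact l)\<^sup>2"
        using poch by (simp add: power2_eq_square)
      then show ?thesis by (simp only: real_sqrt_mult[symmetric]) simp
    qed
    also have "(K1 * K2 * N * R powr (- real l) * (real l + 1) powr ((m + CARD('n)) / 2 - 1)) * (sqrt (fact l / pochhammer ?c l) * sqrt (fact l * pochhammer ?c l)) =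
      (K1 * K2 * R powr (- real l) * (real l + 1) powr ((m + CARD('n)) / 2 - 1) * L2_norm lborel ?u) * sqrt (fact l / pochhammer ?c l)"
      unfolding u by (simp only: mult_ac)
    also have "\<dots> \<le> (K1 * K2 * R powr (- real l) * (real l + 1) powr ((m + CARD('n)) / 2 - 1) * L2_norm lborel ?u) *
        (sqrt \<kappa> * (real l + 1) powr ((1 - ?c) / 2))"
    proof (rule mult_left_mono)
      have "sqrt (fact l / pochhammer ?c l) \<le> sqrt (\<kappa> * (real l + 1) powr (1 - ?c))"
        using \<kappa>(2) by (rule real_sqrt_le_mono)
      also have "\<dots> = sqrt \<kappa> * (real l + 1) powr ((1 - ?c) / 2)"
        by (simp add: real_sqrt_mult powr_half_sqrt[symmetric] powr_powr)
      finally show "sqrt (fact l / pochhammer ?c l) \<le> sqrt \<kappa> * (real l + 1) powr ((1 - ?c) / 2)" .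
      show "0 \<le> K1 * K2 * R powr (- real l) * (real l + 1) powr ((m + CARD('n)) / 2 - 1) * L2_norm lborel ?u"
        using K1(1) K2(1) by (intro mult_nonneg_nonneg) (auto simp: L2_norm_def)
    qed
    also have "\<dots> = K * ((real l + 1) powr ((m + CARD('n)) / 2 - 1) * (real l + 1) powr ((1 - ?c) / 2)) * R powr (- real l) * L2_norm lborel ?u"
      by (simp only: K_def mult_ac)
    \<comment> \<open>(m+n)/2 - 1 + (1 - m - n/2)/2 = (n-2)/4: the degree \<open>m\<close> drops
      out.\<close>
    also have "(real l + 1) powr ((m + CARD('n)) / 2 - 1) * (real l + 1) powr ((1 - ?c) / 2) = (real l + 1) powr ((real CARD('n) - 2) / 4)"
      unfolding powr_add[symmetric] by (rule arg_cong[of _ _ "(powr) (real l + 1)"]) (simp add: field_simps)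
    finally show ?thesis .
  qed
  ultimately show ?thesis by blast
qed

text \<open>The exponent (n-2)/4 is negative for n = 1, so comparable bases are needed in both
  directions; hence the absolute value.\<close>

lemma powr_comparable:
  fixes x y D \<gamma> :: real
  assumes "1 \<le> x" "x \<le> y" "y \<le> D * x" "D \<ge> 1"
  shows "x powr \<gamma> \<le> D powr \<bar>\<gamma>\<bar> * y powr \<gamma>"
proof (cases "\<gamma> \<ge> 0")
  case True
  have "1 * x powr \<gamma> \<le> D powr \<bar>\<gamma>\<bar> * y powr \<gamma>"
    using assms True by (intro mult_mono powr_mono2 ge_one_powr_ge_zero) auto
  then show ?thesis by simp
next
  case False
  have "x powr \<gamma> \<le> (y / D) powr \<gamma>"
    using assms False by (intro powr_mono2') (auto simp: field_simps)
  also have "\<dots> = D powr \<bar>\<gamma>\<bar> * y powr \<gamma>"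
    using assms False by (simp add: powr_divide powr_minus field_simps)
  finally show ?thesis .
qed

theorem theorem1p4:
  fixes f :: "real^'n \<Rightarrow> complex"
    and d :: "nat \<Rightarrow> nat"
    and Y :: "nat \<Rightarrow> nat \<Rightarrow> real^'n \<Rightarrow> complex"
    and C\<^sub>0 a t :: real
  assumes basis: "spherical_harmonic_basis d Y"
    and L1: "integrable lborel f"
    and C0: "C\<^sub>0 > 0"
    and a: "0 < a" "a < 1"
    and f_bound: "AE x in lborel. norm (f x) \<le> C\<^sub>0 * exp (- (1/2) * a * (norm x)\<^sup>2)"
    and fhat_bound: "\<And>x. norm (fourier f x) \<le> C\<^sub>0 * exp (- (1/2) * a * (norm x)\<^sup>2)"
    and fin: "On_finite d Y f"
    and t: "t > 0" "a = tanh (2 * t)"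
  shows "\<exists>C>0. \<forall>k. L2_norm lborel (hermite_proj k f)
           \<le> C * (2 * real k + real CARD('n)) powr ((real CARD('n) - 2) / 4)
               * exp (- (2 * real k + real CARD('n)) * t / 2)"
proof -
  let ?n = "real CARD('n)" and ?\<gamma> = "(real CARD('n) - 2) / 4"
  define R where "R = exp (2 * t)"
  have R: "R > 1" using t by (simp add: R_def)
  have aR: "a = (R\<^sup>2 - 1) / (R\<^sup>2 + 1)"
  proof -
    have "exp (- 2 * (2 * t)) = 1 / R\<^sup>2"
      unfolding R_def by (simp add: exp_minus inverse_eq_divide flip: exp_double)
    then have "a = (1 - 1 / R\<^sup>2) / (1 + 1 / R\<^sup>2)"
      unfolding t(2) tanh_real_altdef by simp
    also have "\<dots> = (R\<^sup>2 - 1) / (R\<^sup>2 + 1)" using R by (simp add: divide_simps)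
    finally show ?thesis .
  qed
  have C0': "C\<^sub>0 \<ge> 0" using C0 by simp
  have fm: "f \<in> borel_measurable borel" using borel_measurable_integrable[OF L1] by simp
  have int: "integrable lborel (\<lambda>x. f x * cnj (transform_gauss k p x))" if "homogeneous_poly_fun k p" for k p
    by (rule integrable_mult_transform_gauss[OF fm f_bound C0' a(1) that])
  obtain M where M: "\<And>m p \<phi>. m > M \<Longrightarrow> homogeneous_poly_fun m p \<Longrightarrow> laplacian p = (\<lambda>_. 0) \<Longrightarrow>
    integrable lborel (\<lambda>x. f x * (\<phi> (norm x) * cnj (p x))) \<Longrightarrow>
    (LINT x|lborel. f x * (\<phi> (norm x) * cnj (p x))) = 0"
    using On_finite_orthogonal[OF basis fin L1] by blast
  have "\<exists>K>0. \<forall>p l. homogeneous_poly_fun m p \<longrightarrow> laplacian p = (\<lambda>_. 0) \<longrightarrow>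
    norm (L2_inner lborel f (transform_gauss (m + 2 * l) ((norm_sq_mult ^^ l) p))) \<le>
      K * (real l + 1) powr ?\<gamma> * R powr (- real l) *
      L2_norm lborel (transform_gauss (m + 2 * l) ((norm_sq_mult ^^ l) p))" for m
    by (rule harmonic_component_bound[OF R L1 C0' f_bound[unfolded aR] fhat_bound[unfolded aR]])
  then obtain K where K: "\<And>m. K m > 0" "\<And>m p l. homogeneous_poly_fun m p \<Longrightarrow> laplacian p = (\<lambda>_. 0) \<Longrightarrow>
    norm (L2_inner lborel f (transform_gauss (m + 2 * l) ((norm_sq_mult ^^ l) p))) \<le>
      K m * (real l + 1) powr ?\<gamma> * R powr (- real l) *
      L2_norm lborel (transform_gauss (m + 2 * l) ((norm_sq_mult ^^ l) p))"
    by metis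
  \<comment> \<open>If k = i + 2l with i <= M, then 2k + n <= D (l + 1), so powers of l + 1 and of
    2k + n are comparable.\<close>
  define D where "D = 2 * real M + ?n + 4"
  \<comment> \<open>The exponential absorbs two shifts: k - 2l <= M, and the n/2 inside exp
    (-(2k+n)t/2). The sum of the K m gives one constant for all surviving degrees.\<close>
  define E where "E = (\<Sum>m\<le>M. K m) * D powr \<bar>?\<gamma>\<bar> * exp (t * (real M + ?n / 2))"
  have E: "E > 0"
  proof -
    have "(\<Sum>m\<le>M. K m) > 0" using K(1) by (intro sum_pos) auto
    moreover have "D > 0" by (simp add: D_def add_nonneg_pos)
    ultimately show ?thesis by (simp add: E_def)
  qed
  have "L2_norm lborel (hermite_proj k f) \<le> (real M + 1) * E * (2 * real k + ?n) powr ?\<gamma> * exp (- (2 * real k + ?n) * t / 2)" for k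
  proof -
    define X where "X = (2 * real k + ?n) powr ?\<gamma> * exp (- (2 * real k + ?n) * t / 2)"
    have X: "X \<ge> 0" by (simp add: X_def)
    let ?S = "{\<alpha> :: 'n \<Rightarrow> nat. sum \<alpha> UNIV = k}"
    \<comment> \<open>Chosen so that \<open>transform_gauss k p\<close> is the projection itself:
      \<open>Hermite \<alpha>\<close> is \<open>hermite_gauss \<alpha>\<close> divided by the root
      of its weight.\<close>
    define c where "c \<alpha> = L2_inner lborel f (Hermite \<alpha>) * of_real (1 / sqrt (hermite_weight \<alpha>))" for \<alpha>
    define p where "p = (\<lambda>x :: real^'n. \<Sum>\<alpha>\<in>?S. c \<alpha> * monom_fun \<alpha> x)"
    have hm: "homogeneous_poly_fun k (monom_fun \<alpha>)" if "\<alpha> \<in> ?S" for \<alpha>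
      using homogeneous_monom_fun[of \<alpha>] that by simp
    have p: "homogeneous_poly_fun k p"
      unfolding p_def by (intro homogeneous_sum homogeneous_cmult hm)
    define u where "u = transform_gauss k p"
    have u_sum: "u = (\<lambda>x. \<Sum>\<alpha>\<in>?S. c \<alpha> * hermite_gauss \<alpha> x)"
    proof -
      have "u = (\<lambda>x. \<Sum>\<alpha>\<in>?S. transform_gauss k (\<lambda>x. c \<alpha> * monom_fun \<alpha> x) x)"
        unfolding u_def p_def by (rule transform_gauss_sum) (intro homogeneous_cmult hm)
      then show ?thesis
        by (simp add: transform_gauss_cmult[OF hm] transform_gauss_monom_fun)
    qed
    have proj: "hermite_proj k f = u"
      unfolding u_sum hermite_proj_def[abs_def] Hermite_eq_hermite_gauss c_def
      by (simp add: mult.assoc)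
    define N where "N = L2_norm lborel u"
    have N0: "N \<ge> 0" by (simp add: N_def L2_norm_def)
    have Nsq: "N\<^sup>2 = (\<Sum>\<alpha>\<in>?S. (norm (c \<alpha>))\<^sup>2 * hermite_weight \<alpha>)"
    proof -
      have "(\<Sum>\<alpha>\<in>?S. (norm (c \<alpha>))\<^sup>2 * hermite_weight \<alpha>) \<ge> 0"
        by (intro sum_nonneg mult_nonneg_nonneg less_imp_le[OF hermite_weight_pos]) auto
      then show ?thesis
        unfolding N_def u_def L2_norm_transform_gauss hermite_inner_self_ge[OF p_def] by simp
    qed
    \<comment> \<open>(f, P_k f) is the squared norm of P_k f. A bound for the pairing that is
      linear in N therefore becomes a bound for N.\<close>
    have inner_u: "L2_inner lborel f u = of_real (N\<^sup>2)"
    proof -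
      have "L2_inner lborel f u = (LINT x|lborel. (\<Sum>\<alpha>\<in>?S. cnj (c \<alpha>) * (f x * cnj (hermite_gauss \<alpha> x))))"
        unfolding L2_inner_def u_sum by (simp add: sum_distrib_left mult_ac)
      also have "\<dots> = (\<Sum>\<alpha>\<in>?S. cnj (c \<alpha>) * L2_inner lborel f (hermite_gauss \<alpha>))"
        unfolding L2_inner_def
        by (subst Bochner_Integration.integral_sum)
           (use int[OF hm] in \<open>auto simp: transform_gauss_monom_fun intro!: integrable_mult_right\<close>)
      also have "\<dots> = (\<Sum>\<alpha>\<in>?S. of_real ((norm (c \<alpha>))\<^sup>2 * hermite_weight \<alpha>))"
      proof (rule sum.cong[OF refl])
        fix \<alpha> :: "'n \<Rightarrow> nat"
        let ?w = "hermite_weight \<alpha>"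
        have w: "?w > 0" by (rule hermite_weight_pos)
        have "L2_inner lborel f (Hermite \<alpha>) = (LINT x|lborel. of_real (1 / sqrt ?w) * (f x * cnj (hermite_gauss \<alpha> x)))"
          unfolding L2_inner_def Hermite_eq_hermite_gauss by (simp add: mult_ac)
        also have "\<dots> = of_real (1 / sqrt ?w) * L2_inner lborel f (hermite_gauss \<alpha>)"
          unfolding L2_inner_def by (rule integral_mult_right_zero)
        finally have "c \<alpha> = of_real (1 / sqrt ?w * (1 / sqrt ?w)) * L2_inner lborel f (hermite_gauss \<alpha>)"
          unfolding c_def of_real_mult by (simp only: mult_ac)
        also have "1 / sqrt ?w * (1 / sqrt ?w) = 1 / ?w" using w by (simp flip: real_sqrt_mult)
        finally have "of_real ?w * c \<alpha> = of_real ?w * (of_real (1 / ?w) * L2_inner lborel f (hermite_gauss \<alpha>))"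
          by (rule arg_cong)
        also have "\<dots> = L2_inner lborel f (hermite_gauss \<alpha>)"
          using w by (simp only: mult.assoc[symmetric] of_real_mult[symmetric]) simp
        finally have L: "L2_inner lborel f (hermite_gauss \<alpha>) = of_real ?w * c \<alpha>" ..
        show "cnj (c \<alpha>) * L2_inner lborel f (hermite_gauss \<alpha>) = of_real ((norm (c \<alpha>))\<^sup>2 * ?w)"
          unfolding L of_real_mult complex_norm_square by (simp only: mult_ac)
      qed
      finally show ?thesis unfolding Nsq of_real_sum .
    qed
    obtain Q where Q: "\<And>l. l \<le> k div 2 \<Longrightarrow> homogeneous_poly_fun (k - 2 * l) (Q l)"
      "\<And>l. l \<le> k div 2 \<Longrightarrow> laplacian (Q l) = (\<lambda>_. 0)"
      "p = (\<lambda>x. \<Sum>l\<le>k div 2. (norm_sq_mult ^^ l) (Q l) x)"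
      by (rule Fischer_decomposition[OF p]) blast
    define P where "P l = (norm_sq_mult ^^ l) (Q l)" for l
    have kl: "k - 2 * l + 2 * l = k" if "l \<le> k div 2" for l using that by simp
    have P: "homogeneous_poly_fun k (P l)" if l: "l \<le> k div 2" for l
      using homogeneous_norm_sq_mult_funpow[OF Q(1)[OF l], of l] unfolding P_def kl[OF l] .
    have pP: "p = (\<lambda>x. \<Sum>l\<le>k div 2. P l x)" using Q(3) unfolding P_def .
    have orth: "hermite_inner k (P l) (P l') = 0" if l: "l \<le> k div 2" "l' \<le> k div 2" "l' < l" for l l'
      using hermite_inner_harmonic_orthogonal[OF Q(1)[OF l(1)] Q(1)[OF l(2)] Q(2)[OF l(2)], of l l'] l(3)
      unfolding P_def kl[OF l(1)] kl[OF l(2)] by simp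
    have orth': "hermite_inner k (P l) (P l') = 0" if l: "l \<le> k div 2" "l' \<le> k div 2" "l' \<noteq> l" for l l'
    proof (cases "l' < l")
      case True
      then show ?thesis using orth l by blast
    next
      case False
      then have "hermite_inner k (P l') (P l) = 0" using orth l by auto
      then show ?thesis by (subst hermite_inner_cnj) simp
    qed
    have Re_nonneg: "Re (hermite_inner k q q) = (L2_norm lborel (transform_gauss k q))\<^sup>2" for q :: "real^'n \<Rightarrow> complex"
    proof -
      have "hermite_inner k q q = of_real (LINT x|lborel. (norm (transform_gauss k q x))\<^sup>2)"
        unfolding hermite_inner_def L2_inner_def complex_norm_square[symmetric] integral_complex_of_real ..
      then show ?thesis by (simp add: L2_norm_def)
    qed
    \<comment> \<open>Pythagoras: the Fischer components are mutually orthogonal in L2, so none of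
      them is longer than their sum.\<close>
    have Nl: "L2_norm lborel (transform_gauss k (P l)) \<le> N" if l: "l \<le> k div 2" for l
    proof -
      have "hermite_inner k p p = (\<Sum>i\<le>k div 2. hermite_inner k (P i) p)"
        by (subst (1) pP, subst hermite_inner_sum_left) (auto intro: P p)
      also have "\<dots> = (\<Sum>i\<le>k div 2. hermite_inner k (P i) (P i))"
      proof (rule sum.cong[OF refl])
        fix i assume "i \<in> {..k div 2}"
        then have i: "i \<le> k div 2" by simp
        have "hermite_inner k (P i) p = (\<Sum>j\<le>k div 2. hermite_inner k (P i) (P j))"
          by (subst (1) pP, subst hermite_inner_sum_right) (auto intro: P i)
        also have "\<dots> = (\<Sum>j\<le>k div 2. if j = i then hermite_inner k (P i) (P i) else 0)"
          using orth'[OF i] by (intro sum.cong) auto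
        finally show "hermite_inner k (P i) p = hermite_inner k (P i) (P i)" using i by simp
      qed
      finally have "N\<^sup>2 = (\<Sum>i\<le>k div 2. (L2_norm lborel (transform_gauss k (P i)))\<^sup>2)"
        using Re_nonneg[of p] by (simp add: Re_nonneg N_def u_def)
      then have "(L2_norm lborel (transform_gauss k (P l)))\<^sup>2 \<le> N\<^sup>2"
        using l member_le_sum[of l "{..k div 2}" "\<lambda>i. (L2_norm lborel (transform_gauss k (P i)))\<^sup>2"] by simp
      then show ?thesis using N0 by (rule power2_le_imp_le)
    qed
    have sum_l: "L2_inner lborel f u = (\<Sum>l\<le>k div 2. L2_inner lborel f (transform_gauss k (P l)))"
    proof -
      have "u = (\<lambda>x. \<Sum>l\<le>k div 2. transform_gauss k (P l) x)"
        unfolding u_def by (subst pP, rule transform_gauss_sum) (auto intro: P)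
      then show ?thesis
        unfolding L2_inner_def using int[OF P] by (simp add: sum_distrib_left)
    qed
    have zero: "L2_inner lborel f (transform_gauss k (P l)) = 0" if l: "l \<le> k div 2" and m: "k - 2 * l > M" for l
    proof -
      \<comment> \<open>The radial factor of the component is real, so conjugation affects only the
        harmonic polynomial and \<open>M\<close> applies.\<close>
      define \<phi> where "\<phi> r = complex_of_real ((-1) ^ l * fact l *
        (\<Sum>i\<le>l. laguerre_coeff ((k - 2 * l) + CARD('n) / 2) l i * (r ^ (2 * i) * exp (- r\<^sup>2 / 2))))" for r
      have "transform_gauss k (P l) x = \<phi> (norm x) * Q l x" for x
        using transform_gauss_harmonic[OF Q(1)[OF l] Q(2)[OF l], of l x] unfolding P_def kl[OF l] \<phi>_def .
      moreover have "cnj (\<phi> r) = \<phi> r" for r unfolding \<phi>_def by (rule complex_cnj_complex_of_real)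
      ultimately have eq: "cnj (transform_gauss k (P l) x) = \<phi> (norm x) * cnj (Q l x)" for x by simp
      show ?thesis
        using M[OF m Q(1)[OF l] Q(2)[OF l], of \<phi>] int[OF P[OF l]] unfolding L2_inner_def eq by blast
    qed
    have comp: "norm (L2_inner lborel f (transform_gauss k (P l))) \<le> E * X * N"
      if l: "l \<le> k div 2" and m: "k - 2 * l \<le> M" for l
    proof -
      define i where "i = k - 2 * l"
      have i: "i \<le> M" using m by (simp add: i_def)
      have k: "real k = real i + 2 * real l" using l by (simp add: i_def)
      have "norm (L2_inner lborel f (transform_gauss k (P l))) \<le>
        K i * (real l + 1) powr ?\<gamma> * R powr (- real l) * L2_norm lborel (transform_gauss k (P l))"
        using K(2)[OF Q(1)[OF l] Q(2)[OF l], of l] unfolding P_def kl[OF l] i_def .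
      also have "\<dots> \<le> K i * (real l + 1) powr ?\<gamma> * R powr (- real l) * N"
        using K(1)[of i] by (intro mult_left_mono Nl[OF l]) auto
      also have "\<dots> \<le> ((\<Sum>m\<le>M. K m) * (D powr \<bar>?\<gamma>\<bar> * (2 * real k + ?n) powr ?\<gamma>) *
          (exp (t * (real M + ?n / 2)) * exp (- (2 * real k + ?n) * t / 2))) * N"
      proof (intro mult_right_mono N0 mult_mono)
        show "K i \<le> (\<Sum>m\<le>M. K m)"
          using i K(1) by (intro member_le_sum) (auto intro: less_imp_le)
        have n: "?n \<ge> 1" by (simp add: Suc_leI)
        show "(real l + 1) powr ?\<gamma> \<le> D powr \<bar>?\<gamma>\<bar> * (2 * real k + ?n) powr ?\<gamma>"
        proof (intro powr_comparable)
          have "2 * real k + ?n \<le> (2 * real M + ?n) * 1 + 4 * real l" using k i by simp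
          also have "\<dots> \<le> (2 * real M + ?n) * (real l + 1) + 4 * (real l + 1)"
            by (intro add_mono mult_left_mono) auto
          also have "\<dots> = D * (real l + 1)" by (simp add: D_def algebra_simps)
          finally show "2 * real k + ?n \<le> D * (real l + 1)" .
          show "real l + 1 \<le> 2 * real k + ?n" using k n by linarith
        qed (auto simp: D_def)
        have "R powr (- real l) = exp (- real l * (2 * t))"
          by (simp add: R_def powr_def)
        also have "\<dots> \<le> exp (t * (real M + ?n / 2) + - (2 * real k + ?n) * t / 2)"
        proof -
          have "t * real i \<le> t * real M" using i t(1) by simp
          moreover have "t * real k = t * real i + 2 * (t * real l)" unfolding k by (simp add: algebra_simps)
          moreover have "t * (real M + ?n / 2) + - (2 * real k + ?n) * t / 2 = t * real M - t * real k"
            by (simp add: field_simps)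
          ultimately show ?thesis by (simp only: exp_le_cancel_iff) (simp add: algebra_simps)
        qed
        finally show "R powr (- real l) \<le> exp (t * (real M + ?n / 2)) * exp (- (2 * real k + ?n) * t / 2)"
          by (simp only: exp_add)
        show "0 \<le> (\<Sum>m\<le>M. K m)" using K(1) by (intro sum_nonneg) (auto intro: less_imp_le)
        then show "0 \<le> (\<Sum>m\<le>M. K m) * (D powr \<bar>?\<gamma>\<bar> * (2 * real k + ?n) powr ?\<gamma>)" by simp
      qed auto
      also have "\<dots> = E * X * N" unfolding E_def X_def by (simp only: mult_ac)
      finally show ?thesis .
    qed
    \<comment> \<open>The indices whose harmonic degree k - 2l is at most M. Distinct l have
      distinct degrees, so there are at most M + 1 of them, independently of k.\<close>
    let ?L = "{l. l \<le> k div 2 \<and> k - 2 * l \<le> M}"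
    have fin_L: "finite ?L" by (rule finite_subset[of _ "{..k div 2}"]) auto
    have card_L: "card ?L \<le> M + 1"
    proof -
      have "inj_on (\<lambda>l. k - 2 * l) ?L" by (rule inj_onI) auto
      then have "card ?L = card ((\<lambda>l. k - 2 * l) ` ?L)" by (rule card_image[symmetric])
      also have "\<dots> \<le> card {..M}" by (intro card_mono) auto
      finally show ?thesis by simp
    qed
    have "N\<^sup>2 = norm (L2_inner lborel f u)" unfolding inner_u by (simp only: norm_of_real) simp
    also have "L2_inner lborel f u = (\<Sum>l\<in>?L. L2_inner lborel f (transform_gauss k (P l)))"
      unfolding sum_l
    proof (intro sum.mono_neutral_right ballI)
      fix l assume "l \<in> {..k div 2} - ?L"
      then have "l \<le> k div 2" "k - 2 * l > M" by auto
      then show "L2_inner lborel f (transform_gauss k (P l)) = 0" by (rule zero)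
    qed auto
    also have "norm \<dots> \<le> of_nat (card ?L) * (E * X * N)"
      by (rule sum_norm_bound) (use comp in auto)
    also have "\<dots> \<le> (real M + 1) * (E * X * N)"
      using card_L E X N0 by (intro mult_right_mono) auto
    finally have le: "N * N \<le> ((real M + 1) * E * X) * N" by (simp add: power2_eq_square mult_ac)
    \<comment> \<open>Cancel one factor N from the quadratic inequality; N = 0 is trivial.\<close>
    have "N \<le> (real M + 1) * E * X"
    proof (cases "N = 0")
      case True
      then show ?thesis using E X by simp
    next
      case False
      then show ?thesis using le N0 by (intro mult_right_le_imp_le[OF le]) simp
    qed
    then show ?thesis unfolding proj N_def X_def by (simp only: mult.assoc)
  qed
  then show ?thesis
    using E by (intro exI[of _ "(real M + 1) * E"]) auto
qed

end
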